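(* Let $\mathcal M=D/\Gamma$ be as in the context and let $C(2)^+$ be the Fricke modular curve of level $2$. Then there are isomorphisms $$\mathcal M\cong C(2)^+\cong\mathbb A^1 .$$
   Context: Let $T=A_1^{\oplus2}\oplus A_1(-1)^{\oplus2}$, where $A_1$ is the rank one lattice generated by a vector of square $-2$ and $A_1(-1)$ the one generated by a vector of square $2$. Let $\rho\in O(T)$ be the isometry given in the natural basis by $J=A\oplus A$ with $A=\begin{pmatrix}0&-1\\1&0\end{pmatrix}$. Define $$D=\{z\in\mathbb P(T\otimes\mathbb C):\rho(z)=iz,\ (z,\bar z)>0\},\qquad \Gamma=\{\gamma\in O(T):\gamma\circ\rho=\rho\circ\gamma\},\qquad \mathcal M=D/\Gamma .$$ ($\mathcal M$ is the moduli space of the $K3$ surfaces with $\mathbb Z_4$-action obtained as degree four cyclic covers of the plane branched along plane quartics with five nodes.) Let $H[2]=\left\{\begin{pmatrix}a&b\\c&d\end{pmatrix}\in PSL(2,\mathbb Z): c\equiv0\ (\mathrm{mod}\ 2)\right\}$ and $F=\begin{pmatrix}0&-1/\sqrt2\\\sqrt2&0\end{pmatrix}\in PSL(2,\mathbb R)$ (the Fricke involution, which normalizes $H[2]$). The Fricke modular group of level 2 is $H[2]^+=H[2]\cup F\,H[2]\subset PSL(2,\mathbb R)$, and the Fricke modular curve of level 2 is $C(2)^+=S/H[2]^+$, where $S=\{z\in\mathbb C:\mathrm{Im}(z)>0\}$ with the action by Möbius transformations. Isomorphisms are of Riemann surfaces, $\mathbb A^1$ being the complex affine line. *)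

theory Defs
  imports "HOL-Complex_Analysis.Complex_Analysis" "HOL-Algebra.Coset" "HOL-Number_Theory.Cong"
begin

section \<open>Spaces with functions and Riemann surfaces\<close>

text \<open>
  A complex manifold is presented here as a topological space together with its sheaf of
  holomorphic functions. The sheaf assigns to an open set \<open>U\<close> a set of total functions on the
  ambient type, of which only the values on \<open>U\<close> matter; \<open>regular\<close> is meaningful on open
  sets only. This presentation makes quotients canonical: a function on an open subset of a
  quotient is regular iff its pullback is.
\<close>

record 'a fspace =
  top_of :: "'a topology"
  regular :: "'a set \<Rightarrow> ('a \<Rightarrow> complex) set"

definition points :: "'a fspace \<Rightarrow> 'a set" where
  "points X = topspace (top_of X)"

definition function_sheaf :: "'a fspace \<Rightarrow> bool" where
  "function_sheaf X \<longleftrightarrow>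
     (\<forall>U f g. openin (top_of X) U \<and> f \<in> regular X U \<and> (\<forall>x\<in>U. g x = f x) \<longrightarrow> g \<in> regular X U) \<and>
     (\<forall>U V f. openin (top_of X) U \<and> openin (top_of X) V \<and> V \<subseteq> U \<and> f \<in> regular X U
        \<longrightarrow> f \<in> regular X V) \<and>
     (\<forall>U f. openin (top_of X) U \<and>
        (\<forall>x\<in>U. \<exists>V. openin (top_of X) V \<and> x \<in> V \<and> V \<subseteq> U \<and> f \<in> regular X V)
        \<longrightarrow> f \<in> regular X U)"

definition fspace_iso :: "'a fspace \<Rightarrow> 'b fspace \<Rightarrow> ('a \<Rightarrow> 'b) \<Rightarrow> bool" where
  "fspace_iso X Y h \<longleftrightarrow> homeomorphic_map (top_of X) (top_of Y) h \<and>
     (\<forall>U f. openin (top_of Y) U \<longrightarrow>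
        (f \<in> regular Y U \<longleftrightarrow> f \<circ> h \<in> regular X {x \<in> points X. h x \<in> U}))"

text \<open>
  The structure induced on a subset: regular functions are those that extend locally to regular
  functions of the ambient space. On a locally closed complex submanifold these are
  exactly its holomorphic functions.
\<close>

definition fs_restrict :: "'a fspace \<Rightarrow> 'a set \<Rightarrow> 'a fspace" where
  "fs_restrict X A =
     \<lparr> top_of = subtopology (top_of X) A,
       regular = (\<lambda>U. {f. \<forall>x\<in>U. \<exists>V g. openin (top_of X) V \<and> x \<in> V \<and> g \<in> regular X V \<and>
                              (\<forall>y\<in>V \<inter> U. f y = g y)}) \<rparr>"

definition quotient_topology :: "'a topology \<Rightarrow> ('a \<Rightarrow> 'b) \<Rightarrow> 'b topology" where
  "quotient_topology X p =
     topology (\<lambda>U. U \<subseteq> p ` topspace X \<and> openin X {x \<in> topspace X. p x \<in> U})"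

definition fs_quotient :: "'a fspace \<Rightarrow> ('a \<Rightarrow> 'b) \<Rightarrow> 'b fspace" where
  "fs_quotient X p =
     \<lparr> top_of = quotient_topology (top_of X) p,
       regular = (\<lambda>U. {f. f \<circ> p \<in> regular X {x \<in> points X. p x \<in> U}}) \<rparr>"

definition orbit_space :: "'a fspace \<Rightarrow> 'g set \<Rightarrow> ('g \<Rightarrow> 'a \<Rightarrow> 'a) \<Rightarrow> 'a set fspace" where
  "orbit_space X G act = fs_quotient X (\<lambda>x. (\<lambda>g. act g x) ` G)"

definition affine_line :: "complex fspace" where
  "affine_line = \<lparr> top_of = euclidean, regular = (\<lambda>U. {f. f holomorphic_on U}) \<rparr>"

text \<open>The derivative is real Frechet differentiability with a complex-linear derivative.\<close>

definition affine_space :: "(complex ^ 'n) fspace" where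
  "affine_space =
     \<lparr> top_of = euclidean,
       regular = (\<lambda>U. {f. \<forall>z\<in>U. \<exists>f'. (f has_derivative f') (at z) \<and>
                                   (\<forall>c v. f' (c *s v) = c * f' v)}) \<rparr>"

definition riemann_surface :: "'a fspace \<Rightarrow> bool" where
  "riemann_surface X \<longleftrightarrow>
     function_sheaf X \<and> Hausdorff_space (top_of X) \<and> second_countable (top_of X) \<and>
     connected_space (top_of X) \<and> points X \<noteq> {} \<and>
     (\<forall>x\<in>points X. \<exists>V W h. openin (top_of X) V \<and> x \<in> V \<and> open W \<and>
        fspace_iso (fs_restrict X V) (fs_restrict affine_line W) h)"

definition rs_isomorphic :: "'a fspace \<Rightarrow> 'b fspace \<Rightarrow> bool" where
  "rs_isomorphic X Y \<longleftrightarrow> riemann_surface X \<and> riemann_surface Y \<and> (\<exists>h. fspace_iso X Y h)"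

lemma istopology_quotient:
  "istopology (\<lambda>U. U \<subseteq> p ` topspace X \<and> openin X {x \<in> topspace X. p x \<in> U})"
proof -
  have 1: "{x \<in> topspace X. p x \<in> U \<inter> V} = {x \<in> topspace X. p x \<in> U} \<inter> {x \<in> topspace X. p x \<in> V}"
    for U V by auto
  have 2: "{x \<in> topspace X. p x \<in> \<Union>K} = (\<Union>U\<in>K. {x \<in> topspace X. p x \<in> U})" for K by auto
  show ?thesis
    unfolding istopology_def 1 2 by (auto intro!: openin_Int openin_Union)
qed

lemma openin_quotient_topology:
  "openin (quotient_topology X p) U \<longleftrightarrow>
     U \<subseteq> p ` topspace X \<and> openin X {x \<in> topspace X. p x \<in> U}"
  unfolding quotient_topology_def by (simp add: topology_inverse'[OF istopology_quotient])

lemma quotient_map_quotient_topology: "quotient_map X (quotient_topology X p) p"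
proof -
  have "openin (quotient_topology X p) (p ` topspace X)"
    unfolding openin_quotient_topology by (auto intro: openin_subopen[THEN iffD2])
  then have "topspace (quotient_topology X p) = p ` topspace X"
    by (metis openin_quotient_topology openin_subset openin_topspace subset_antisym)
  then show ?thesis
    unfolding quotient_map_def by (auto simp: openin_quotient_topology)
qed


section \<open>Projective space\<close>

definition proj_point :: "complex ^ 'n \<Rightarrow> (complex ^ 'n) set" where
  "proj_point v = vec.span {v}"

definition projective_space :: "(complex ^ 'n) set fspace" where
  "projective_space = fs_quotient (fs_restrict affine_space (- {0})) proj_point"


section \<open>The lattice, the period domain and its arithmetic group\<close>

text \<open>
  The lattice is \<open>int ^ 4\<close> in its natural basis, whose first two vectors have square -2 and
  whose last two have square 2. The form is polymorphic in the coefficients, so that on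
  \<open>complex ^ 4\<close> it is the bilinear extension.
\<close>

definition T_form :: "'a::comm_ring_1 ^ 4 \<Rightarrow> 'a ^ 4 \<Rightarrow> 'a" where
  "T_form x y = - 2 * (x $ 1 * y $ 1) - 2 * (x $ 2 * y $ 2) + 2 * (x $ 3 * y $ 3) + 2 * (x $ 4 * y $ 4)"

definition O_T :: "(int ^ 4 ^ 4) set" where
  "O_T = {\<gamma>. invertible \<gamma> \<and> (\<forall>x y. T_form (\<gamma> *v x) (\<gamma> *v y) = T_form x y)}"

definition rho :: "int ^ 4 ^ 4" where
  "rho = vector [vector [0, -1, 0, 0],
                 vector [1, 0, 0, 0],
                 vector [0, 0, 0, -1],
                 vector [0, 0, 1, 0]]"

definition complexify :: "int ^ 4 ^ 4 \<Rightarrow> complex ^ 4 ^ 4" where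
  "complexify = map_matrix of_int"

definition cnj_vec :: "complex ^ 'n \<Rightarrow> complex ^ 'n" where
  "cnj_vec z = (\<chi> i. cnj (z $ i))"

lemma T_form_cnj_vec_real: "T_form z (cnj_vec z) \<in> \<real>"
  unfolding T_form_def cnj_vec_def by (simp add: complex_is_Real_iff)

lemma rho_in_O_T: "rho \<in> O_T"
proof -
  have mv: "rho *v x = vector [- x $ 2, x $ 1, - x $ 4, x $ 3]" for x
    by (simp add: rho_def vec_eq_iff forall_4 matrix_vector_mult_def sum_4 vector_def)
  have "rho ** (- rho) = mat 1" "(- rho) ** rho = mat 1"
    by (simp_all add: rho_def vec_eq_iff forall_4 matrix_matrix_mult_def sum_4 vector_def mat_def)
  then have "invertible rho" unfolding invertible_def by blast
  then show ?thesis
    by (simp add: O_T_def mv T_form_def vector_def algebra_simps)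
qed

text \<open>Positivity forces \<open>z \<noteq> 0\<close>, and both conditions depend only on the line through \<open>z\<close>.\<close>

definition period_domain_points :: "(complex ^ 4) set set" where
  "period_domain_points = proj_point ` {z. complexify rho *v z = \<i> *s z \<and> Re (T_form z (cnj_vec z)) > 0}"

definition period_domain :: "(complex ^ 4) set fspace" where
  "period_domain = fs_restrict projective_space period_domain_points"

definition Gamma_rho :: "(int ^ 4 ^ 4) set" where
  "Gamma_rho = {\<gamma> \<in> O_T. \<gamma> ** rho = rho ** \<gamma>}"

definition moduli_M :: "(complex ^ 4) set set fspace" where
  "moduli_M = orbit_space period_domain Gamma_rho (\<lambda>\<gamma> L. (*v) (complexify \<gamma>) ` L)"


section \<open>The Fricke modular curve of level 2\<close>

definition SL2R :: "(real ^ 2 ^ 2) monoid" where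
  "SL2R = \<lparr> carrier = {A. det A = 1}, mult = (**), one = mat 1 \<rparr>"

definition PSL2R :: "(real ^ 2 ^ 2) set monoid" where
  "PSL2R = SL2R Mod {mat 1, - mat 1}"

definition psl :: "real ^ 2 ^ 2 \<Rightarrow> (real ^ 2 ^ 2) set" where
  "psl A = {mat 1, - mat 1} #>\<^bsub>SL2R\<^esub> A"

definition H2 :: "(real ^ 2 ^ 2) set set" where
  "H2 = {psl (map_matrix of_int A) | A :: int ^ 2 ^ 2. det A = 1 \<and> [A $ 2 $ 1 = 0] (mod 2)}"

definition Fricke :: "(real ^ 2 ^ 2) set" where
  "Fricke = psl (vector [vector [0, - 1 / sqrt 2], vector [sqrt 2, 0]])"

definition H2_plus :: "(real ^ 2 ^ 2) set set" where
  "H2_plus = H2 \<union> (Fricke <#\<^bsub>PSL2R\<^esub> H2)"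

definition mat_moebius :: "real ^ 2 ^ 2 \<Rightarrow> complex \<Rightarrow> complex" where
  "mat_moebius A = moebius (of_real (A $ 1 $ 1)) (of_real (A $ 1 $ 2))
                           (of_real (A $ 2 $ 1)) (of_real (A $ 2 $ 2))"

text \<open>An element of \<open>PSL2R\<close> acts through any of its two representatives.\<close>

definition psl_act :: "(real ^ 2 ^ 2) set \<Rightarrow> complex \<Rightarrow> complex" where
  "psl_act P z = (THE w. \<exists>A\<in>P. w = mat_moebius A z)"

lemma psl_eq: "psl A = {A, - A}"
proof -
  have "(- mat 1) ** A = - A"
    by (simp add: vec_eq_iff matrix_matrix_mult_def mat_def forall_2 sum_2)
  then show ?thesis by (auto simp: psl_def r_coset_def SL2R_def)
qed

lemma carrier_PSL2R: "carrier PSL2R = psl ` carrier SL2R"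
  by (auto simp: PSL2R_def psl_def FactGroup_def RCOSETS_def)

lemma psl_act_psl: "psl_act (psl A) z = mat_moebius A z"
proof -
  have "(- a - b) / (- c - d) = (a + b) / (c + d)" for a b c d :: complex
    by (metis add_uminus_conv_diff minus_add_distrib minus_divide_divide)
  then have "mat_moebius (- A) z = mat_moebius A z"
    by (simp add: mat_moebius_def moebius_def)
  then show ?thesis by (auto simp: psl_act_def psl_eq)
qed

definition upper_half_plane :: "complex fspace" where
  "upper_half_plane = fs_restrict affine_line {z. Im z > 0}"

definition fricke_curve_2 :: "complex set fspace" where
  "fricke_curve_2 = orbit_space upper_half_plane H2_plus psl_act"

end

theory Submission
  imports Defs
begin

text \<open>
  An eigenvector of \<open>\<rho>\<close> for the eigenvalue \<open>\<i>\<close> has the form \<open>(a, - \<i> a, b, - \<i> b)\<close>, and its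
  hermitian norm is \<open>4 (|b|\<^sup>2 - |a|\<^sup>2)\<close>. Hence the period domain is the disc \<open>|a / b| < 1\<close>, and the
  isometries that commute with \<open>\<rho>\<close> act on \<open>(a, b)\<close> as the matrices over the Gaussian integers that
  are unitary for \<open>|b|\<^sup>2 - |a|\<^sup>2\<close>. The coordinate \<open>t = (a + \<i> b) / ((1 - \<i>) (b - a))\<close> identifies the disc
  with the upper half plane (\<open>period_domain_iso\<close>). Up to scalars it turns the unitary matrices of determinant
  \<open>1\<close> or \<open>-1\<close> into elements of the group \<open>H2\<close>, those of determinant \<open>\<i>\<close> or \<open>- \<i>\<close> into elements of its
  Fricke coset, and both groups have the same orbits (\<open>Gamma_rho_orbit\<close>, \<open>H2_plus_orbit\<close>). This gives
  the first isomorphism.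

  For the second one, the translation \<open>T: z \<mapsto> z + 1\<close> and the Fricke involution \<open>W: z \<mapsto> - 1 / (2 z)\<close>
  generate the whole group by a Euclidean descent (\<open>fricke_mat_induct\<close>), so a function is invariant as
  soon as it is invariant under these two. An absolutely convergent lattice sum \<open>eis2\<close> is invariant
  under \<open>T\<close>, satisfies \<open>eis2 (W z) = - 2 z\<^sup>2 eis2 z\<close>, and has a nonzero limit at the cusp.
  Normalised to have limit \<open>2 \<pi> \<i>\<close>, it is the logarithmic derivative of a function \<open>g\<close>
  without zeros which, in \<open>q = exp (2 \<pi> \<i> z)\<close>, is holomorphic with a simple zero at \<open>q = 0\<close>. The weight
  two law says that the derivative of \<open>g (z) g (W z)\<close> vanishes, so this product is a constant \<open>C\<close>, and
  \<open>f = 1 / g + g / C\<close> is an invariant function with a simple pole at the only cusp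
  (\<open>hauptmodul_exists\<close>).

  Such an \<open>f\<close> is proper and open modulo the group, hence surjective. The set of values taken at
  two inequivalent points is open; it is closed away from the countably many critical values,
  and it is bounded because \<open>f\<close> is injective near the cusp. Removing a countable set keeps the plane
  connected, so this set is empty (\<open>injective_modulo_fricke_rel\<close>). Finally a function \<open>u\<close> on
  an open set of the plane is holomorphic if \<open>u \<circ> f\<close> is, by local inverses of \<open>f\<close> and removable
  singularities at the critical values (\<open>descends_to_holomorphic\<close>), so \<open>f\<close> induces an isomorphism
  of the Fricke curve with the affine line.
\<close>

section \<open>A weight two form of the Fricke group as a lattice sum\<close>

abbreviation uhp :: "complex set" where
  "uhp \<equiv> {z. Im z > 0}"

lemma summable_on_diff:
  fixes f g :: "'a \<Rightarrow> complex"
  assumes "f summable_on A" "g summable_on A"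
  shows "(\<lambda>x. f x - g x) summable_on A"
  using summable_on_add[OF assms(1) summable_on_uminus[THEN iffD2, OF assms(2)]] by simp

lemma infsum_diff:
  fixes f g :: "'a \<Rightarrow> complex"
  assumes "f summable_on A" "g summable_on A"
  shows "infsum (\<lambda>x. f x - g x) A = infsum f A - infsum g A"
  using infsum_add[OF assms(1) summable_on_uminus[THEN iffD2, OF assms(2)]] by (simp add: infsum_uminus)

text \<open>
  The sum of \<open>latA z\<close> is the value of the Weierstrass \<open>\<wp>\<close>-function of the lattice \<open>\<int> + \<int> z\<close> at \<open>1/2\<close>,
  the sum of \<open>latB z\<close> that of the lattice \<open>\<int> + 2 \<int> z\<close> at its half period \<open>z\<close>. Since
  \<open>inverse 0 = 0\<close>, the lattice point \<open>0\<close> needs no exception.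
\<close>

definition latA :: "complex \<Rightarrow> int \<times> int \<Rightarrow> complex" where
  "latA z = (\<lambda>(m, n). inverse ((of_int m + 1/2 + of_int n * z)\<^sup>2) - inverse ((of_int m + of_int n * z)\<^sup>2))"

definition latB :: "complex \<Rightarrow> int \<times> int \<Rightarrow> complex" where
  "latB z = (\<lambda>(m, n). inverse ((of_int m + of_int (2*n+1) * z)\<^sup>2) - inverse ((of_int m + of_int (2*n) * z)\<^sup>2))"

definition strip :: "real \<Rightarrow> real \<Rightarrow> complex set" where
  "strip R e = {z. \<bar>Re z\<bar> \<le> R \<and> e \<le> Im z}"

definition lat_major :: "int \<times> int \<Rightarrow> real" where
  "lat_major = (\<lambda>(m, n). inverse ((1 + \<bar>of_int n\<bar>) * (1 + \<bar>of_int m\<bar> + \<bar>of_int n\<bar>)\<^sup>2))"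

lemma summable_on_int_powr: "(\<lambda>n::int. (1 + \<bar>of_int n\<bar>) powr (-3/2) :: real) summable_on UNIV"
proof -
  have s: "summable (\<lambda>n. of_nat (n + 1) powr (-3/2) :: real)"
    using summable_real_powr_iff[of "-3/2"] by (subst summable_iff_shift) auto
  have eq: "(1 + real n) powr (-3/2) = of_nat (n + 1) powr (-3/2)" for n by (simp add: add.commute)
  have nat: "(\<lambda>n::nat. (1 + real n) powr (-3/2)) summable_on UNIV"
    using s unfolding eq[symmetric] by (intro norm_summable_imp_summable_on) simp
  have 1: "(\<lambda>n::int. (1 + \<bar>of_int n\<bar>) powr (-3/2) :: real) summable_on (range int)"
    using nat by (subst summable_on_reindex) (auto simp: o_def)
  have 2: "(\<lambda>n::int. (1 + \<bar>of_int n\<bar>) powr (-3/2) :: real) summable_on (range (\<lambda>n. - int n))"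
    using nat by (subst summable_on_reindex) (auto simp: o_def inj_on_def)
  have "range int \<union> range (\<lambda>n. - int n) = UNIV"
    by (auto simp: image_iff) (metis int_cases2)
  then show ?thesis using summable_on_union[OF 1 2] by simp
qed

text \<open>
  With \<open>w = 1 + |m|\<close> and \<open>v = 1 + |n|\<close>, the factor \<open>(w + v - 1)\<^sup>2\<close> is at least \<open>w\<^bsup>3/2\<^esup> v\<^bsup>1/2\<^esup>\<close>, which bounds
  the majorant by a product of two convergent one-dimensional sums.
\<close>

lemma summable_lat_major: "lat_major summable_on UNIV"
proof -
  let ?g = "\<lambda>n::int. (1 + \<bar>of_int n\<bar>) powr (-3/2) :: real"
  have "(\<lambda>(m,n). ?g m * ?g n) summable_on (UNIV \<times> UNIV)"
  proof (rule summable_on_SigmaI)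
    fix m :: int
    show "((\<lambda>n. case (m, n) of (m, n) \<Rightarrow> ?g m * ?g n) has_sum (?g m * infsum ?g UNIV)) UNIV"
      using summable_on_int_powr by (auto intro!: has_sum_cmult_right)
  next
    show "(\<lambda>m::int. ?g m * infsum ?g UNIV) summable_on UNIV"
      using summable_on_int_powr by (rule summable_on_cmult_left)
  qed auto
  then have "(\<lambda>(m,n). ?g m * ?g n) summable_on UNIV" by simp
  then show ?thesis
  proof (rule summable_on_comparison_test, goal_cases)
    case (1 x)
    obtain m n where x: "x = (m, n)" by (cases x)
    define w v :: real where "w = 1 + \<bar>of_int m\<bar>" and "v = 1 + \<bar>of_int n\<bar>"
    have wv: "w \<ge> 1" "v \<ge> 1" by (auto simp: w_def v_def)
    have L: "1 + \<bar>real_of_int m\<bar> + \<bar>real_of_int n\<bar> = w + v - 1" by (simp add: w_def v_def)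
    have "(w powr (3/2)) * (v powr (3/2)) = v * (w powr (3/2) * v powr (1/2))"
      using wv powr_add[of v 1 "1/2"] by (simp add: powr_one)
    also have "w powr (3/2) * v powr (1/2) \<le> (w + v - 1) powr (3/2) * (w + v - 1) powr (1/2)"
      using wv by (intro mult_mono powr_mono2) auto
    also have "\<dots> = (w + v - 1)\<^sup>2"
      using wv powr_add[of "w+v-1" "3/2" "1/2"] by (simp add: powr_numeral)
    finally have "(w powr (3/2)) * (v powr (3/2)) \<le> v * (w + v - 1)\<^sup>2" using wv by auto
    then have "inverse (v * (w + v - 1)\<^sup>2) \<le> inverse ((w powr (3/2)) * (v powr (3/2)))"
      using wv by (intro le_imp_inverse_le) auto
    then have "inverse (v * (w + v - 1)\<^sup>2) \<le> w powr (-3/2) * v powr (-3/2)"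
      by (simp add: powr_minus)
    then show ?case unfolding x lat_major_def prod.case L unfolding v_def[symmetric] w_def[symmetric] .
  next
    case (2 x)
    then show ?case by (auto simp: lat_major_def split: prod.splits)
  qed
qed

definition lat_const :: "real \<Rightarrow> real \<Rightarrow> real" where
  "lat_const R e = 1 + (R + 1) / e"

text \<open>
  On a vertical strip that stays away from the real axis, \<open>|x + y z|\<close> controls \<open>|y| Im z\<close>, hence
  \<open>|y|\<close> and \<open>|y Re z|\<close>, hence \<open>|x|\<close>. The constant is uniform up to the cusp, which is what the
  limit there requires; this is also why \<open>|y| |z|\<close> is bounded separately from \<open>|x| + |y|\<close>.
\<close>

lemma lattice_vector_lower_bounds:
  fixes x y :: real
  assumes z: "z \<in> strip R e" and "0 < e" "0 \<le> R"
  shows "\<bar>x\<bar> + \<bar>y\<bar> \<le> lat_const R e * cmod (of_real x + of_real y * z)"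
    and "\<bar>y\<bar> * cmod z \<le> lat_const R e * cmod (of_real x + of_real y * z)"
proof -
  define N where "N = cmod (of_real x + of_real y * z)"
  have z': "\<bar>Re z\<bar> \<le> R" "e \<le> Im z" using z by (auto simp: strip_def)
  have im: "\<bar>y\<bar> * Im z \<le> N"
    using abs_Im_le_cmod[of "of_real x + of_real y * z"] z' assms by (simp add: N_def abs_mult)
  have re: "\<bar>x + y * Re z\<bar> \<le> N"
    using abs_Re_le_cmod[of "of_real x + of_real y * z"] by (simp add: N_def)
  have "\<bar>y\<bar> * e \<le> \<bar>y\<bar> * Im z" using z' by (intro mult_left_mono) auto
  then have y: "\<bar>y\<bar> \<le> N / e" using im assms by (simp add: field_simps)
  have yR: "\<bar>y * Re z\<bar> \<le> N / e * R" unfolding abs_mult using y z' by (intro mult_mono) auto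
  have x: "\<bar>x\<bar> \<le> N + N / e * R" using re yR by linarith
  have c: "lat_const R e * N = N + N / e * R + N / e"
    by (simp add: lat_const_def algebra_simps add_divide_distrib)
  show "\<bar>x\<bar> + \<bar>y\<bar> \<le> lat_const R e * cmod (of_real x + of_real y * z)"
    using x y c unfolding N_def[symmetric] by linarith
  have "\<bar>y\<bar> * cmod z \<le> \<bar>y\<bar> * (\<bar>Re z\<bar> + \<bar>Im z\<bar>)"
    using cmod_le by (intro mult_left_mono) auto
  also have "\<dots> = \<bar>y * Re z\<bar> + \<bar>y\<bar> * Im z" using z' assms by (simp add: abs_mult algebra_simps)
  also have "\<dots> \<le> N / e * R + N" using yR im by linarith
  also have "\<dots> \<le> lat_const R e * N" unfolding c using y by linarith
  finally show "\<bar>y\<bar> * cmod z \<le> lat_const R e * cmod (of_real x + of_real y * z)"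
    unfolding N_def .
qed

lemma norm_inverse_square_diff:
  fixes a b :: complex
  assumes "a \<noteq> 0" "b \<noteq> 0"
  shows "cmod (inverse (a\<^sup>2) - inverse (b\<^sup>2)) \<le>
     cmod (a - b) * (inverse (cmod a * (cmod b)\<^sup>2) + inverse ((cmod a)\<^sup>2 * cmod b))"
proof -
  have "inverse (a\<^sup>2) - inverse (b\<^sup>2) = - ((a - b) * (a + b)) / (a\<^sup>2 * b\<^sup>2)"
    using assms by (simp add: field_simps power2_eq_square)
  then have "cmod (inverse (a\<^sup>2) - inverse (b\<^sup>2)) = cmod (a - b) * cmod (a + b) / ((cmod a)\<^sup>2 * (cmod b)\<^sup>2)"
    by (simp add: norm_divide norm_mult norm_power)
  also have "\<dots> \<le> cmod (a - b) * (cmod a + cmod b) / ((cmod a)\<^sup>2 * (cmod b)\<^sup>2)"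
    by (intro divide_right_mono mult_left_mono norm_triangle_ineq) auto
  also have "\<dots> = cmod (a - b) * (inverse (cmod a * (cmod b)\<^sup>2) + inverse ((cmod a)\<^sup>2 * cmod b))"
    using assms by (simp add: field_simps power2_eq_square)
  finally show ?thesis .
qed

lemma lattice_pair_bound:
  fixes a b :: complex and K L v :: real
  assumes K: "K \<ge> 1" and L: "L > 0" and v: "v > 0"
    and a: "L \<le> 4 * K * cmod a" and b: "L \<le> 4 * K * cmod b"
    and d: "cmod (a - b) * v \<le> 2 * K * cmod a"
  shows "cmod (inverse (a\<^sup>2) - inverse (b\<^sup>2)) \<le> 64 * K ^ 3 * inverse (v * L\<^sup>2)"
proof -
  have pos: "cmod a > 0" "cmod b > 0" using a b L K by (auto intro!: zero_less_norm_iff[THEN iffD2] )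
  have ia: "inverse (cmod a) \<le> 4 * K / L" and ib: "inverse (cmod b) \<le> 4 * K / L"
    using a b L pos by (auto simp: field_simps)
  have q: "cmod (a - b) * inverse (cmod a) \<le> 2 * K / v" using d v pos by (simp add: field_simps)
  have "cmod (inverse (a\<^sup>2) - inverse (b\<^sup>2)) \<le>
     cmod (a - b) * (inverse (cmod a * (cmod b)\<^sup>2) + inverse ((cmod a)\<^sup>2 * cmod b))"
    by (rule norm_inverse_square_diff) (use pos in auto)
  also have "\<dots> = (cmod (a - b) * inverse (cmod a)) *
       (inverse (cmod b) * inverse (cmod b) + inverse (cmod a) * inverse (cmod b))"
    by (simp add: power2_eq_square algebra_simps)
  also have "\<dots> \<le> (2 * K / v) * ((4 * K / L) * (4 * K / L) + (4 * K / L) * (4 * K / L))"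
    using q ia ib pos K L v by (intro mult_mono add_mono) auto
  also have "\<dots> = 64 * K ^ 3 * inverse (v * L\<^sup>2)"
    using v L by (simp add: field_simps power2_eq_square power3_eq_cube)
  finally show ?thesis .
qed

text \<open>
  The two points of a pair differ by \<open>1/2\<close>, so the pair decays like the inverse third power of the size of
  \<open>(m, n)\<close>.
\<close>

lemma latA_bound:
  assumes "z \<in> strip R e" "0 < e" "0 \<le> R"
  shows "cmod (latA z p) \<le> 64 * lat_const R e ^ 3 * lat_major p"
proof -
  obtain m n where p: "p = (m, n)" by (cases p)
  define K where "K = lat_const R e"
  have K: "K \<ge> 1" using assms by (simp add: K_def lat_const_def)
  define L v :: real where "L = 1 + \<bar>of_int m\<bar> + \<bar>of_int n\<bar>" and "v = 1 + \<bar>of_int n\<bar>"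
  have Lv: "1 \<le> v" "v \<le> L" by (auto simp: L_def v_def)
  define a b where "a = of_int m + 1/2 + of_int n * z" and "b = of_int m + of_int n * z"
  have m4: "1 + \<bar>real_of_int m\<bar> \<le> 4 * \<bar>real_of_int m + 1/2\<bar>"
    by (cases "m \<ge> 0"; cases "m \<le> -1") auto
  have a: "\<bar>of_int m + 1/2\<bar> + \<bar>of_int n\<bar> \<le> K * cmod a"
    using lattice_vector_lower_bounds(1)[OF assms, of "of_int m + 1/2" "of_int n"]
    by (simp add: a_def K_def)
  have b: "\<bar>of_int m\<bar> + \<bar>of_int n\<bar> \<le> K * cmod b"
    using lattice_vector_lower_bounds(1)[OF assms, of "of_int m" "of_int n"]
    by (simp add: b_def K_def)
  have arith: "1 + s + u \<le> 4 * k" if "1 + s \<le> 4 * t" "t + u \<le> k" "0 \<le> u" for s t u k :: real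
    using that by linarith
  have La: "L \<le> 4 * K * cmod a" using arith[OF m4 a] unfolding L_def mult.assoc by simp
  show ?thesis
  proof (cases "p = (0, 0)")
    case True
    have "4 \<le> 64 * K ^ 3" using one_le_power[OF K, of 3] by linarith
    then show ?thesis using True by (simp add: latA_def lat_major_def power2_eq_square K_def)
  next
    case False
    then have "\<bar>m\<bar> + \<bar>n\<bar> \<ge> 1" using p by auto
    then have "\<bar>real_of_int m\<bar> + \<bar>real_of_int n\<bar> \<ge> 1" by linarith
    then have Lb: "L \<le> 4 * K * cmod b" using b unfolding L_def mult.assoc by linarith
    have ab: "a - b = 1/2" by (simp add: a_def b_def)
    have "cmod (a - b) * v \<le> 2 * K * cmod a" unfolding ab using La Lv by simp
    from lattice_pair_bound[OF K _ _ La Lb this] Lv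
    show ?thesis unfolding p latA_def lat_major_def prod.case K_def a_def b_def L_def v_def by simp
  qed
qed

text \<open>
  The two points of a pair differ by \<open>z\<close>, which is unbounded on the strip, but \<open>|z|\<close> is small compared
  with the first point by a factor of order \<open>1 + |n|\<close>. This is the reason for the unsymmetric
  shape of the majorant.
\<close>

lemma latB_bound:
  assumes "z \<in> strip R e" "0 < e" "0 \<le> R"
  shows "cmod (latB z p) \<le> 64 * lat_const R e ^ 3 * lat_major p"
proof -
  obtain m n where p: "p = (m, n)" by (cases p)
  define K where "K = lat_const R e"
  have K: "K \<ge> 1" using assms by (simp add: K_def lat_const_def)
  define L v :: real where "L = 1 + \<bar>of_int m\<bar> + \<bar>of_int n\<bar>" and "v = 1 + \<bar>of_int n\<bar>"
  have Lv: "1 \<le> v" "v \<le> L" by (auto simp: L_def v_def)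
  define a b where "a = of_int m + of_int (2*n+1) * z" and "b = of_int m + of_int (2*n) * z"
  have a: "\<bar>of_int m\<bar> + \<bar>of_int (2*n+1)\<bar> \<le> K * cmod a" and a2: "\<bar>of_int (2*n+1)\<bar> * cmod z \<le> K * cmod a"
    using lattice_vector_lower_bounds(1)[OF assms, of "of_int m" "of_int (2*n+1)"]
      lattice_vector_lower_bounds(2)[OF assms, of "of_int (2*n+1)" "of_int m"]
    by (simp_all add: a_def K_def)
  have b: "\<bar>of_int m\<bar> + \<bar>of_int (2*n)\<bar> \<le> K * cmod b"
    using lattice_vector_lower_bounds(1)[OF assms, of "of_int m" "of_int (2*n)"]
    by (simp add: b_def K_def)
  have ab: "a - b = z" by (simp add: a_def b_def algebra_simps)
  show ?thesis
  proof (cases "n = 0")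
    case False
    then have "\<bar>n\<bar> \<ge> 1" by auto
    then have n1: "\<bar>real_of_int n\<bar> \<ge> 1" by linarith
    have n2: "\<bar>real_of_int (2*n+1)\<bar> \<ge> \<bar>real_of_int n\<bar>" "\<bar>real_of_int (2*n)\<bar> = 2 * \<bar>real_of_int n\<bar>"
      using n1 by auto
    have La: "L \<le> 4 * K * cmod a" and Lb: "L \<le> 4 * K * cmod b"
      using a b n1 n2 unfolding L_def mult.assoc by linarith+
    have "cmod (a - b) * v = v * cmod z" unfolding ab by (rule mult.commute)
    also have "\<dots> \<le> (2 * \<bar>of_int (2*n+1)\<bar>) * cmod z"
      using n1 n2 by (intro mult_right_mono) (auto simp: v_def)
    also have "\<dots> \<le> 2 * K * cmod a" using a2 unfolding mult.assoc by (intro mult_left_mono) auto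
    finally have "cmod (a - b) * v \<le> 2 * K * cmod a" .
    from lattice_pair_bound[OF K _ _ La Lb this] Lv
    show ?thesis unfolding p latB_def lat_major_def prod.case K_def a_def b_def L_def v_def by simp
  next
    case True
    \<comment> \<open>The second point is the integer \<open>m\<close>, which does not grow with \<open>z\<close>, so the two terms are
      estimated separately.\<close>
    have n: "n = 0" "v = 1" using True by (auto simp: v_def)
    have aL: "L \<le> K * cmod a" using a n by (simp add: L_def add.commute)
    have L1: "L \<ge> 1" using Lv by auto
    have ia: "inverse (cmod a) \<le> K / L" 
    proof -
      have "cmod a > 0" using aL L1 K by (auto intro!: zero_less_norm_iff[THEN iffD2])
      then show ?thesis using aL L1 by (simp add: field_simps)
    qed
    have "cmod (inverse (a\<^sup>2)) = inverse (cmod a) * inverse (cmod a)"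
      by (simp add: norm_inverse norm_mult power2_eq_square)
    also have "\<dots> \<le> (K / L) * (K / L)" using ia K L1 by (intro mult_mono) auto
    finally have A: "cmod (inverse (a\<^sup>2)) \<le> K\<^sup>2 / L\<^sup>2" by (simp add: power2_eq_square)
    have B: "cmod (inverse (b\<^sup>2)) \<le> 4 / L\<^sup>2"
    proof (cases "m = 0")
      case True
      then show ?thesis using n by (simp add: b_def)
    next
      case False
      then have "\<bar>m\<bar> \<ge> 1" by auto
      then have m1: "\<bar>real_of_int m\<bar> \<ge> 1" by linarith
      have "L\<^sup>2 \<le> (2 * \<bar>real_of_int m\<bar>)\<^sup>2" using m1 n by (intro power_mono) (auto simp: L_def)
      then have "inverse (4 * (real_of_int m)\<^sup>2) \<le> inverse (L\<^sup>2)"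
        using L1 by (intro le_imp_inverse_le) (auto simp: power_mult_distrib)
      moreover have "cmod (inverse (b\<^sup>2)) = inverse ((real_of_int m)\<^sup>2)"
        using n by (simp add: b_def norm_inverse norm_power)
      moreover have "inverse (4 * (real_of_int m)\<^sup>2) = inverse ((real_of_int m)\<^sup>2) / 4"
        by (simp only: inverse_mult_distrib inverse_eq_divide) simp
      ultimately show ?thesis unfolding divide_inverse[of 4] by linarith
    qed
    have K3: "K\<^sup>2 \<le> K ^ 3" "1 \<le> K ^ 3" using K by (auto intro!: power_increasing)
    have "cmod (latB z p) \<le> cmod (inverse (a\<^sup>2)) + cmod (inverse (b\<^sup>2))"
      unfolding p latB_def prod.case a_def b_def by (rule norm_triangle_ineq4)
    also have "\<dots> \<le> (K\<^sup>2 + 4) / L\<^sup>2" using A B by (simp add: add_divide_distrib)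
    also have "\<dots> \<le> 64 * K ^ 3 / L\<^sup>2" using K3 by (intro divide_right_mono) auto
    finally show ?thesis using n(1) by (simp add: p K_def lat_major_def L_def field_simps)
  qed
qed

lemma upper_half_plane_in_strip: "Im z > 0 \<Longrightarrow> z \<in> strip \<bar>Re z\<bar> (Im z)"
  by (simp add: strip_def)

lemma summable_latA: "latA z summable_on UNIV"
  and summable_latB: "latB z summable_on UNIV" if "Im z > 0"
proof -
  have "(\<lambda>p. 64 * lat_const \<bar>Re z\<bar> (Im z) ^ 3 * lat_major p) summable_on UNIV"
    by (intro summable_on_cmult_right summable_lat_major)
  note summable = Infinite_Sum.abs_summable_summable[OF Infinite_Sum.abs_summable_on_comparison_test'[OF this]]
  show "latA z summable_on UNIV" "latB z summable_on UNIV"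
    using upper_half_plane_in_strip[OF that] that by (auto intro!: summable latA_bound latB_bound)
qed

lemma infsum_latA_add_1: "infsum (latA (z + 1)) UNIV = infsum (latA z) UNIV"
  by (rule infsum_reindex_bij_witness[where i = "\<lambda>(m, n). (m - n, n)" and j = "\<lambda>(m, n). (m + n, n)"])
     (auto simp: latA_def algebra_simps)

text \<open>
  Translating \<open>z\<close> by \<open>1\<close> moves the half period \<open>z\<close> to \<open>z + 1\<close>, so it changes the sum by the sum \<open>D\<close>
  of the differences of neighbouring terms \<open>u\<close>. The central symmetry of the shifted lattice
  exchanges the two neighbours, so \<open>D = - D\<close>.
\<close>

lemma infsum_latB_add_1:
  assumes "Im z > 0"
  shows "infsum (latB (z + 1)) UNIV = infsum (latB z) UNIV"
proof -
  define u where "u = (\<lambda>(m, n). inverse ((of_int m + of_int (2*n+1) * z)\<^sup>2))"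
  define B' where "B' = (\<lambda>(m, n). u (m + 1, n) - inverse ((of_int m + of_int (2*n) * z)\<^sup>2))"
  have B': "infsum (latB (z + 1)) UNIV = infsum B' UNIV" "latB (z + 1) summable_on UNIV \<longleftrightarrow> B' summable_on UNIV"
  proof -
    have rw: "B' (case p of (m, n) \<Rightarrow> (m + 2 * n, n)) = latB (z + 1) p" for p
    proof -
      obtain m n where p: "p = (m, n)" by (cases p)
      have "of_int (m + 2 * n + 1) + of_int (2*n+1) * z = of_int m + of_int (2*n+1) * (z + 1)"
        and "of_int (m + 2 * n) + of_int (2*n) * z = of_int m + of_int (2*n) * (z + 1)"
        by (simp_all add: algebra_simps)
      then show ?thesis by (simp only: p prod.case B'_def latB_def u_def)
    qed
    show "infsum (latB (z + 1)) UNIV = infsum B' UNIV"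
      by (rule infsum_reindex_bij_witness[where i = "\<lambda>(m, n). (m - 2 * n, n)" and j = "\<lambda>(m, n). (m + 2 * n, n)"])
         (auto simp: rw[symmetric])
    show "latB (z + 1) summable_on UNIV \<longleftrightarrow> B' summable_on UNIV"
      by (rule summable_on_reindex_bij_witness[where i = "\<lambda>(m, n). (m - 2 * n, n)" and j = "\<lambda>(m, n). (m + 2 * n, n)"])
         (auto simp: rw[symmetric])
  qed
  have sB': "B' summable_on UNIV" using B'(2) summable_latB[of "z + 1"] assms by simp
  define D where "D = (\<lambda>(m, n). u (m + 1, n) - u (m, n))"
  have BD: "B' p - latB z p = D p" for p
    by (cases p) (simp add: B'_def latB_def D_def u_def)
  have "infsum D UNIV = infsum (\<lambda>p. - D p) UNIV"
  proof (rule infsum_reindex_bij_witness[where i = "\<lambda>(m, n). (- m - 1, - n - 1)" and j = "\<lambda>(m, n). (- m - 1, - n - 1)"])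
    fix p :: "int \<times> int"
    obtain m n where p: "p = (m, n)" by (cases p)
    have u: "u (- m, - n - 1) = u (m, n)" for m n
    proof -
      have "of_int (- m) + of_int (2 * (- n - 1) + 1) * z = - (of_int m + of_int (2*n+1) * z)"
        by (simp add: algebra_simps)
      then show ?thesis by (simp only: u_def prod.case power2_minus)
    qed
    show "- D (case p of (m, n) \<Rightarrow> (- m - 1, - n - 1)) = D p"
      using u[of m n] u[of "m + 1" n] by (simp add: p D_def)
  qed auto
  then have "infsum D UNIV = 0" by (simp add: infsum_uminus)
  moreover have "infsum D UNIV = infsum B' UNIV - infsum (latB z) UNIV"
    unfolding BD[symmetric] using infsum_diff[OF sB' summable_latB[OF assms]] .
  ultimately show ?thesis using B' by simp
qed

text \<open>
  The lattice \<open>\<int> - \<int> / (2 z)\<close> is \<open>1 / (2 z)\<close> times \<open>\<int> + 2 \<int> z\<close>, and under this homothety the half period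
  \<open>1/2\<close> corresponds to \<open>z\<close>.
\<close>

lemma infsum_latA_Fricke:
  assumes "z \<noteq> 0"
  shows "infsum (latA (- 1 / (2 * z))) UNIV = 4 * z\<^sup>2 * infsum (latB z) UNIV"
proof -
  have "infsum (latA (- 1 / (2 * z))) UNIV = infsum (\<lambda>p. 4 * z\<^sup>2 * latB z p) UNIV"
  proof (rule infsum_reindex_bij_witness[where i = "\<lambda>(m, n). (n, - m)" and j = "\<lambda>(m, n). (- n, m)"])
    fix p :: "int \<times> int"
    obtain m n where p: "p = (m, n)" by (cases p)
    have 1: "of_int (- n) + of_int (2 * m + 1) * z = (of_int m + 1/2 + of_int n * (- 1 / (2 * z))) * (2 * z)"
      and 2: "of_int (- n) + of_int (2 * m) * z = (of_int m + of_int n * (- 1 / (2 * z))) * (2 * z)"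
      using assms by (simp_all add: field_simps)
    have 3: "4 * z\<^sup>2 * inverse ((x * (2 * z))\<^sup>2) = inverse (x\<^sup>2)" for x
      using assms by (simp add: power_mult_distrib)
    show "4 * z\<^sup>2 * latB z (case p of (m, n) \<Rightarrow> (- n, m)) = latA (- 1 / (2 * z)) p"
      unfolding p prod.case latB_def latA_def 1 2 right_diff_distrib 3 ..
  qed auto
  then show ?thesis by (simp add: infsum_cmult_right')
qed

text \<open>
  The involution exchanges the sums of \<open>latA\<close> and \<open>latB\<close> up to the weight two factor; the coefficient
  \<open>- 2\<close> makes the combination anti-invariant.
\<close>

definition eis2 :: "complex \<Rightarrow> complex" where
  "eis2 z = infsum (\<lambda>p. latA z p - 2 * latB z p) UNIV"

lemma eis2_eq:
  assumes "Im z > 0" shows "eis2 z = infsum (latA z) UNIV - 2 * infsum (latB z) UNIV"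
  unfolding eis2_def using assms
  by (simp add: infsum_diff infsum_cmult_right' summable_latA summable_latB summable_on_cmult_right)

lemma eis2_add_1: "Im z > 0 \<Longrightarrow> eis2 (z + 1) = eis2 z"
  by (simp add: eis2_eq infsum_latA_add_1 infsum_latB_add_1)

lemma Im_Fricke_pos: "Im z > 0 \<Longrightarrow> Im (- 1 / (2 * z)) > 0"
  by (cases z) (auto simp: Im_divide power2_eq_square intro!: divide_pos_pos add_nonneg_pos)

lemma eis2_Fricke:
  assumes "Im z > 0"
  shows "eis2 (- 1 / (2 * z)) = - 2 * z\<^sup>2 * eis2 z"
proof -
  have z: "z \<noteq> 0" using assms by auto
  have "infsum (latA z) UNIV = 4 * (- 1 / (2 * z))\<^sup>2 * infsum (latB (- 1 / (2 * z))) UNIV"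
    using infsum_latA_Fricke[of "- 1 / (2 * z)"] z by simp
  then have B: "infsum (latB (- 1 / (2 * z))) UNIV = z\<^sup>2 * infsum (latA z) UNIV"
    using z by (simp add: field_simps)
  show ?thesis
    unfolding eis2_eq[OF assms] eis2_eq[OF Im_Fricke_pos[OF assms]] infsum_latA_Fricke[OF z] B
    by (simp add: algebra_simps)
qed

lemma eis2_summand_bound:
  assumes "z \<in> strip R e" "0 < e" "0 \<le> R"
  shows "cmod (latA z p - 2 * latB z p) \<le> 192 * lat_const R e ^ 3 * lat_major p"
proof -
  have "cmod (latA z p - 2 * latB z p) \<le> cmod (latA z p) + 2 * cmod (latB z p)"
    using norm_triangle_ineq4[of "latA z p" "2 * latB z p"] by (simp add: norm_mult)
  also have "\<dots> \<le> 64 * lat_const R e ^ 3 * lat_major p + 2 * (64 * lat_const R e ^ 3 * lat_major p)"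
    by (intro add_mono mult_left_mono latA_bound[OF assms] latB_bound[OF assms]) auto
  finally show ?thesis by (simp add: algebra_simps)
qed

lemma uniform_limit_eis2:
  assumes "0 < e" "0 \<le> R"
  shows "uniform_limit (strip R e) (\<lambda>X z. \<Sum>p\<in>X. latA z p - 2 * latB z p) eis2 (finite_subsets_at_top UNIV)"
  unfolding eis2_def
  by (rule Weierstrass_m_test_general[where M = "\<lambda>p. 192 * lat_const R e ^ 3 * lat_major p"])
     (use eis2_summand_bound[OF _ assms] summable_on_cmult_right[OF summable_lat_major] in auto)

lemma eis2_bounded_on_strip:
  assumes "0 < e" "0 \<le> R"
  shows "\<exists>B. \<forall>z\<in>strip R e. cmod (eis2 z) \<le> B"
proof (intro exI ballI)
  fix z assume z: "z \<in> strip R e"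
  then have "Im z > 0" using assms by (auto simp: strip_def)
  then have s: "(\<lambda>p. latA z p - 2 * latB z p) summable_on UNIV"
    by (intro summable_on_diff summable_latA summable_on_cmult_right summable_latB)
  show "cmod (eis2 z) \<le> infsum (\<lambda>p. 192 * lat_const R e ^ 3 * lat_major p) UNIV"
    unfolding eis2_def
    by (rule norm_infsum_le[OF has_sum_infsum[OF s] has_sum_infsum[OF summable_on_cmult_right[OF summable_lat_major]]])
       (use eis2_summand_bound[OF z assms] in auto)
qed

lemma lattice_vector_nonzero:
  assumes "Im z > 0" "x \<noteq> 0 \<or> y \<noteq> 0"
  shows "complex_of_real x + complex_of_real y * z \<noteq> 0"
  using assms by (auto simp: complex_eq_iff)

lemma lat_term_holomorphic:
  shows "(\<lambda>z. inverse ((of_real x + of_real y * z)\<^sup>2)) holomorphic_on uhp"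
proof (cases "x = 0 \<and> y = 0")
  case False
  then show ?thesis
    by (intro holomorphic_intros) (use lattice_vector_nonzero in \<open>auto simp del: of_real_add\<close>)
qed simp

lemma latA_holomorphic: "(\<lambda>z. latA z p) holomorphic_on uhp"
  using lat_term_holomorphic[of "of_int (fst p) + 1/2" "of_int (snd p)"]
    lat_term_holomorphic[of "of_int (fst p)" "of_int (snd p)"]
  by (auto simp: latA_def case_prod_beta intro!: holomorphic_intros)

lemma latB_holomorphic: "(\<lambda>z. latB z p) holomorphic_on uhp"
  using lat_term_holomorphic[of "of_int (fst p)" "of_int (2 * snd p + 1)"]
    lat_term_holomorphic[of "of_int (fst p)" "of_int (2 * snd p)"]
  by (auto simp: latB_def case_prod_beta intro!: holomorphic_intros)

lemma eis2_holomorphic: "eis2 holomorphic_on uhp"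
proof -
  have "\<exists>r>0. eis2 holomorphic_on ball z r" if "Im z > 0" for z
  proof (intro exI conjI)
    let ?r = "Im z / 2"
    have sub: "cball z ?r \<subseteq> strip (\<bar>Re z\<bar> + ?r) ?r"
    proof
      fix w assume "w \<in> cball z ?r"
      then have "cmod (z - w) \<le> ?r" by (simp add: dist_norm)
      then have "\<bar>Re (z - w)\<bar> \<le> ?r" "\<bar>Im (z - w)\<bar> \<le> ?r"
        using abs_Re_le_cmod abs_Im_le_cmod order_trans by blast+
      then have "Re z - Re w \<le> ?r" "Re w - Re z \<le> ?r" "Im z - Im w \<le> ?r"
        unfolding minus_complex.sel abs_le_iff by auto
      then have "\<bar>Re w\<bar> \<le> \<bar>Re z\<bar> + ?r" "?r \<le> Im w" by linarith+
      then show "w \<in> strip (\<bar>Re z\<bar> + ?r) ?r" unfolding strip_def by blast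
    qed
    have sub2: "cball z ?r \<subseteq> uhp" using sub that by (auto simp: strip_def)
    have hol: "(\<lambda>z. \<Sum>p\<in>X. latA z p - 2 * latB z p) holomorphic_on uhp" for X
      by (intro holomorphic_intros latA_holomorphic latB_holomorphic)
    show "?r > 0" using that by simp
    show "eis2 holomorphic_on ball z ?r"
    proof (rule holomorphic_uniform_limit)
      show "uniform_limit (cball z ?r) (\<lambda>X z. \<Sum>p\<in>X. latA z p - 2 * latB z p) eis2 (finite_subsets_at_top UNIV)"
        using uniform_limit_eis2[of ?r "\<bar>Re z\<bar> + ?r"] sub that uniform_limit_on_subset by fastforce
      show "\<forall>\<^sub>F X in finite_subsets_at_top UNIV. continuous_on (cball z ?r) (\<lambda>z. \<Sum>p\<in>X. latA z p - 2 * latB z p) \<and>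
          (\<lambda>z. \<Sum>p\<in>X. latA z p - 2 * latB z p) holomorphic_on ball z ?r"
        using sub2 ball_subset_cball
        by (intro always_eventually allI conjI holomorphic_on_imp_continuous_on)
           (blast intro: holomorphic_on_subset[OF hol])+
    qed simp_all
  qed
  then show ?thesis
    by (intro analytic_imp_holomorphic) (auto simp: analytic_on_def)
qed

text \<open>
  Only the terms with \<open>n = 0\<close> survive at the cusp. They are positive there, so the limit cannot
  vanish.
\<close>

definition cusp_summand :: "int \<times> int \<Rightarrow> real" where
  "cusp_summand = (\<lambda>(m, n). if n = 0 then inverse ((of_int m + 1/2)\<^sup>2) + inverse ((of_int m)\<^sup>2) else 0)"

lemma tendsto_inverse_square_at_cusp:
  assumes "y \<noteq> 0"
  shows "((\<lambda>t. inverse ((of_real x + of_real y * (\<i> * of_real t))\<^sup>2) :: complex) \<longlongrightarrow> 0) at_top"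
proof (rule Lim_null_comparison)
  show "((\<lambda>t. inverse (y\<^sup>2 * t\<^sup>2)) \<longlongrightarrow> 0) at_top"
    using assms by real_asymp
  show "\<forall>\<^sub>F t in at_top. cmod (inverse ((of_real x + of_real y * (\<i> * of_real t))\<^sup>2)) \<le> inverse (y\<^sup>2 * t\<^sup>2)"
    using eventually_gt_at_top[of 0]
  proof eventually_elim
    case (elim t)
    have "\<bar>y * t\<bar> \<le> cmod (of_real x + of_real y * (\<i> * of_real t))"
      using abs_Im_le_cmod[of "of_real x + of_real y * (\<i> * of_real t)"] by simp
    then have "(y * t)\<^sup>2 \<le> (cmod (of_real x + of_real y * (\<i> * of_real t)))\<^sup>2"
      using power_mono[of "\<bar>y * t\<bar>" _ 2] by (simp add: power2_abs)
    then have "inverse ((cmod (of_real x + of_real y * (\<i> * of_real t)))\<^sup>2) \<le> inverse ((y * t)\<^sup>2)"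
      using elim assms by (intro le_imp_inverse_le) auto
    then show ?case by (simp add: norm_inverse norm_power power_mult_distrib)
  qed
qed

lemma eis2_summand_at_cusp:
  "((\<lambda>t. latA (\<i> * of_real t) p - 2 * latB (\<i> * of_real t) p) \<longlongrightarrow> of_real (cusp_summand p)) at_top"
proof -
  obtain m n where p: "p = (m, n)" by (cases p)
  note lim = tendsto_inverse_square_at_cusp
  have 1: "((\<lambda>t. inverse ((of_int m + of_int (2*n+1) * (\<i> * of_real t))\<^sup>2) :: complex) \<longlongrightarrow> 0) at_top"
  proof -
    have "2 * n + 1 \<noteq> 0" by presburger
    then have "real_of_int (2 * n + 1) \<noteq> 0" unfolding of_int_eq_0_iff .
    from lim[OF this, of "of_int m"] show ?thesis unfolding of_real_of_int_eq .
  qed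
  show ?thesis
  proof (cases "n = 0")
    case True
    have "((\<lambda>t. inverse ((of_int m + 1/2)\<^sup>2) - inverse ((of_int m)\<^sup>2) -
        2 * (inverse ((of_int m + of_int (2*n+1) * (\<i> * of_real t))\<^sup>2) - inverse ((of_int m)\<^sup>2)) :: complex)
        \<longlongrightarrow> inverse ((of_int m + 1/2)\<^sup>2) - inverse ((of_int m)\<^sup>2) - 2 * (0 - inverse ((of_int m)\<^sup>2))) at_top"
      by (intro tendsto_intros 1)
    then show ?thesis using True by (simp add: p latA_def latB_def cusp_summand_def algebra_simps)
  next
    case False
    have 2: "((\<lambda>t. inverse ((of_int m + of_int (2*n) * (\<i> * of_real t))\<^sup>2) :: complex) \<longlongrightarrow> 0) at_top"
      using lim[of "of_int (2*n)" "of_int m"] False by simp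
    have 3: "((\<lambda>t. inverse ((of_int m + of_int n * (\<i> * of_real t))\<^sup>2) :: complex) \<longlongrightarrow> 0) at_top"
      using lim[of "of_int n" "of_int m"] False by simp
    have 4: "((\<lambda>t. inverse ((of_int m + 1/2 + of_int n * (\<i> * of_real t))\<^sup>2) :: complex) \<longlongrightarrow> 0) at_top"
      using lim[of "of_int n" "of_int m + 1/2"] False by simp
    have "((\<lambda>t. latA (\<i> * of_real t) p - 2 * latB (\<i> * of_real t) p) \<longlongrightarrow> (0 - 0) - 2 * (0 - 0)) at_top"
      unfolding p latA_def latB_def prod.case by (intro tendsto_intros 1 2 3 4)
    then show ?thesis using False by (simp add: p cusp_summand_def)
  qed
qed

text \<open>
  The summable majorant is uniform on the strip, so the limit may be taken term by term.
\<close>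

lemma eis2_limit_at_cusp:
  obtains l where "l \<noteq> 0" "((\<lambda>t. eis2 (\<i> * of_real t)) \<longlongrightarrow> l) at_top"
proof -
  define S where "S = strip 0 1"
  have S: "\<forall>\<^sub>F t in at_top. \<i> * complex_of_real t \<in> S"
    using eventually_ge_at_top[of 1] by eventually_elim (auto simp: S_def strip_def)
  define C where "C = 192 * lat_const 0 1 ^ 3"
  have bound: "cusp_summand p \<le> C * lat_major p" for p
  proof -
    have "\<forall>\<^sub>F t in at_top. cmod (latA (\<i> * of_real t) p - 2 * latB (\<i> * of_real t) p) \<le> C * lat_major p"
      using S by eventually_elim (simp add: S_def C_def eis2_summand_bound)
    then have "cmod (of_real (cusp_summand p)) \<le> C * lat_major p"
      by (intro tendsto_upperbound[OF tendsto_norm[OF eis2_summand_at_cusp]]) auto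
    then show ?thesis by (simp only: norm_of_real)
  qed
  have nonneg: "cusp_summand p \<ge> 0" for p by (auto simp: cusp_summand_def split: prod.splits)
  have summ: "cusp_summand summable_on UNIV"
    by (rule summable_on_comparison_test[OF summable_on_cmult_right[OF summable_lat_major]])
       (use bound nonneg in auto)
  define l where "l = infsum cusp_summand UNIV"
  have hs: "(cusp_summand has_sum l) UNIV" unfolding l_def using summ by simp
  then have hs': "((\<lambda>p. of_real (cusp_summand p) :: complex) has_sum of_real l) UNIV"
    by (simp add: has_sum_of_real)
  have "sum cusp_summand {(0, 0)} \<le> l"
    unfolding l_def by (rule finite_sum_le_infsum[OF summ]) (use nonneg in auto)
  then have "l > 0" by (simp add: cusp_summand_def power2_eq_square)
  moreover have "((\<lambda>t. eis2 (\<i> * of_real t)) \<longlongrightarrow> of_real l) at_top"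
  proof (rule swap_uniform_limit'[where F = "finite_subsets_at_top UNIV" and S = "{t. \<i> * complex_of_real t \<in> S}"
        and f = "\<lambda>X t. \<Sum>p\<in>X. latA (\<i> * of_real t) p - 2 * latB (\<i> * of_real t) p" and g = "\<lambda>X. \<Sum>p\<in>X. of_real (cusp_summand p)"])
    show "\<forall>\<^sub>F X in finite_subsets_at_top UNIV. ((\<lambda>t. \<Sum>p\<in>X. latA (\<i> * of_real t) p - 2 * latB (\<i> * of_real t) p)
        \<longlongrightarrow> (\<Sum>p\<in>X. of_real (cusp_summand p))) at_top"
      by (intro always_eventually allI tendsto_sum eis2_summand_at_cusp)
    show "((\<lambda>X. \<Sum>p\<in>X. of_real (cusp_summand p) :: complex) \<longlongrightarrow> of_real l) (finite_subsets_at_top UNIV)"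
      using hs' by (simp add: has_sum_def)
    show "uniform_limit {t. \<i> * complex_of_real t \<in> S} (\<lambda>X t. \<Sum>p\<in>X. latA (\<i> * of_real t) p - 2 * latB (\<i> * of_real t) p)
        (\<lambda>t. eis2 (\<i> * of_real t)) (finite_subsets_at_top UNIV)"
      by (rule uniform_limit_compose'[OF uniform_limit_eis2[of 1 0]]) (auto simp: S_def)
    show "\<forall>\<^sub>F t in at_top. t \<in> {t. \<i> * complex_of_real t \<in> S}" using S by simp
  qed simp
  ultimately show ?thesis using that[of "of_real l"] by auto
qed

section \<open>A Hauptmodul from its logarithmic derivative\<close>

definition nome :: "complex \<Rightarrow> complex" where
  "nome z = exp (2 * of_real pi * \<i> * z)"

lemma norm_nome: "cmod (nome z) = exp (- 2 * pi * Im z)"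
  by (simp add: nome_def)

lemma nome_in_punctured_disc: "Im z > 0 \<Longrightarrow> nome z \<in> ball 0 1 - {0}"
  by (auto simp: norm_nome nome_def)

lemma nome_eq_iff: "nome z = nome w \<longleftrightarrow> (\<exists>k::int. w = z + of_int k)"
proof -
  have "nome z = nome w \<longleftrightarrow> (\<exists>k::int. 2 * of_real pi * \<i> * w = 2 * of_real pi * \<i> * z + of_int (2 * k) * pi * \<i>)"
    unfolding nome_def by (subst eq_commute, subst exp_eq) simp
  also have "\<dots> \<longleftrightarrow> (\<exists>k::int. w = z + of_int k)"
  proof (rule ex_cong1)
    fix k :: int
    have "2 * of_real pi * \<i> * z + of_int (2 * k) * pi * \<i> = (2 * of_real pi * \<i>) * (z + of_int k)"
      by (simp add: algebra_simps)
    then show "2 * of_real pi * \<i> * w = 2 * of_real pi * \<i> * z + of_int (2 * k) * pi * \<i> \<longleftrightarrow> w = z + of_int k"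
      by simp
  qed
  finally show ?thesis .
qed

lemma nome_Ln: "q \<noteq> 0 \<Longrightarrow> nome (Ln q / (2 * of_real pi * \<i>)) = q"
  by (simp add: nome_def)

text \<open>
  Periodicity makes the value at \<open>Ln q / (2 \<pi> \<i>)\<close> independent of the branch of the logarithm, hence
  holomorphic on the punctured disc; boundedness removes the singularity at \<open>q = 0\<close>.
\<close>

lemma periodic_imp_factors_through_nome:
  fixes f :: "complex \<Rightarrow> complex"
  assumes hol: "f holomorphic_on uhp"
    and per: "\<And>z. Im z > 0 \<Longrightarrow> f (z + 1) = f z"
    and bdd: "\<And>z. z \<in> strip 1 1 \<Longrightarrow> cmod (f z) \<le> B"
  obtains F where "F holomorphic_on ball 0 1" "\<And>z. Im z > 0 \<Longrightarrow> f z = F (nome z)"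
proof -
  have pern: "f (z + of_nat n) = f z" if "Im z > 0" for z n
    by (induction n) (use per[of "z + of_nat _"] that in \<open>auto simp: add_ac\<close>)
  have peri: "f (z + of_int k) = f z" if "Im z > 0" for z k
  proof (cases "k \<ge> 0")
    case True
    then show ?thesis using pern[OF that, of "nat k"] by simp
  next
    case False
    then show ?thesis using pern[of "z + of_int k" "nat (- k)"] that by simp
  qed
  have eqf: "f z = f w" if "Im z > 0" "nome z = nome w" for z w
    using that peri[OF that(1)] by (auto simp: nome_eq_iff)
  define F0 where "F0 q = f (Ln q / (2 * of_real pi * \<i>))" for q
  have Im_Ln: "Im (Ln q / (2 * of_real pi * \<i>)) = - ln (cmod q) / (2 * pi)" if "q \<noteq> 0" for q
    using that by (simp add: Im_divide power2_eq_square field_simps)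
  have Re_Ln: "Re (Ln q / (2 * of_real pi * \<i>)) = Im (Ln q) / (2 * pi)" if "q \<noteq> 0" for q
    using that by (simp add: Re_divide power2_eq_square field_simps)
  have pos: "Im z > 0 \<longleftrightarrow> cmod (nome z) < 1" for z by (simp add: norm_nome zero_less_mult_iff)
  have F0: "F0 (nome z) = f z" if "Im z > 0" for z
    unfolding F0_def by (rule eqf[OF that, symmetric]) (simp add: nome_Ln nome_def)
  have "F0 holomorphic_on ball 0 1 - {0}"
  proof -
    have "\<exists>r>0. F0 holomorphic_on ball q0 r" if q0: "q0 \<in> ball 0 1 - {0}" for q0
    proof (intro exI conjI)
      define r where "r = min (cmod q0) (1 - cmod q0)"
      show "r > 0" using q0 by (simp add: r_def)
      \<comment> \<open>A branch of the logarithm near \<open>q0\<close>: the quotient \<open>q / q0\<close> stays in the right half plane.\<close>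
      define L where "L q = (Ln (q / q0) + Ln q0) / (2 * of_real pi * \<i>)" for q
      have q: "cmod q < 1 \<and> q \<noteq> 0 \<and> q / q0 \<notin> \<real>\<^sub>\<le>\<^sub>0" if "q \<in> ball q0 r" for q
      proof -
        have d: "cmod (q - q0) < cmod q0" "cmod (q - q0) < 1 - cmod q0"
          using that by (auto simp: r_def dist_norm norm_minus_commute)
        have "cmod q \<le> cmod (q - q0) + cmod q0" using norm_triangle_ineq[of "q - q0" q0] by simp
        then have 1: "cmod q < 1" using d by linarith
        have "cmod (q / q0 - 1) = cmod (q - q0) / cmod q0"
          using q0 by (simp add: norm_divide[symmetric] diff_divide_distrib)
        also have "\<dots> < 1" using d q0 by simp
        finally have "Re (q / q0) > 0" using abs_Re_le_cmod[of "q / q0 - 1"] unfolding minus_complex.sel by auto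
        then show ?thesis using 1 by (auto simp: complex_nonpos_Reals_iff)
      qed
      have nL: "nome (L q) = q" if "q \<in> ball q0 r" for q
        using q[OF that] q0 by (simp add: nome_def L_def exp_add)
      have "(f \<circ> L) holomorphic_on ball q0 r"
      proof (rule holomorphic_on_compose_gen[OF _ hol])
        show "L holomorphic_on ball q0 r"
          unfolding L_def using q q0 by (intro holomorphic_intros) auto
        show "L ` ball q0 r \<subseteq> uhp" using q nL pos by auto
      qed
      moreover have "F0 q = (f \<circ> L) q" if "q \<in> ball q0 r" for q
        using F0[of "L q"] nL[OF that] pos q[OF that] by auto
      ultimately show "F0 holomorphic_on ball q0 r"
        using holomorphic_transform by (metis (no_types, lifting))
    qed
    then show ?thesis by (intro analytic_imp_holomorphic) (auto simp: analytic_on_def)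
  qed
  moreover have "\<forall>\<^sub>F q in at 0. cmod (F0 q) \<le> B"
  proof (rule eventually_at_ball'[of "exp (- 2 * pi)" 0 UNIV, THEN eventually_mono])
    fix q :: complex assume q: "q \<in> ball 0 (exp (- 2 * pi)) \<and> q \<noteq> 0 \<and> q \<in> UNIV"
    then have "ln (cmod q) < - 2 * pi" using ln_less_cancel_iff[of "cmod q" "exp (- 2 * pi)"] by simp
    then have "- ln (cmod q) / (2 * pi) \<ge> 1" by (simp add: field_simps)
    then have "Im (Ln q / (2 * of_real pi * \<i>)) \<ge> 1" using Im_Ln q by metis
    moreover have "\<bar>Im (Ln q)\<bar> \<le> pi" using mpi_less_Im_Ln Im_Ln_le_pi q by (simp add: abs_le_iff less_imp_le minus_le_iff)
    then have "\<bar>Im (Ln q) / (2 * pi)\<bar> \<le> 1" by (simp add: field_simps abs_divide)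
    ultimately have "Ln q / (2 * of_real pi * \<i>) \<in> strip 1 1"
      using Re_Ln q unfolding strip_def by simp
    then show "cmod (F0 q) \<le> B" unfolding F0_def by (rule bdd)
  qed simp
  ultimately obtain F where F: "F holomorphic_on ball 0 1" "\<And>q. q \<in> ball 0 1 - {0} \<Longrightarrow> F q = F0 q"
    using holomorphic_on_extend_bounded[of F0 "ball 0 1" 0] by (auto simp: interior_open)
  show ?thesis
    by (rule that[OF F(1)]) (metis F(2) F0 nome_in_punctured_disc)
qed

lemma tendsto_nome_cusp: "((\<lambda>t. nome (\<i> * of_real t)) \<longlongrightarrow> 0) at_top"
proof (rule tendsto_norm_zero_cancel)
  have "((\<lambda>t. exp (- 2 * pi * t)) \<longlongrightarrow> 0) at_top"
    using pi_gt_zero by real_asymp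
  then show "((\<lambda>t. cmod (nome (\<i> * of_real t))) \<longlongrightarrow> 0) at_top" by (simp add: norm_nome)
qed

lemma eis2_nome_expansion:
  obtains \<epsilon> l where "\<epsilon> holomorphic_on ball 0 1" "\<epsilon> 0 = 1" "l \<noteq> 0"
    "\<And>z. Im z > 0 \<Longrightarrow> eis2 z = l * \<epsilon> (nome z)"
proof -
  obtain B where "\<forall>z\<in>strip 1 1. cmod (eis2 z) \<le> B" using eis2_bounded_on_strip[of 1 1] by auto
  then obtain F where F: "F holomorphic_on ball 0 1" "\<And>z. Im z > 0 \<Longrightarrow> eis2 z = F (nome z)"
    using periodic_imp_factors_through_nome[OF eis2_holomorphic eis2_add_1] by blast
  obtain l where l: "l \<noteq> 0" "((\<lambda>t. eis2 (\<i> * of_real t)) \<longlongrightarrow> l) at_top"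
    by (rule eis2_limit_at_cusp)
  have "isCont F 0"
    using F(1) by (metis centre_in_ball continuous_on_eq_continuous_at holomorphic_on_imp_continuous_on open_ball zero_less_one)
  then have "((\<lambda>t. F (nome (\<i> * of_real t))) \<longlongrightarrow> F 0) at_top"
    using tendsto_nome_cusp by (rule isCont_tendsto_compose)
  moreover have "\<forall>\<^sub>F t in at_top. F (nome (\<i> * of_real t)) = eis2 (\<i> * of_real t)"
    using eventually_gt_at_top[of 0] by eventually_elim (simp add: F(2))
  ultimately have "((\<lambda>t. eis2 (\<i> * of_real t)) \<longlongrightarrow> F 0) at_top"
    by (simp add: tendsto_cong)
  then have F0: "F 0 = l" using l(2) by (rule tendsto_unique[rotated]) simp
  show ?thesis
    by (rule that[of "\<lambda>q. F q / l" l]) (use F F0 l in \<open>auto intro!: holomorphic_intros\<close>)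
qed

text \<open>
  The equation \<open>q G' = \<epsilon> G\<close> is solved by \<open>G = q exp K\<close>, where \<open>K\<close> is a primitive of \<open>(\<epsilon> - 1) / q\<close>;
  the value \<open>\<epsilon> 0 = 1\<close> makes this quotient holomorphic at \<open>0\<close>.
\<close>

lemma logarithmic_antiderivative_at_0:
  assumes hol: "\<epsilon> holomorphic_on ball 0 1" and "\<epsilon> 0 = 1"
  obtains G where "G holomorphic_on ball 0 1" "G 0 = 0" "deriv G 0 \<noteq> 0"
    "\<And>q. q \<in> ball 0 1 - {0} \<Longrightarrow> G q \<noteq> 0"
    "\<And>q. q \<in> ball 0 1 \<Longrightarrow> q * deriv G q = \<epsilon> q * G q"
proof -
  define k where "k q = (if q = 0 then deriv \<epsilon> 0 else (\<epsilon> q - \<epsilon> 0) / (q - 0))" for q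
  have "k holomorphic_on ball 0 1"
    unfolding k_def using pole_lemma[OF hol, of 0] by (simp add: interior_open)
  then obtain K where K: "\<And>q. q \<in> ball 0 1 \<Longrightarrow> (K has_field_derivative k q) (at q within ball 0 1)"
    using holomorphic_convex_primitive'[of "ball 0 1" k] by auto
  have K': "(K has_field_derivative k q) (at q)" if "q \<in> ball 0 1" for q
    using K[OF that] that by (metis at_within_open open_ball)
  define G where "G q = q * exp (K q)" for q
  have G': "(G has_field_derivative exp (K q) * (1 + q * k q)) (at q)" if "q \<in> ball 0 1" for q
    unfolding G_def by (rule derivative_eq_intros K' that refl)+ (simp add: algebra_simps)
  have dG: "deriv G q = exp (K q) * (1 + q * k q)" if "q \<in> ball 0 1" for q
    using G'[OF that] by (rule DERIV_imp_deriv)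
  have ke: "1 + q * k q = \<epsilon> q" for q
    using assms(2) by (simp add: k_def)
  show ?thesis
  proof (rule that[of G])
    show "G holomorphic_on ball 0 1"
      unfolding holomorphic_on_open[OF open_ball] using G' by blast
    show "q * deriv G q = \<epsilon> q * G q" if "q \<in> ball 0 1" for q
      using dG[OF that] ke by (simp add: G_def)
  qed (use dG in \<open>auto simp: G_def\<close>)
qed

text \<open>
  For \<open>g (z) = G (nome z)\<close> the logarithmic derivative is \<open>2 \<pi> \<i> \<epsilon> (nome z)\<close>, and the involution has
  derivative \<open>1 / (2 z\<^sup>2)\<close>. The weight two law therefore cancels the two contributions to the
  logarithmic derivative of the product.
\<close>

lemma Fricke_quotient_constant:
  assumes hol: "G holomorphic_on ball 0 1"
    and nz: "\<And>q. q \<in> ball 0 1 - {0} \<Longrightarrow> G q \<noteq> 0"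
    and log: "\<And>q. q \<in> ball 0 1 \<Longrightarrow> q * deriv G q = \<epsilon> q * G q"
    and wt: "\<And>z. Im z > 0 \<Longrightarrow> \<epsilon> (nome (- 1 / (2 * z))) = - 2 * z\<^sup>2 * \<epsilon> (nome z)"
  obtains C where "C \<noteq> 0" "\<And>z. Im z > 0 \<Longrightarrow> G (nome z) * G (nome (- 1 / (2 * z))) = C"
proof -
  define h where "h z = G (nome z) * G (nome (- 1 / (2 * z)))" for z
  have g': "((\<lambda>z. G (nome z)) has_field_derivative (2 * of_real pi * \<i>) * (\<epsilon> (nome z) * G (nome z))) (at z)"
    if "Im z > 0" for z
  proof -
    have n: "nome z \<in> ball 0 1" using nome_in_punctured_disc[OF that] by simp
    have "(G has_field_derivative deriv G (nome z)) (at (nome z))"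
      using holomorphic_derivI[OF hol _ n] by simp
    moreover have "(nome has_field_derivative (2 * of_real pi * \<i>) * nome z) (at z)"
      unfolding nome_def by (rule derivative_eq_intros refl | simp)+
    ultimately have "((\<lambda>z. G (nome z)) has_field_derivative deriv G (nome z) * ((2 * of_real pi * \<i>) * nome z)) (at z)"
      by (rule DERIV_chain2)
    moreover have "deriv G (nome z) * ((2 * of_real pi * \<i>) * nome z) = (2 * of_real pi * \<i>) * (\<epsilon> (nome z) * G (nome z))"
      unfolding log[OF n, symmetric] by (simp only: ac_simps)
    ultimately show ?thesis by simp
  qed
  have "(h has_field_derivative 0) (at z within uhp)" if z: "z \<in> uhp" for z
  proof -
    let ?w = "- 1 / (2 * z)"
    have w: "Im ?w > 0" using Im_Fricke_pos z by simp
    have z0: "z \<noteq> 0" using z by auto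
    have "((\<lambda>z. - 1 / (2 * z)) has_field_derivative 1 / (2 * z\<^sup>2)) (at z)"
      by (rule derivative_eq_intros refl | use z0 in \<open>simp add: power2_eq_square\<close>)+
    from DERIV_chain2[OF g'[OF w] this]
    have gw: "((\<lambda>z. G (nome (- 1 / (2 * z)))) has_field_derivative
       (2 * of_real pi * \<i>) * (\<epsilon> (nome ?w) * G (nome ?w)) * (1 / (2 * z\<^sup>2))) (at z)" .
    have "(h has_field_derivative 0) (at z)"
      unfolding h_def
      by (rule DERIV_cong[OF DERIV_mult[OF g' gw]]) (use z wt[of z] z0 in \<open>auto simp: field_simps\<close>)
    then show ?thesis by (rule has_field_derivative_at_within)
  qed
  then obtain C where C: "\<And>z. Im z > 0 \<Longrightarrow> h z = C"
    using has_field_derivative_zero_constant[of "uhp" h] convex_halfspace_Im_gt by (metis mem_Collect_eq)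
  have "h \<i> \<noteq> 0"
    unfolding h_def mult_eq_0_iff de_Morgan_disj
    by (intro conjI nz nome_in_punctured_disc Im_Fricke_pos) auto
  then show ?thesis using that[of C] C[of \<i>] C by (auto simp: h_def)
qed

lemma norm_nome_less: "r > 0 \<Longrightarrow> Im z > - ln r / (2 * pi) \<Longrightarrow> cmod (nome z) < r"
proof -
  assume r: "r > 0" "Im z > - ln r / (2 * pi)"
  then have "- 2 * pi * Im z < ln r" by (simp add: field_simps)
  then show ?thesis using r by (simp add: norm_nome) (metis exp_less_mono exp_ln)
qed

text \<open>
  The properties of the Hauptmodul that determine its fibres: invariance under the generators,
  divergence at the cusp, and injectivity modulo translations near the cusp.
\<close>

locale fricke_hauptmodul =
  fixes f :: "complex \<Rightarrow> complex" and Y :: real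
  assumes hol: "f holomorphic_on uhp"
    and f_T: "\<And>z. Im z > 0 \<Longrightarrow> f (z + 1) = f z"
    and f_W: "\<And>z. Im z > 0 \<Longrightarrow> f (- 1 / (2 * z)) = f z"
    and proper: "\<And>B. \<exists>Y. \<forall>z. Im z > Y \<longrightarrow> cmod (f z) > B"
    and cusp_inj: "\<And>z w. Im z > Y \<Longrightarrow> Im w > Y \<Longrightarrow> f z = f w \<Longrightarrow> \<exists>k::int. w = z + of_int k"

text \<open>
  This is the function \<open>1 / g + g / C\<close>. Translations do not change \<open>nome\<close>, and the involution exchanges the
  two summands. Near the cusp its reciprocal is a holomorphic function of \<open>q\<close> with a simple
  zero, which gives both the growth and the injectivity modulo translations.
\<close>

lemma hauptmodul_exists: "\<exists>f Y. fricke_hauptmodul f Y"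
proof -
  obtain \<epsilon> l where \<epsilon>: "\<epsilon> holomorphic_on ball 0 1" "\<epsilon> 0 = 1" and l: "l \<noteq> 0"
    and E: "\<And>z. Im z > 0 \<Longrightarrow> eis2 z = l * \<epsilon> (nome z)"
    using eis2_nome_expansion by metis
  obtain G where G: "G holomorphic_on ball 0 1" "G 0 = 0" "deriv G 0 \<noteq> 0"
    and Gnz: "\<And>q. q \<in> ball 0 1 - {0} \<Longrightarrow> G q \<noteq> 0"
    and Glog: "\<And>q. q \<in> ball 0 1 \<Longrightarrow> q * deriv G q = \<epsilon> q * G q"
    using logarithmic_antiderivative_at_0[OF \<epsilon>] by metis
  have wt: "\<epsilon> (nome (- 1 / (2 * z))) = - 2 * z\<^sup>2 * \<epsilon> (nome z)" if "Im z > 0" for z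
  proof -
    have "l * \<epsilon> (nome (- 1 / (2 * z))) = l * (- 2 * z\<^sup>2 * \<epsilon> (nome z))"
      unfolding E[OF Im_Fricke_pos[OF that], symmetric] eis2_Fricke[OF that] E[OF that] by simp
    then show ?thesis using l mult_left_cancel by blast
  qed
  obtain C where C: "C \<noteq> 0" "\<And>z. Im z > 0 \<Longrightarrow> G (nome z) * G (nome (- 1 / (2 * z))) = C"
    using Fricke_quotient_constant[OF G(1) Gnz Glog wt] by metis
  define g where "g z = G (nome z)" for z
  have gnz: "g z \<noteq> 0" if "Im z > 0" for z
    unfolding g_def using Gnz nome_in_punctured_disc[OF that] .
  have gW: "g (- 1 / (2 * z)) = C / g z" if "Im z > 0" for z
    using C(2)[OF that] gnz[OF that] by (simp add: g_def field_simps)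
  define f where "f z = inverse (g z) + g z / C" for z
  have g1: "g (z + 1) = g z" for z
    using nome_eq_iff[of z "z + 1"] by (simp add: g_def)
  have ghol: "g holomorphic_on uhp"
  proof -
    have "(G \<circ> nome) holomorphic_on uhp"
      by (rule holomorphic_on_compose_gen[OF _ G(1)])
         (use nome_in_punctured_disc in \<open>auto simp: nome_def[abs_def] intro!: holomorphic_intros\<close>)
    then show ?thesis by (simp add: g_def[abs_def] o_def)
  qed
  \<comment> \<open>The reciprocal of \<open>f\<close> as a function of \<open>q\<close>, with the pole of \<open>1 / G\<close> cleared.\<close>
  define \<psi> where "\<psi> q = C * G q / (C + (G q)\<^sup>2)" for q
  have "continuous_on (ball 0 1) (\<lambda>q. C + (G q)\<^sup>2)"
    by (intro continuous_intros holomorphic_on_imp_continuous_on G)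
  then have "isCont (\<lambda>q. C + (G q)\<^sup>2) 0"
    by (simp add: continuous_on_eq_continuous_at)
  then have "\<forall>\<^sub>F q in nhds 0. C + (G q)\<^sup>2 \<noteq> 0"
    unfolding isCont_def by (rule tendsto_imp_eventually_ne[OF _, THEN eventually_nhds_conv_at[THEN iffD2, OF conjI]])
      (use C G in auto)
  then obtain r1 where r1: "r1 > 0" "\<And>q. q \<in> ball 0 r1 \<Longrightarrow> C + (G q)\<^sup>2 \<noteq> 0"
    unfolding eventually_nhds_metric by (auto simp: dist_commute)
  define r where "r = min r1 1"
  have r: "r > 0" "(ball 0 r :: complex set) \<subseteq> ball 0 1" "r \<le> r1" "r \<le> 1" using r1 by (auto simp: r_def)
  have Cnz: "C + (G q)\<^sup>2 \<noteq> 0" if "q \<in> ball 0 r" for q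
    using r1(2)[of q] that r by auto
  have Gr: "G holomorphic_on ball 0 r" by (rule holomorphic_on_subset[OF G(1)]) (use r in auto)
  have \<psi>hol: "\<psi> holomorphic_on ball 0 r"
    unfolding \<psi>_def using Cnz by (intro holomorphic_intros Gr) auto
  have G0: "(G has_field_derivative deriv G 0) (at 0)"
    using holomorphic_derivI[OF G(1)] by simp
  have "(\<psi> has_field_derivative deriv G 0) (at 0)"
    unfolding \<psi>_def by (rule derivative_eq_intros G0 refl | use C G in \<open>simp add: power2_eq_square\<close>)+
  then have "deriv \<psi> 0 \<noteq> 0" using G(3) by (simp add: DERIV_imp_deriv)
  then obtain s where s: "s > 0" "(ball 0 s :: complex set) \<subseteq> ball 0 r" "inj_on \<psi> (ball 0 s)"
    using has_complex_derivative_locally_injective[OF \<psi>hol, of 0] r by auto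
  have f\<psi>: "f z \<noteq> 0 \<and> \<psi> (nome z) = inverse (f z)" if "Im z > 0" "cmod (nome z) < r" for z
  proof -
    have "C + (G (nome z))\<^sup>2 \<noteq> 0" using Cnz that by simp
    then show ?thesis using gnz[OF that(1)] C
      by (simp add: f_def \<psi>_def g_def field_simps power2_eq_square)
  qed
  have "fricke_hauptmodul f (max 1 (- ln s / (2 * pi)))"
  proof
    show "f holomorphic_on uhp"
      unfolding f_def using gnz C by (intro holomorphic_intros ghol) auto
    show "f (z + 1) = f z" for z by (simp add: f_def g1)
    show "f (- 1 / (2 * z)) = f z" if "Im z > 0" for z
      unfolding f_def gW[OF that] using gnz[OF that] C(1) by (simp add: inverse_eq_divide)
    show "\<exists>k::int. w = z + of_int k"
      if zw: "Im z > max 1 (- ln s / (2 * pi))" "Im w > max 1 (- ln s / (2 * pi))" and eq: "f z = f w" for z w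
    proof -
      have n: "nome z \<in> ball 0 s" "nome w \<in> ball 0 s" using norm_nome_less s zw by auto
      then have "\<psi> (nome z) = \<psi> (nome w)"
        using f\<psi>[of z] f\<psi>[of w] s(2) zw eq by (auto simp: subset_iff)
      then show ?thesis using s(3) n nome_eq_iff by (metis inj_onD)
    qed
    fix B :: real
    have "isCont \<psi> 0"
      using \<psi>hol r by (metis centre_in_ball continuous_on_eq_continuous_at holomorphic_on_imp_continuous_on open_ball)
    then obtain d where d: "d > 0" "\<And>q. cmod q < d \<Longrightarrow> cmod (\<psi> q) < inverse (\<bar>B\<bar> + 1)"
      unfolding continuous_at_eps_delta dist_norm using G(2)
      by (metis (no_types, lifting) \<psi>_def diff_zero div_0 mult_zero_right abs_ge_zero add_nonneg_pos zero_less_one positive_imp_inverse_positive)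
    show "\<exists>Y. \<forall>z. Im z > Y \<longrightarrow> cmod (f z) > B"
    proof (intro exI allI impI)
      fix z assume z: "Im z > max 1 (- ln (min d r) / (2 * pi))"
      then have n: "cmod (nome z) < min d r" using norm_nome_less[of "min d r"] d r by auto
      have "f z \<noteq> 0" "\<psi> (nome z) = inverse (f z)" using f\<psi>[of z] z n by auto
      then have "inverse (cmod (f z)) < inverse (\<bar>B\<bar> + 1)" using d(2)[of "nome z"] n by (simp add: norm_inverse)
      then have "\<bar>B\<bar> + 1 < cmod (f z)" using \<open>f z \<noteq> 0\<close> by (simp add: inverse_less_iff_less)
      then show "cmod (f z) > B" by linarith
    qed
  qed
  then show ?thesis by blast
qed

section \<open>The Fricke group of level two\<close>

text \<open>
  Integral matrices that represent the elements of \<open>H2_plus\<close>: determinant \<open>1\<close> for \<open>H2\<close>, and determinant \<open>2\<close>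
  for the Fricke coset, whose real representatives become integral after multiplication
  by the square root of \<open>2\<close>.
\<close>

definition fricke_mat :: "int \<Rightarrow> int \<Rightarrow> int \<Rightarrow> int \<Rightarrow> bool" where
  "fricke_mat a b c d \<longleftrightarrow>
     even c \<and> (a * d - b * c = 1 \<or> a * d - b * c = 2 \<and> even a \<and> even d)"

definition int_moebius :: "int \<Rightarrow> int \<Rightarrow> int \<Rightarrow> int \<Rightarrow> complex \<Rightarrow> complex" where
  "int_moebius a b c d z = (of_int a * z + of_int b) / (of_int c * z + of_int d)"

definition fricke_rel :: "complex \<Rightarrow> complex \<Rightarrow> bool" where
  "fricke_rel z w \<longleftrightarrow> (\<exists>a b c d. fricke_mat a b c d \<and> w = int_moebius a b c d z)"

lemma fricke_mat_denom_nonzero: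
  assumes "fricke_mat a b c d" "Im z > 0"
  shows "of_int c * z + of_int d \<noteq> 0"
proof -
  have "c \<noteq> 0 \<or> d \<noteq> 0" using assms(1) by (auto simp: fricke_mat_def)
  then have "real_of_int c \<noteq> 0 \<or> real_of_int d \<noteq> 0" by simp
  from lattice_vector_nonzero[OF assms(2), of "of_int d" "of_int c"] this
  show ?thesis by (auto simp: add.commute)
qed

lemma Im_int_moebius:
  assumes "of_int c * z + of_int d \<noteq> 0"
  shows "Im (int_moebius a b c d z) = of_int (a * d - b * c) * Im z / (cmod (of_int c * z + of_int d))\<^sup>2"
  unfolding int_moebius_def Im_divide cmod_power2
  by (rule arg_cong2[where f = "(/)"]) (simp_all add: algebra_simps)

lemma fricke_mat_Im_pos:
  assumes "fricke_mat a b c d" "Im z > 0"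
  shows "Im (int_moebius a b c d z) > 0"
proof -
  have "a * d - b * c > 0" using assms by (auto simp: fricke_mat_def)
  then have "real_of_int (a * d - b * c) > 0" unfolding of_int_0_less_iff .
  then show ?thesis
    using fricke_mat_denom_nonzero[OF assms] assms
    by (subst Im_int_moebius) (auto intro!: divide_pos_pos mult_pos_pos simp del: of_int_diff of_int_mult)
qed

lemma fricke_rel_Im_pos: "fricke_rel z w \<Longrightarrow> Im z > 0 \<Longrightarrow> Im w > 0"
  using fricke_mat_Im_pos by (auto simp: fricke_rel_def)

lemma fricke_rel_refl: "fricke_rel z z"
  unfolding fricke_rel_def
  by (rule exI[of _ 1], rule exI[of _ 0], rule exI[of _ 0], rule exI[of _ 1])
     (simp add: fricke_mat_def int_moebius_def)

lemma fricke_rel_sym: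
  assumes "fricke_rel z w" "Im z > 0"
  shows "fricke_rel w z"
proof -
  obtain a b c d where M: "fricke_mat a b c d" and w: "w = int_moebius a b c d z"
    using assms(1) by (auto simp: fricke_rel_def)
  have nz: "of_int c * z + of_int d \<noteq> 0" using fricke_mat_denom_nonzero[OF M assms(2)] .
  define D where "D = a * d - b * c"
  have D: "D \<noteq> 0" using M by (auto simp: fricke_mat_def D_def)
  have num: "of_int d * w + of_int (- b) = of_int D * z / (of_int c * z + of_int d)"
    and den: "of_int (- c) * w + of_int a = of_int D / (of_int c * z + of_int d)"
    using nz by (simp_all add: w int_moebius_def D_def field_simps)
  have "int_moebius d (- b) (- c) a w = z"
    unfolding int_moebius_def num den using nz D by simp
  moreover have "fricke_mat d (- b) (- c) a"
    using M by (auto simp: fricke_mat_def algebra_simps)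
  ultimately show ?thesis unfolding fricke_rel_def by metis
qed

lemma fricke_rel_translate:
  assumes "fricke_rel z w" "Im z > 0"
  shows "fricke_rel z (w + of_int k)"
proof -
  obtain a b c d where M: "fricke_mat a b c d" and w: "w = int_moebius a b c d z"
    using assms(1) by (auto simp: fricke_rel_def)
  have nz: "of_int c * z + of_int d \<noteq> 0" using fricke_mat_denom_nonzero[OF M assms(2)] .
  have "w + of_int k = int_moebius (a + k * c) (b + k * d) c d z"
    using nz by (simp add: w int_moebius_def field_simps)
  moreover have "fricke_mat (a + k * c) (b + k * d) c d"
    using M by (auto simp: fricke_mat_def algebra_simps)
  ultimately show ?thesis unfolding fricke_rel_def by blast
qed

text \<open>
  Composing with \<open>W\<close> multiplies the matrix by the one with rows \<open>(0, - 1)\<close> and \<open>(2, 0)\<close>. Starting from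
  determinant \<open>2\<close> the product has determinant \<open>4\<close> and all its entries are even.
\<close>

lemma int_moebius_Fricke:
  assumes M: "fricke_mat a b c d" and z: "Im z > 0"
  obtains (I) "a * d - b * c = 1" "fricke_mat (- c) (- d) (2 * a) (2 * b)"
      "- 1 / (2 * int_moebius a b c d z) = int_moebius (- c) (- d) (2 * a) (2 * b) z"
    | (F) c' d' where "c = 2 * c'" "a * d - b * c = 2" "(- c') * b - (- d') * a = 1" "fricke_mat (- c') (- d') a b"
      "- 1 / (2 * int_moebius a b c d z) = int_moebius (- c') (- d') a b z"
proof -
  have nz: "of_int c * z + of_int d \<noteq> 0" using fricke_mat_denom_nonzero[OF M z] .
  have "Im (int_moebius a b c d z) > 0" by (rule fricke_mat_Im_pos[OF M z])
  then have nz2: "of_int a * z + of_int b \<noteq> 0" by (auto simp: int_moebius_def)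
  obtain c' where c': "c = 2 * c'" using M by (auto simp: fricke_mat_def elim: evenE)
  consider "a * d - b * c = 1" | a' d' where "a = 2 * a'" "d = 2 * d'" "a * d - b * c = 2"
    using M by (auto simp: fricke_mat_def elim!: evenE)
  then show ?thesis
  proof cases
    case 1
    then have "fricke_mat (- c) (- d) (2 * a) (2 * b)"
      using M by (auto simp: fricke_mat_def algebra_simps)
    then show ?thesis using 1 nz nz2 by (intro I) (simp_all add: int_moebius_def field_simps)
  next
    case 2
    have "- 1 / (2 * int_moebius a b c d z) = (2 * (of_int (- c') * z + of_int (- d'))) / (2 * (of_int a * z + of_int b))"
      using nz nz2 by (simp add: int_moebius_def 2 c' field_simps)
    also have "\<dots> = int_moebius (- c') (- d') a b z"
      unfolding int_moebius_def by (rule mult_divide_mult_cancel_left) simp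
    finally show ?thesis
      using 2 c' by (intro F[of c' d']) (auto simp: fricke_mat_def algebra_simps)
  qed
qed

lemma fricke_rel_Fricke:
  assumes "fricke_rel z w" "Im z > 0"
  shows "fricke_rel z (- 1 / (2 * w))"
proof -
  obtain a b c d where M: "fricke_mat a b c d" and w: "w = int_moebius a b c d z"
    using assms(1) by (auto simp: fricke_rel_def)
  show ?thesis
    unfolding w by (rule int_moebius_Fricke[OF M assms(2)]) (auto simp: fricke_rel_def)
qed

lemma nearest_multiple:
  fixes a c :: int
  assumes "c \<noteq> 0"
  obtains k where "2 * \<bar>a + k * c\<bar> \<le> \<bar>c\<bar>"
proof -
  define k where "k = - round (real_of_int a / real_of_int c)"
  have "\<bar>real_of_int a / real_of_int c - of_int (round (real_of_int a / real_of_int c))\<bar> \<le> 1 / 2"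
    using of_int_round_abs_le[of "real_of_int a / real_of_int c"] by (simp add: abs_minus_commute)
  then have "\<bar>real_of_int a / real_of_int c + of_int k\<bar> * \<bar>real_of_int c\<bar> \<le> 1 / 2 * \<bar>real_of_int c\<bar>"
    unfolding k_def by (intro mult_right_mono) auto
  also have "\<bar>real_of_int a / real_of_int c + of_int k\<bar> * \<bar>real_of_int c\<bar> = \<bar>real_of_int (a + k * c)\<bar>"
    using assms by (simp add: abs_mult[symmetric] field_simps)
  finally have "real_of_int (2 * \<bar>a + k * c\<bar>) \<le> real_of_int \<bar>c\<bar>" by simp
  then have "2 * \<bar>a + k * c\<bar> \<le> \<bar>c\<bar>" unfolding of_int_le_iff .
  then show ?thesis using that by blast
qed

text \<open>
  \<open>T\<close> and \<open>W\<close> generate the group: a power of \<open>T\<close> reduces \<open>a\<close> modulo \<open>c\<close> to \<open>|a| \<le> |c| / 2\<close>, and then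
  \<open>W\<close> makes \<open>2 a\<close>, or \<open>a\<close> after cancelling a common factor \<open>2\<close>, the new lower left entry. From
  determinant \<open>1\<close> to determinant \<open>2\<close> the entry may keep its size, in the other direction it is at least
  halved, so \<open>2 |c|\<close> is corrected by the parity of the determinant to give a decreasing
  measure.
\<close>

lemma fricke_mat_induct:
  assumes M: "fricke_mat a b c d" and z: "Im z > 0" and P: "P z"
    and T: "\<And>w. Im w > 0 \<Longrightarrow> P w \<Longrightarrow> P (w + 1)"
    and T': "\<And>w. Im w > 0 \<Longrightarrow> P w \<Longrightarrow> P (w - 1)"
    and W: "\<And>w. Im w > 0 \<Longrightarrow> P w \<Longrightarrow> P (- 1 / (2 * w))"
  shows "P (int_moebius a b c d z)"
proof -
  have Tk: "P (w + of_int k)" if w: "Im w > 0" "P w" for w k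
  proof -
    have 1: "P (w + of_nat n)" for n
      by (induction n) (use w T[of "w + of_nat _"] in \<open>auto simp: add_ac\<close>)
    have 2: "P (w - of_nat n)" for n
      by (induction n) (use w T'[of "w - of_nat _"] in \<open>auto simp: algebra_simps\<close>)
    show ?thesis using 1[of "nat k"] 2[of "nat (- k)"] by (cases "k \<ge> 0") auto
  qed
  from M show ?thesis
  proof (induction "nat (2 * \<bar>c\<bar> + (a * d - b * c) mod 2)" arbitrary: a b c d rule: less_induct)
    case less
    note M = less.prems
    show ?case
    proof (cases "c = 0")
      case True
      then have "a * d = 1" using M by (auto simp: fricke_mat_def elim!: evenE) presburger+
      then consider "a = 1" "d = 1" | "a = - 1" "d = - 1" by (auto simp: zmult_eq_1_iff)
      then show ?thesis
        using True Tk[OF z P, of b] Tk[OF z P, of "- b"]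
        by cases (auto simp: int_moebius_def add_divide_distrib)
    next
      case False
      obtain k where k: "2 * \<bar>a + k * c\<bar> \<le> \<bar>c\<bar>" using nearest_multiple[OF False] by blast
      define w where "w = int_moebius a b c d z"
      define v where "v = - 1 / (2 * (w + of_int k))"
      have rel: "fricke_rel z w" using M by (auto simp: fricke_rel_def w_def)
      have wk: "Im (w + of_int k) > 0" using fricke_rel_Im_pos[OF rel z] by simp
      have v: "Im v > 0" unfolding v_def by (rule Im_Fricke_pos[OF wk])
      have nz: "of_int c * z + of_int d \<noteq> 0" using fricke_mat_denom_nonzero[OF M z] .
      define a' b' where "a' = a + k * c" and "b' = b + k * d"
      have wk': "w + of_int k = int_moebius a' b' c d z"
        using nz by (simp add: w_def a'_def b'_def int_moebius_def field_simps)
      have M': "fricke_mat a' b' c d"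
        using M by (auto simp: fricke_mat_def a'_def b'_def algebra_simps)
      have det: "a * d - b * c = a' * d - b' * c" by (simp add: a'_def b'_def algebra_simps)
      from M' z have "P v"
      proof (cases rule: int_moebius_Fricke)
        case I
        have "(- c) * (2 * b') - (- d) * (2 * a') = 2" using I(1) by (simp add: algebra_simps)
        moreover have "\<bar>2 * a'\<bar> \<le> \<bar>c\<bar>" using k unfolding a'_def abs_mult by simp
        ultimately show ?thesis
          using less.hyps[OF _ I(2)] I det by (simp add: v_def wk')
      next
        case (F c' d')
        have "2 * \<bar>a'\<bar> + 1 < 2 * \<bar>c\<bar>" using k False F(1) unfolding a'_def[symmetric] by presburger
        then show ?thesis
          using less.hyps[OF _ F(4)] F det by (simp add: v_def wk')
      qed
      then have "P (- 1 / (2 * v))" by (rule W[OF v])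
      moreover have "- 1 / (2 * (- 1 / (2 * u))) = u" for u :: complex by simp
      ultimately have "P (w + of_int k)" unfolding v_def by metis
      then have "P (w + of_int k + of_int (- k))" by (rule Tk[OF wk])
      then show ?thesis by (simp add: w_def)
    qed
  qed
qed

lemma fricke_rel_induct:
  assumes "fricke_rel z w" "Im z > 0" "P z"
    and "\<And>w. Im w > 0 \<Longrightarrow> P w \<Longrightarrow> P (w + 1)"
    and "\<And>w. Im w > 0 \<Longrightarrow> P w \<Longrightarrow> P (w - 1)"
    and "\<And>w. Im w > 0 \<Longrightarrow> P w \<Longrightarrow> P (- 1 / (2 * w))"
  shows "P w"
  using assms fricke_mat_induct[of _ _ _ _ z P] unfolding fricke_rel_def by blast

lemma fricke_rel_trans:
  assumes "fricke_rel x y" "fricke_rel y z" "Im x > 0"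
  shows "fricke_rel x z"
  using assms(2)
proof (rule fricke_rel_induct)
  show "Im y > 0" using fricke_rel_Im_pos assms by blast
  show "fricke_rel x (w + 1)" "fricke_rel x (w - 1)" if "fricke_rel x w" for w
    using fricke_rel_translate[OF that assms(3), of 1] fricke_rel_translate[OF that assms(3), of "- 1"] by simp_all
  show "fricke_rel x (- 1 / (2 * w))" if "fricke_rel x w" for w
    using fricke_rel_Fricke[OF that assms(3)] .
qed fact

lemma fricke_rel_add_int: "Im z > 0 \<Longrightarrow> fricke_rel z (z + of_int k)"
  using fricke_rel_translate[OF fricke_rel_refl] .

text \<open>
  A set that meets every orbit. The height \<open>2/5\<close> lies strictly below the height \<open>1/2\<close> of the corners of the
  usual fundamental domain, which gives the reduction a uniform gain at every step.
\<close>

definition siegel_set :: "complex set" where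
  "siegel_set = {z. \<bar>Re z\<bar> \<le> 1/2 \<and> Im z \<ge> 2/5}"

text \<open>
  If \<open>|Re w| \<le> 1/2\<close> and \<open>Im w < 2/5\<close> then \<open>2 |w|\<^sup>2 \<le> 2 (1/4 + 4/25) = 41/50\<close>, so \<open>W\<close> raises the imaginary
  part by a factor of at least \<open>50/41\<close>.
\<close>

lemma fricke_reduction:
  assumes "Im z > 0"
  obtains w where "w \<in> siegel_set" "fricke_rel z w"
proof -
  have main: "\<exists>w\<in>siegel_set. fricke_rel z w" if "Im z > 0" "Im z \<ge> 2/5 * (41/50) ^ n" for n z
    using that
  proof (induction n arbitrary: z)
    case (0 z)
    define k where "k = - round (Re z)"
    have "\<bar>Re (z + of_int k)\<bar> \<le> 1/2"
      using of_int_round_abs_le[of "Re z"] by (simp add: k_def abs_minus_commute)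
    then have "z + of_int k \<in> siegel_set" using 0 by (simp add: siegel_set_def)
    then show ?case using fricke_rel_add_int 0 by blast
  next
    case (Suc n z)
    define k where "k = - round (Re z)"
    define w where "w = z + of_int k"
    have w: "\<bar>Re w\<bar> \<le> 1/2" "Im w = Im z"
      using of_int_round_abs_le[of "Re z"] by (simp_all add: k_def w_def abs_minus_commute)
    have zw: "fricke_rel z w" unfolding w_def using fricke_rel_add_int Suc by blast
    show ?case
    proof (cases "Im z \<ge> 2/5")
      case True
      then show ?thesis using w zw by (auto simp: siegel_set_def)
    next
      case False
      let ?v = "- 1 / (2 * w)"
      have "(Re w)\<^sup>2 \<le> (1/2)\<^sup>2" using w power_mono[of "\<bar>Re w\<bar>" "1/2" 2] by simp
      moreover have "(Im w)\<^sup>2 \<le> (2/5)\<^sup>2" using w False Suc.prems by (intro power_mono) auto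
      ultimately have n: "2 * ((Re w)\<^sup>2 + (Im w)\<^sup>2) \<le> 41/50" by (simp add: power2_eq_square)
      have n0: "(Im w)\<^sup>2 > 0" using w Suc.prems by simp
      have "Im ?v = (2 * Im w) / (2 * (2 * ((Re w)\<^sup>2 + (Im w)\<^sup>2)))"
        by (simp add: Im_divide power2_eq_square algebra_simps)
      also have "\<dots> = Im w / (2 * ((Re w)\<^sup>2 + (Im w)\<^sup>2))"
        by (rule mult_divide_mult_cancel_left) simp
      also have "\<dots> \<ge> Im w / (41/50)"
        using n n0 w Suc.prems by (intro divide_left_mono mult_pos_pos add_nonneg_pos) auto
      finally have "Im ?v \<ge> Im z / (41/50)" using w by simp
      moreover have "Im z / (41/50) \<ge> 2/5 * (41/50) ^ n" using Suc.prems by (simp add: field_simps)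
      ultimately have "Im ?v \<ge> 2/5 * (41/50) ^ n" by linarith
      moreover have "Im ?v > 0" using Im_Fricke_pos w Suc.prems by simp
      ultimately obtain u where u: "u \<in> siegel_set" "fricke_rel ?v u" using Suc.IH by blast
      have "fricke_rel z ?v" using fricke_rel_Fricke[OF zw] Suc.prems by blast
      then show ?thesis using u fricke_rel_trans Suc.prems by blast
    qed
  qed
  have "(\<lambda>n. 2/5 * (41/50) ^ n :: real) \<longlonglongrightarrow> 2/5 * 0"
    by (intro tendsto_mult tendsto_const LIMSEQ_power_zero) simp
  then have "\<forall>\<^sub>F n in sequentially. 2/5 * (41/50) ^ n < Im z"
    by (rule order_tendstoD(2)) (use assms in simp)
  then obtain n where "2/5 * (41/50) ^ n < Im z" using eventually_sequentially by auto
  then show ?thesis using main[of z n] assms that by auto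
qed

text \<open>
  Proper discontinuity: if \<open>x\<close> and \<open>y = (a x + b) / (c x + d)\<close> both stay in a box, the comparison of their
  imaginary parts bounds \<open>c x + d\<close>, hence also \<open>a x + b\<close>, so only finitely many matrices occur, and
  each of them relates a closed set of pairs.
\<close>

lemma fricke_rel_closed_on_box:
  assumes e: "0 < e" and R: "0 \<le> R"
  obtains C :: "(complex \<times> complex) set" where "closed C"
    "\<And>x y. x \<in> strip R e \<Longrightarrow> y \<in> strip R e \<Longrightarrow> Im x \<le> S \<Longrightarrow> Im y \<le> S \<Longrightarrow> fricke_rel x y \<longleftrightarrow> (x, y) \<in> C"
proof -
  define K where "K = lat_const R e"
  have K: "K \<ge> 1" using e R by (simp add: K_def lat_const_def)
  define N where "N = \<lceil>K * (1 + R + \<bar>S\<bar>) * sqrt (2 * \<bar>S\<bar> / e)\<rceil>"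
  define Z where "Z = (\<lambda>(a, b, c, d). {(x :: complex, y). y * (of_int c * x + of_int d) = of_int a * x + of_int b})"
  define F where "F = {(a, b, c, d). fricke_mat a b c d} \<inter> ({-N..N} \<times> {-N..N} \<times> {-N..N} \<times> {-N..N})"
  define C where "C = (\<Union>m\<in>F. Z m)"
  have "closed (Z m)" for m
    unfolding Z_def case_prod_unfold by (intro closed_Collect_eq continuous_intros)
  then have "closed C" unfolding C_def F_def by (intro closed_UN) auto
  moreover have "fricke_rel x y \<longleftrightarrow> (x, y) \<in> C"
    if x: "x \<in> strip R e" and y: "y \<in> strip R e" and S: "Im x \<le> S" "Im y \<le> S" for x y
  proof
    have pos: "Im x > 0" "Im y > 0" "S > 0" using x y S e by (auto simp: strip_def)
    show "fricke_rel x y" if "(x, y) \<in> C"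
    proof -
      from that obtain a b c d where M: "fricke_mat a b c d"
        and eq: "y * (of_int c * x + of_int d) = of_int a * x + of_int b"
        by (auto simp: C_def F_def Z_def)
      then show ?thesis using fricke_mat_denom_nonzero[OF M pos(1)]
        unfolding fricke_rel_def int_moebius_def by (metis nonzero_mult_div_cancel_right)
    qed
    assume "fricke_rel x y"
    then obtain a b c d where M: "fricke_mat a b c d" and yx: "y = int_moebius a b c d x"
      by (auto simp: fricke_rel_def)
    define u where "u = cmod (of_int c * x + of_int d)"
    have nz: "of_int c * x + of_int d \<noteq> 0" using fricke_mat_denom_nonzero[OF M pos(1)] .
    have u0: "u > 0" using nz by (simp add: u_def)
    have "Im y = of_int (a * d - b * c) * Im x / u\<^sup>2"
      unfolding yx u_def by (rule Im_int_moebius[OF nz])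
    then have "u\<^sup>2 * Im y = of_int (a * d - b * c) * Im x" using u0 by (simp add: field_simps)
    also have "\<dots> \<le> 2 * S"
    proof (intro mult_mono)
      have "a * d - b * c \<le> 2" using M by (auto simp: fricke_mat_def)
      then have "real_of_int (a * d - b * c) \<le> real_of_int 2" unfolding of_int_le_iff .
      then show "real_of_int (a * d - b * c) \<le> 2" by simp
    qed (use S pos in auto)
    finally have "u\<^sup>2 * Im y \<le> 2 * S" .
    moreover have "u\<^sup>2 * e \<le> u\<^sup>2 * Im y" using y by (intro mult_left_mono) (auto simp: strip_def)
    ultimately have "u\<^sup>2 \<le> 2 * \<bar>S\<bar> / e" using e pos by (simp add: field_simps)
    then have u: "u \<le> sqrt (2 * \<bar>S\<bar> / e)" by (rule real_le_rsqrt)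
    have eq: "y * (of_int c * x + of_int d) = of_int a * x + of_int b"
      using nz by (simp add: yx int_moebius_def)
    have "cmod y \<le> \<bar>Re y\<bar> + \<bar>Im y\<bar>" by (rule cmod_le)
    also have "\<dots> \<le> R + \<bar>S\<bar>" using y S pos by (auto simp: strip_def)
    finally have ny: "cmod y \<le> R + \<bar>S\<bar>" .
    have v: "cmod (of_int a * x + of_int b) \<le> (R + \<bar>S\<bar>) * sqrt (2 * \<bar>S\<bar> / e)"
      unfolding eq[symmetric] norm_mult u_def[symmetric] using ny u u0 R by (intro mult_mono) auto
    have bd: "i \<in> {-N..N} \<and> j \<in> {-N..N}" if "cmod (of_int i * x + of_int j) \<le> (1 + R + \<bar>S\<bar>) * sqrt (2 * \<bar>S\<bar> / e)" for i j
    proof -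
      have "\<bar>of_int j\<bar> + \<bar>of_int i\<bar> \<le> K * cmod (of_int i * x + of_int j)"
        using lattice_vector_lower_bounds(1)[OF x e R, of "of_int j" "of_int i"] by (simp add: K_def add.commute)
      also have "\<dots> \<le> K * ((1 + R + \<bar>S\<bar>) * sqrt (2 * \<bar>S\<bar> / e))" using that K by (intro mult_left_mono) auto
      also have "\<dots> \<le> of_int N" unfolding N_def mult.assoc by (rule le_of_int_ceiling)
      finally have "\<bar>j\<bar> + \<bar>i\<bar> \<le> N" by linarith
      then show ?thesis by auto
    qed
    have le: "t * sqrt (2 * \<bar>S\<bar> / e) \<le> (1 + R + \<bar>S\<bar>) * sqrt (2 * \<bar>S\<bar> / e)" if "t \<le> 1 + R + \<bar>S\<bar>" for t
      using that e by (intro mult_right_mono) auto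
    have "a \<in> {-N..N} \<and> b \<in> {-N..N}" using bd[OF order_trans[OF v le]] by simp
    moreover have "c \<in> {-N..N} \<and> d \<in> {-N..N}" 
      using bd[OF order_trans[OF _ le[of 1]], of c d] u R unfolding u_def by simp
    ultimately have "(a, b, c, d) \<in> F" using M by (simp add: F_def)
    moreover have "(x, y) \<in> Z (a, b, c, d)" using eq by (simp add: Z_def)
    ultimately show "(x, y) \<in> C" unfolding C_def by blast
  qed
  ultimately show ?thesis using that by blast
qed

section \<open>The Hauptmodul classifies orbits\<close>

lemma fsigma_upper_half_plane: "fsigma uhp"
proof -
  have "uhp = (\<Union>n::nat. {z. Im z \<ge> inverse (of_nat (Suc n))})"
  proof safe
    fix z :: complex assume "Im z > 0"
    then obtain n where "inverse (of_nat (Suc n)) < Im z" using reals_Archimedean by blast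
    then show "z \<in> (\<Union>n::nat. {z. Im z \<ge> inverse (of_nat (Suc n))})" by (auto intro: less_imp_le)
  next
    fix z :: complex and n :: nat assume "inverse (real (Suc n)) \<le> Im z"
    moreover have "inverse (real (Suc n)) > 0" by simp
    ultimately show "Im z > 0" by linarith
  qed
  then show ?thesis by (metis fsigma.intros closed_halfspace_Im_ge)
qed

lemma countable_open_imp_empty:
  fixes U :: "complex set"
  assumes "open U" "countable U"
  shows "U = {}"
proof (rule ccontr)
  assume "U \<noteq> {}"
  then obtain x r where "r > 0" "ball x r \<subseteq> U" using assms(1) openE by blast
  then show False using uncountable_ball[of r x] countable_subset assms(2) by blast
qed

lemma fricke_rel_transport:
  assumes "fricke_rel x x'" "fricke_rel y y'" "fricke_rel x' y'" "Im x > 0" "Im y > 0"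
  shows "fricke_rel x y"
  using fricke_rel_trans[OF fricke_rel_trans[OF assms(1,3,4)] fricke_rel_sym[OF assms(2,5)] assms(4)] .

context fricke_hauptmodul
begin

lemma invariant:
  assumes "fricke_rel z w" "Im z > 0"
  shows "f z = f w"
  using assms
proof (rule fricke_rel_induct[where P = "\<lambda>w. f z = f w"])
  show "f z = f (w + 1)" "f z = f (- 1 / (2 * w))" if "Im w > 0" "f z = f w" for w
    using that f_T f_W by auto
  show "f z = f (w - 1)" if "Im w > 0" "f z = f w" for w
    using that f_T[of "w - 1"] by simp
qed simp

lemma not_constant: "\<not> f constant_on uhp"
proof
  assume "f constant_on uhp"
  then obtain c where c: "\<And>z. Im z > 0 \<Longrightarrow> f z = c" by (auto simp: constant_on_def)
  obtain Y where "\<forall>z. Im z > Y \<longrightarrow> cmod (f z) > cmod c" using proper by blast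
  then show False using c[of "\<i> * of_real (\<bar>Y\<bar> + 1)"] by (auto dest: spec[of _ "\<i> * of_real (\<bar>Y\<bar> + 1)"])
qed

lemma open_uhp: "open uhp" by (rule open_halfspace_Im_gt)

lemma connected_uhp: "connected uhp"
  by (intro convex_connected convex_halfspace_Im_gt)

lemma open_map: "open U \<Longrightarrow> U \<subseteq> uhp \<Longrightarrow> open (f ` U)"
  using open_mapping_thm[OF hol open_uhp connected_uhp _ _ not_constant] by blast

lemma continuous: "continuous_on uhp f"
  by (rule holomorphic_on_imp_continuous_on[OF hol])

lemma isCont: "Im z > 0 \<Longrightarrow> isCont f z"
  using continuous continuous_on_eq_continuous_at[OF open_uhp] by blast

text \<open>
  Bounded values force bounded imaginary parts, so the sequence stays in a compact part of the
  Siegel set.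
\<close>

lemma siegel_sequence_limit:
  assumes x: "\<And>n. x n \<in> siegel_set" and lim: "(\<lambda>n. f (x n)) \<longlonglongrightarrow> c"
  obtains s l where "strict_mono s" "Im l > 0" "f l = c" "(x \<circ> s) \<longlonglongrightarrow> l"
proof -
  have "Bseq (\<lambda>n. f (x n))" using lim by (intro convergent_imp_Bseq) (auto simp: convergent_def)
  then obtain B where B: "\<And>n. cmod (f (x n)) \<le> B" by (auto simp: Bseq_def)
  obtain Y' where Y': "\<And>z. Im z > Y' \<Longrightarrow> cmod (f z) > B" using proper by blast
  have "Im (x n) \<le> Y'" for n using Y'[of "x n"] B[of n] by (meson linorder_not_le)
  then have "x n \<in> cbox (Complex (- 1/2) (2/5)) (Complex (1/2) Y')" for n
    using x[of n] by (auto simp: siegel_set_def in_cbox_complex_iff abs_le_iff)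
  moreover have "compact (cbox (Complex (- 1/2) (2/5)) (Complex (1/2) Y'))" by (rule compact_cbox)
  ultimately obtain l s where l: "l \<in> cbox (Complex (- 1/2) (2/5)) (Complex (1/2) Y')"
    and s: "strict_mono s" "(x \<circ> s) \<longlonglongrightarrow> l"
    unfolding compact_def by blast
  have "Im l > 0" using l by (auto simp: in_cbox_complex_iff)
  moreover have "(\<lambda>n. f ((x \<circ> s) n)) \<longlonglongrightarrow> f l"
    by (rule isCont_tendsto_compose[OF isCont[OF \<open>Im l > 0\<close>] s(2)])
  moreover have "(\<lambda>n. f ((x \<circ> s) n)) \<longlonglongrightarrow> c"
    using LIMSEQ_subseq_LIMSEQ[OF lim s(1)] by (simp add: o_def)
  ultimately show ?thesis using that s LIMSEQ_unique by blast
qed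

lemma preimage_in_siegel_set:
  assumes "Im z > 0" obtains w where "w \<in> siegel_set" "fricke_rel z w" "f w = f z"
  using fricke_reduction[OF assms] invariant[OF _ assms] by metis

lemma siegel_set_Im_pos: "z \<in> siegel_set \<Longrightarrow> Im z > 0" by (auto simp: siegel_set_def)

lemma surjective: "f ` uhp = UNIV"
proof -
  have "closed (f ` uhp)"
    unfolding closed_sequential_limits
  proof safe
    fix c l assume c: "\<forall>n. c n \<in> f ` uhp" and lim: "c \<longlonglongrightarrow> l"
    have "\<exists>x. x \<in> siegel_set \<and> f x = c n" for n
    proof -
      obtain z where "Im z > 0" "c n = f z" using c by blast
      then show ?thesis using preimage_in_siegel_set[of z] by metis
    qed
    then obtain x where x: "\<And>n. x n \<in> siegel_set" "\<And>n. f (x n) = c n" by metis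
    from lim x(2) have "(\<lambda>n. f (x n)) \<longlonglongrightarrow> l" by simp
    then obtain a where "Im a > 0" "f a = l" using siegel_sequence_limit[of x l] x(1) by metis
    then show "l \<in> f ` uhp" by auto
  qed
  moreover have "open (f ` uhp)" using open_map open_uhp by blast
  moreover have "f \<i> \<in> f ` uhp" by (rule imageI) simp
  ultimately show ?thesis using clopen[of "f ` uhp"] by (metis empty_iff)
qed

definition double_values :: "complex set" where
  "double_values = {c. \<exists>x y. Im x > 0 \<and> Im y > 0 \<and> f x = c \<and> f y = c \<and> \<not> fricke_rel x y}"

definition critical_values :: "complex set" where
  "critical_values = f ` {z. Im z > 0 \<and> deriv f z = 0}"

lemma deriv_holomorphic: "deriv f holomorphic_on uhp"
  by (rule holomorphic_deriv[OF hol open_uhp])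

lemma deriv_nonzero_somewhere: obtains b where "Im b > 0" "deriv f b \<noteq> 0"
proof -
  have False if zero: "\<And>z. Im z > 0 \<Longrightarrow> deriv f z = 0"
  proof -
    have "(f has_field_derivative 0) (at z within uhp)" if "z \<in> uhp" for z
      using holomorphic_derivI[OF hol open_uhp that] zero[of z] that by (auto intro: has_field_derivative_at_within)
    then have "f constant_on uhp"
      using has_field_derivative_zero_constant[OF convex_halfspace_Im_gt, of 0 f]
      by (auto simp: constant_on_def)
    then show False using not_constant by blast
  qed
  then show ?thesis using that by blast
qed

lemma countable_critical_values: "countable critical_values"
proof -
  have "countable {z \<in> uhp. deriv f z = 0}"
  proof (rule ccontr)
    assume "uncountable {z \<in> uhp. deriv f z = 0}"
    then have "uhp \<subseteq> {z \<in> uhp. deriv f z = 0}"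
      by (intro holomorphic_countable_equal[OF deriv_holomorphic])
         (auto intro: open_uhp connected_uhp fsigma_upper_half_plane)
    then show False using deriv_nonzero_somewhere by blast
  qed
  then show ?thesis unfolding critical_values_def by (intro countable_image) simp
qed

text \<open>
  Related pairs form a closed set on a box, which makes the orbit space Hausdorff.
\<close>

lemma inequivalent_open:
  assumes "Im x > 0" "Im y > 0" "\<not> fricke_rel x y"
  obtains r where "r > 0" "ball x r \<subseteq> uhp" "ball y r \<subseteq> uhp"
    "\<And>x' y'. x' \<in> ball x r \<Longrightarrow> y' \<in> ball y r \<Longrightarrow> \<not> fricke_rel x' y'"
proof -
  define e where "e = min (Im x) (Im y) / 2"
  define R where "R = max \<bar>Re x\<bar> \<bar>Re y\<bar> + e"
  define S where "S = max (Im x) (Im y) + e"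
  have e: "e > 0" using assms by (simp add: e_def)
  have near: "z' \<in> strip R e \<and> Im z' \<le> S" if "z \<in> {x, y}" "z' \<in> ball z e" for z z'
  proof -
    have "cmod (z - z') < e" using that by (simp add: dist_norm)
    then have d: "\<bar>Re z - Re z'\<bar> < e" "\<bar>Im z - Im z'\<bar> < e"
      using abs_Re_le_cmod[of "z - z'"] abs_Im_le_cmod[of "z - z'"] unfolding minus_complex.sel by linarith+
    have z: "\<bar>Re z\<bar> \<le> R - e" "Im z \<le> S - e" "2 * e \<le> Im z"
      using that by (auto simp: R_def S_def e_def)
    have "\<bar>Re z'\<bar> \<le> R" "e \<le> Im z'" "Im z' \<le> S" using d z by linarith+
    then show ?thesis by (simp add: strip_def)
  qed
  obtain C where C: "closed C"
    "\<And>x y. x \<in> strip R e \<Longrightarrow> y \<in> strip R e \<Longrightarrow> Im x \<le> S \<Longrightarrow> Im y \<le> S \<Longrightarrow> fricke_rel x y \<longleftrightarrow> (x, y) \<in> C"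
    using fricke_rel_closed_on_box[of e R S] e unfolding R_def by auto
  have "(x, y) \<in> - C" using C(2)[of x y] near[of x x] near[of y y] e assms by auto
  moreover have "open (- C)" using C(1) by auto
  ultimately obtain A B where AB: "open A" "open B" "x \<in> A" "y \<in> B" "A \<times> B \<subseteq> - C"
    using open_prod_elim by (metis mem_Sigma_iff)
  obtain r1 r2 where r12: "r1 > 0" "ball x r1 \<subseteq> A" "r2 > 0" "ball y r2 \<subseteq> B"
    using AB openE by metis
  define r where "r = min e (min r1 r2)"
  have r: "r > 0" "ball x r \<subseteq> ball x e" "ball y r \<subseteq> ball y e" "ball x r \<subseteq> A" "ball y r \<subseteq> B"
    using e r12 subset_ball[of r r1 x] subset_ball[of r r2 y] by (auto simp: r_def)
  show ?thesis
  proof (rule that[OF r(1)])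
    show "ball x r \<subseteq> uhp" "ball y r \<subseteq> uhp"
      using near[of x] near[of y] r e by (force simp: strip_def)+
    show "\<not> fricke_rel x' y'" if "x' \<in> ball x r" "y' \<in> ball y r" for x' y'
      using C(2)[of x' y'] near[of x x'] near[of y y'] that r AB(5) by blast
  qed
qed

lemma open_double_values: "open double_values"
proof (subst open_subopen, safe)
  fix c assume "c \<in> double_values"
  then obtain x y where xy: "Im x > 0" "Im y > 0" "f x = c" "f y = c" "\<not> fricke_rel x y"
    by (auto simp: double_values_def)
  obtain r where r: "r > 0" "ball x r \<subseteq> uhp" "ball y r \<subseteq> uhp"
    "\<And>x' y'. x' \<in> ball x r \<Longrightarrow> y' \<in> ball y r \<Longrightarrow> \<not> fricke_rel x' y'"
    using inequivalent_open[OF xy(1,2,5)] by metis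
  show "\<exists>T. open T \<and> c \<in> T \<and> T \<subseteq> double_values"
  proof (intro exI conjI)
    show "open (f ` ball x r \<inter> f ` ball y r)" using r by (intro open_Int open_map) auto
    show "c \<in> f ` ball x r \<inter> f ` ball y r"
      using xy r(1) by (intro IntI image_eqI[of c f x] image_eqI[of c f y]) auto
    show "f ` ball x r \<inter> f ` ball y r \<subseteq> double_values"
    proof
      fix d assume "d \<in> f ` ball x r \<inter> f ` ball y r"
      then obtain x' y' where "x' \<in> ball x r" "y' \<in> ball y r" "f x' = d" "f y' = d" by auto
      then show "d \<in> double_values" using r unfolding double_values_def by blast
    qed
  qed
qed

text \<open>
  Two inequivalent preimages can only disappear in a limit by merging into one orbit. Moving the
  second sequence by the matrix that relates the two limits makes them merge at a point of
  the upper half plane, where \<open>f\<close> would fail to be injective; this requires a critical value.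
\<close>

lemma double_values_limit:
  assumes c: "\<And>n. c n \<in> double_values" and lim: "c \<longlonglongrightarrow> l" and l: "l \<notin> critical_values"
  shows "l \<in> double_values"
proof -
  have "\<exists>x y. x \<in> siegel_set \<and> y \<in> siegel_set \<and> f x = c n \<and> f y = c n \<and> \<not> fricke_rel x y" for n
  proof -
    obtain x y where xy: "Im x > 0" "Im y > 0" "f x = c n" "f y = c n" "\<not> fricke_rel x y"
      using c[of n] by (auto simp: double_values_def)
    obtain x' where x': "x' \<in> siegel_set" "fricke_rel x x'" "f x' = f x"
      using preimage_in_siegel_set[OF xy(1)] by metis
    obtain y' where y': "y' \<in> siegel_set" "fricke_rel y y'" "f y' = f y"
      using preimage_in_siegel_set[OF xy(2)] by metis
    have "\<not> fricke_rel x' y'"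
      using fricke_rel_transport[OF x'(2) y'(2) _ xy(1,2)] xy(5) by blast
    then show ?thesis using x' y' xy by auto
  qed
  then obtain x y where xy: "\<And>n. x n \<in> siegel_set" "\<And>n. y n \<in> siegel_set"
    "\<And>n. f (x n) = c n" "\<And>n. f (y n) = c n" "\<And>n. \<not> fricke_rel (x n) (y n)"
    by metis
  obtain s a where s: "strict_mono s" "Im a > 0" "f a = l" "(x \<circ> s) \<longlonglongrightarrow> a"
    using siegel_sequence_limit[of x l] xy lim by auto
  have "(\<lambda>n. f ((y \<circ> s) n)) \<longlonglongrightarrow> l"
    using LIMSEQ_subseq_LIMSEQ[OF lim s(1)] xy(4) by (simp add: o_def)
  then obtain t b where t: "strict_mono t" "Im b > 0" "f b = l" "((y \<circ> s) \<circ> t) \<longlonglongrightarrow> b"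
    using siegel_sequence_limit[of "y \<circ> s" l] xy by auto
  have xa: "((x \<circ> s) \<circ> t) \<longlonglongrightarrow> a" by (rule LIMSEQ_subseq_LIMSEQ[OF s(4) t(1)])
  define u v where "u n = x (s (t n))" and "v n = y (s (t n))" for n
  have uv: "u \<longlonglongrightarrow> a" "v \<longlonglongrightarrow> b" "\<And>n. f (u n) = f (v n)" "\<And>n. \<not> fricke_rel (u n) (v n)"
    "\<And>n. Im (u n) > 0" "\<And>n. Im (v n) > 0"
    using xa t(4) xy siegel_set_Im_pos by (auto simp: u_def[abs_def] v_def[abs_def] o_def)
  show ?thesis
  proof (cases "fricke_rel b a")
    case False
    then have "\<not> fricke_rel a b" using fricke_rel_sym s(2) by blast
    then show ?thesis using s t by (auto simp: double_values_def)
  next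
    case True
    then obtain p q r' k where M: "fricke_mat p q r' k" and a: "a = int_moebius p q r' k b"
      by (auto simp: fricke_rel_def)
    have "isCont (int_moebius p q r' k) b"
      unfolding int_moebius_def using fricke_mat_denom_nonzero[OF M t(2)] by (intro continuous_intros) auto
    then have mv: "(\<lambda>n. int_moebius p q r' k (v n)) \<longlonglongrightarrow> a"
      unfolding a by (rule isCont_tendsto_compose[OF _ uv(2)])
    have rel: "fricke_rel (v n) (int_moebius p q r' k (v n))" for n
      using M by (auto simp: fricke_rel_def)
    have "deriv f a \<noteq> 0" using l s by (auto simp: critical_values_def)
    then obtain e where e: "e > 0" "ball a e \<subseteq> uhp" "inj_on f (ball a e)"
      using has_complex_derivative_locally_injective[OF hol _ open_uhp] s(2) by (metis mem_Collect_eq)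
    have ball: "open (ball a e)" "a \<in> ball a e" using e by auto
    have "\<forall>\<^sub>F n in sequentially. u n \<in> ball a e \<and> int_moebius p q r' k (v n) \<in> ball a e"
      using topological_tendstoD[OF uv(1) ball] topological_tendstoD[OF mv ball] by (rule eventually_conj)
    then obtain n where n: "u n \<in> ball a e" "int_moebius p q r' k (v n) \<in> ball a e"
      using eventually_sequentially by auto
    have "f (int_moebius p q r' k (v n)) = f (u n)" using invariant[OF rel uv(6)] uv(3) by metis
    then have "int_moebius p q r' k (v n) = u n" using e(3) n by (meson inj_onD)
    then have "fricke_rel (u n) (v n)" using rel[of n] fricke_rel_sym uv(6) by metis
    then show ?thesis using uv(4) by blast
  qed
qed

text \<open>
  A value that is large compared with \<open>f\<close> on the compact part of the Siegel set has all its reduced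
  preimages close to the cusp, where \<open>f\<close> separates orbits.
\<close>

lemma double_values_bounded: "\<exists>B. \<forall>c\<in>double_values. cmod c \<le> B"
proof -
  define K where "K = cbox (Complex (- 1/2) (2/5)) (Complex (1/2) Y)"
  have "compact (f ` K)"
    unfolding K_def
    by (intro compact_continuous_image compact_cbox continuous_on_subset[OF continuous]) (auto simp: in_cbox_complex_iff)
  then obtain B where B: "\<And>z. z \<in> K \<Longrightarrow> cmod (f z) \<le> B"
    using compact_imp_bounded[of "f ` K"] unfolding bounded_iff by (metis imageI)
  have "cmod c \<le> B" if "c \<in> double_values" for c
  proof (rule ccontr)
    assume big_c: "\<not> cmod c \<le> B"
    have big: "Im z > Y" if "z \<in> siegel_set" "f z = c" for z
    proof (rule ccontr)
      assume "\<not> Im z > Y"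
      then have "z \<in> K" using that(1) by (auto simp: K_def siegel_set_def in_cbox_complex_iff)
      then show False using B big_c that(2) by blast
    qed
    obtain x y where xy: "Im x > 0" "Im y > 0" "f x = c" "f y = c" "\<not> fricke_rel x y"
      using \<open>c \<in> double_values\<close> by (auto simp: double_values_def)
    obtain x' where x': "x' \<in> siegel_set" "fricke_rel x x'" "f x' = f x"
      using preimage_in_siegel_set[OF xy(1)] by metis
    obtain y' where y': "y' \<in> siegel_set" "fricke_rel y y'" "f y' = f y"
      using preimage_in_siegel_set[OF xy(2)] by metis
    obtain k :: int where "y' = x' + of_int k" using cusp_inj[of x' y'] big x' y' xy by auto
    then have "fricke_rel x' y'" using fricke_rel_add_int siegel_set_Im_pos x' by blast
    then show False using fricke_rel_transport[OF x'(2) y'(2) _ xy(1,2)] xy(5) by blast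
  qed
  then show ?thesis by blast
qed

theorem injective_modulo_fricke_rel:
  assumes "Im z > 0" "Im w > 0"
  shows "f z = f w \<longleftrightarrow> fricke_rel z w"
proof
  assume eq: "f z = f w"
  have conn: "connected (- critical_values)"
    unfolding Compl_eq_Diff_UNIV
    by (rule connected_open_diff_countable[OF _ open_UNIV connected_UNIV countable_critical_values]) simp
  have op: "openin (top_of_set (- critical_values)) (double_values - critical_values)"
    unfolding openin_open using open_double_values by (intro exI[of _ double_values]) auto
  have cl: "closedin (top_of_set (- critical_values)) (double_values - critical_values)"
    unfolding closedin_limpt
  proof safe
    fix l assume "l islimpt double_values - critical_values" and l: "l \<notin> critical_values"
    then obtain c where "\<And>n. c n \<in> double_values" "c \<longlonglongrightarrow> l"
      unfolding islimpt_sequential by blast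
    then show "l \<in> double_values" using double_values_limit l by blast
  qed
  have "double_values - critical_values \<noteq> - critical_values"
  proof
    assume *: "double_values - critical_values = - critical_values"
    obtain B where "\<forall>c\<in>double_values. cmod c \<le> B" using double_values_bounded by blast
    then have "double_values \<subseteq> cball 0 B" by auto
    then have "- cball 0 B \<subseteq> critical_values" using * by blast
    then have "countable (- cball (0::complex) B)" using countable_critical_values countable_subset by blast
    moreover have "open (- cball (0::complex) B)" by auto
    moreover have "of_real (\<bar>B\<bar> + 1) \<in> - cball (0::complex) B" by (simp add: norm_of_real)
    ultimately show False using countable_open_imp_empty by blast
  qed
  then have "double_values - critical_values = {}"
    using conn op cl unfolding connected_clopen by blast
  then have "countable double_values" using countable_critical_values countable_subset by (metis Diff_eq_empty_iff)
  then have "double_values = {}" by (rule countable_open_imp_empty[OF open_double_values])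
  then have "f z \<notin> double_values" by simp
  then show "fricke_rel z w" using eq[symmetric] assms unfolding double_values_def by blast
next
  assume "fricke_rel z w"
  then show "f z = f w" using invariant assms(1) by blast
qed

end

section \<open>Quotients of spaces with functions\<close>

lemma top_of_quotient [simp]: "top_of (fs_quotient X p) = quotient_topology (top_of X) p"
  by (simp add: fs_quotient_def)

lemma top_of_restrict [simp]: "top_of (fs_restrict X A) = subtopology (top_of X) A"
  by (simp add: fs_restrict_def)

lemma topspace_quotient_topology [simp]: "topspace (quotient_topology X p) = p ` topspace X"
  using quotient_map_quotient_topology[of X p] by (simp add: quotient_map_def)

lemma points_quotient: "points (fs_quotient X p) = p ` points X"
  by (simp add: points_def)

lemma regular_quotient:
  "f \<in> regular (fs_quotient X p) U \<longleftrightarrow> f \<circ> p \<in> regular X {x \<in> points X. p x \<in> U}"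
  by (simp add: fs_quotient_def)

text \<open>
  The first of the three sheaf axioms alone. Restrictions and quotients inherit it directly; the other
  two axioms reach the quotients below through their isomorphism with the plane.
\<close>

definition value_determined :: "'a fspace \<Rightarrow> bool" where
  "value_determined X \<longleftrightarrow>
     (\<forall>U f g. openin (top_of X) U \<and> f \<in> regular X U \<and> (\<forall>x\<in>U. g x = f x) \<longrightarrow> g \<in> regular X U)"

lemma value_determinedD:
  assumes "value_determined X" "openin (top_of X) U" "\<And>x. x \<in> U \<Longrightarrow> g x = f x"
  shows "f \<in> regular X U \<longleftrightarrow> g \<in> regular X U"
  using assms unfolding value_determined_def by metis

lemma value_determined_restrict: "value_determined (fs_restrict X A)"
  unfolding value_determined_def fs_restrict_def by fastforce

lemma value_determined_quotient:
  assumes "value_determined X"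
  shows "value_determined (fs_quotient X p)"
  unfolding value_determined_def
proof (intro allI impI)
  fix U f g
  assume "openin (top_of (fs_quotient X p)) U \<and> f \<in> regular (fs_quotient X p) U \<and> (\<forall>x\<in>U. g x = f x)"
  then have "openin (top_of X) {x \<in> points X. p x \<in> U}" "f \<circ> p \<in> regular X {x \<in> points X. p x \<in> U}"
    "\<forall>x\<in>U. g x = f x"
    by (auto simp: openin_quotient_topology regular_quotient points_def)
  then show "g \<in> regular (fs_quotient X p) U"
    using value_determinedD[OF assms, of "{x \<in> points X. p x \<in> U}" "g \<circ> p" "f \<circ> p"]
    by (simp add: regular_quotient)
qed

text \<open>
  Since both \<open>p\<close> and \<open>f\<close> are quotient maps with the same fibres, \<open>f\<close> factors through \<open>p\<close> by a bijection
  which is a quotient map itself, that is, a homeomorphism.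
\<close>

lemma fs_quotient_iso:
  assumes vd: "value_determined X"
    and q: "quotient_map (top_of X) (top_of Y) f"
    and fib: "\<And>x y. x \<in> points X \<Longrightarrow> y \<in> points X \<Longrightarrow> f x = f y \<longleftrightarrow> p x = p y"
    and reg: "\<And>U u. openin (top_of Y) U \<Longrightarrow> u \<in> regular Y U \<longleftrightarrow> u \<circ> f \<in> regular X {x \<in> points X. f x \<in> U}"
  shows "\<exists>h. fspace_iso (fs_quotient X p) Y h"
proof -
  define h where "h y = f (inv_into (points X) p y)" for y
  have hp: "h (p x) = f x" if "x \<in> points X" for x
  proof -
    have "inv_into (points X) p (p x) \<in> points X" "p (inv_into (points X) p (p x)) = p x"
      using that by (auto intro: inv_into_into f_inv_into_f)
    then show ?thesis using fib that unfolding h_def by blast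
  qed
  have qhp: "quotient_map (top_of X) (top_of Y) (h \<circ> p)"
    by (rule quotient_map_eq[OF q]) (simp add: hp points_def)
  have qp: "quotient_map (top_of X) (top_of (fs_quotient X p)) p"
    by (simp add: quotient_map_quotient_topology)
  have qh: "quotient_map (top_of (fs_quotient X p)) (top_of Y) h"
    using quotient_map_compose_eq[OF qp] qhp by blast
  have inj: "inj_on h (topspace (top_of (fs_quotient X p)))"
    using fib by (auto simp: inj_on_def hp points_def[symmetric])
  have "fspace_iso (fs_quotient X p) Y h"
    unfolding fspace_iso_def homeomorphic_map_def
  proof (intro conjI allI impI qh inj)
    fix U u assume U: "openin (top_of Y) U"
    have sets: "{x \<in> points X. p x \<in> {y \<in> points (fs_quotient X p). h y \<in> U}} = {x \<in> points X. f x \<in> U}"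
    proof (intro Collect_cong conj_cong refl)
      fix x assume "x \<in> points X"
      then show "(p x \<in> {y \<in> points (fs_quotient X p). h y \<in> U}) = (f x \<in> U)"
        by (simp add: points_quotient hp)
    qed
    have "openin (top_of X) {x \<in> points X. f x \<in> U}"
      using quotient_imp_continuous_map[OF q] U unfolding continuous_map_def points_def by blast
    then have "u \<circ> f \<in> regular X {x \<in> points X. f x \<in> U} \<longleftrightarrow> (u \<circ> h) \<circ> p \<in> regular X {x \<in> points X. f x \<in> U}"
      by (intro value_determinedD[OF vd]) (auto simp: hp)
    then show "u \<in> regular Y U \<longleftrightarrow> u \<circ> h \<in> regular (fs_quotient X p) {x \<in> points (fs_quotient X p). h x \<in> U}"
      unfolding reg[OF U] regular_quotient sets .
  qed
  then show ?thesis by blast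
qed

lemma regular_restrict_affine_line:
  assumes "open U"
  shows "f \<in> regular (fs_restrict affine_line A) U \<longleftrightarrow> f holomorphic_on U"
proof
  assume "f \<in> regular (fs_restrict affine_line A) U"
  then have loc: "\<exists>V g. open V \<and> x \<in> V \<and> g holomorphic_on V \<and> (\<forall>y\<in>V \<inter> U. f y = g y)" if "x \<in> U" for x
    using that by (auto simp: fs_restrict_def affine_line_def)
  have "f field_differentiable at x" if x: "x \<in> U" for x
  proof -
    obtain V g where V: "open V" "x \<in> V" "g holomorphic_on V" "\<forall>y\<in>V \<inter> U. f y = g y"
      using loc[OF x] by blast
    have "g holomorphic_on V \<inter> U" using V(3) by (rule holomorphic_on_subset) auto
    then have "f holomorphic_on V \<inter> U" using V(4) by (metis holomorphic_transform)
    then show ?thesis using V x assms by (meson IntI holomorphic_on_imp_differentiable_at open_Int)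
  qed
  then show "f holomorphic_on U" by (auto simp: holomorphic_on_def field_differentiable_at_within)
next
  assume "f holomorphic_on U"
  then show "f \<in> regular (fs_restrict affine_line A) U"
    using assms by (auto simp: fs_restrict_def affine_line_def intro!: exI[of _ U])
qed

lemma points_upper_half_plane: "points upper_half_plane = uhp"
  by (simp add: points_def upper_half_plane_def affine_line_def)

lemma top_of_upper_half_plane: "top_of upper_half_plane = top_of_set uhp"
  by (simp add: upper_half_plane_def affine_line_def)

lemma openin_upper_half_plane: "openin (top_of upper_half_plane) U \<longleftrightarrow> open U \<and> U \<subseteq> uhp"
  unfolding top_of_upper_half_plane by (rule openin_open_eq[OF open_halfspace_Im_gt])

lemma regular_upper_half_plane: "open U \<Longrightarrow> f \<in> regular upper_half_plane U \<longleftrightarrow> f holomorphic_on U"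
  unfolding upper_half_plane_def by (rule regular_restrict_affine_line)

lemma value_determined_upper_half_plane: "value_determined upper_half_plane"
  unfolding upper_half_plane_def by (rule value_determined_restrict)

lemma fspace_iso_compose:
  assumes f: "fspace_iso X Y f" and g: "fspace_iso Y Z g"
  shows "fspace_iso X Z (g \<circ> f)"
proof -
  have hf: "homeomorphic_map (top_of X) (top_of Y) f" and hg: "homeomorphic_map (top_of Y) (top_of Z) g"
    using f g by (simp_all add: fspace_iso_def)
  have rf: "u \<in> regular Y U \<longleftrightarrow> u \<circ> f \<in> regular X {x \<in> points X. f x \<in> U}" if "openin (top_of Y) U" for U u
    using f that by (simp add: fspace_iso_def)
  have rg: "u \<in> regular Z U \<longleftrightarrow> u \<circ> g \<in> regular Y {x \<in> points Y. g x \<in> U}" if "openin (top_of Z) U" for U u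
    using g that by (simp add: fspace_iso_def)
  have img: "f x \<in> points Y" if "x \<in> points X" for x
    using homeomorphic_imp_surjective_map[OF hf] that by (auto simp: points_def)
  show ?thesis
    unfolding fspace_iso_def
  proof (intro conjI allI impI)
    show "homeomorphic_map (top_of X) (top_of Z) (g \<circ> f)"
      by (rule homeomorphic_map_compose[OF hf hg])
    fix U u assume U: "openin (top_of Z) U"
    have oU: "openin (top_of Y) {y \<in> points Y. g y \<in> U}"
      using homeomorphic_imp_continuous_map[OF hg] U by (simp add: points_def continuous_map_def)
    have "u \<in> regular Z U \<longleftrightarrow> u \<circ> g \<in> regular Y {y \<in> points Y. g y \<in> U}"
      by (rule rg[OF U])
    also have "\<dots> \<longleftrightarrow> u \<circ> g \<circ> f \<in> regular X {x \<in> points X. f x \<in> {y \<in> points Y. g y \<in> U}}"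
      by (rule rf[OF oU])
    also have "{x \<in> points X. f x \<in> {y \<in> points Y. g y \<in> U}} = {x \<in> points X. (g \<circ> f) x \<in> U}"
      using img by auto
    finally show "u \<in> regular Z U \<longleftrightarrow> u \<circ> (g \<circ> f) \<in> regular X {x \<in> points X. (g \<circ> f) x \<in> U}"
      unfolding o_assoc .
  qed
qed

lemma second_countable_euclidean: "second_countable (euclidean :: complex topology)"
proof -
  obtain B :: "complex set set" where "countable B" "topological_basis B"
    using ex_countable_basis by blast
  then have "countable B \<and> (\<forall>V\<in>B. open V) \<and> (\<forall>U x. open U \<and> x \<in> U \<longrightarrow> (\<exists>V\<in>B. x \<in> V \<and> V \<subseteq> U))"
    using topological_basis_open topological_basisE by metis
  then have "\<exists>B. countable B \<and> (\<forall>V\<in>B. open V) \<and> (\<forall>(U :: complex set) x. open U \<and> x \<in> U \<longrightarrow> (\<exists>V\<in>B. x \<in> V \<and> V \<subseteq> U))"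
    by (rule exI)
  then show ?thesis by (simp only: second_countable_def open_openin[symmetric])
qed

text \<open>
  One global chart suffices, and the remaining sheaf axioms are transported from the plane by the
  isomorphism.
\<close>

lemma riemann_surface_if_iso_affine_line:
  assumes vd: "value_determined X" and h: "fspace_iso X affine_line h"
  shows "riemann_surface X"
proof -
  have hom: "homeomorphic_map (top_of X) euclidean h"
    and reg: "\<And>U f. open U \<Longrightarrow> f holomorphic_on U \<longleftrightarrow> f \<circ> h \<in> regular X {x \<in> points X. h x \<in> U}"
    using h by (auto simp: fspace_iso_def affine_line_def)
  define k where "k = inv_into (points X) h"
  have inj: "inj_on h (points X)" and surj: "h ` points X = UNIV"
    using hom homeomorphic_imp_injective_map homeomorphic_imp_surjective_map by (fastforce simp: points_def)+
  have kh: "k (h x) = x" if "x \<in> points X" for x using that inj by (simp add: k_def)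
  have sub: "U \<subseteq> points X" if "openin (top_of X) U" for U
    using that openin_subset by (auto simp: points_def)
  have open_h: "open (h ` U)" if "openin (top_of X) U" for U
    using homeomorphic_imp_open_map[OF hom] that by (simp add: open_map_def)
  have pre: "{x \<in> points X. h x \<in> h ` U} = U" if "openin (top_of X) U" for U
    using sub[OF that] inj by (auto simp: inj_on_def)
  have cont: "openin (top_of X) {x \<in> points X. h x \<in> W}" if "open W" for W
    using homeomorphic_imp_continuous_map[OF hom] that by (simp add: continuous_map_def points_def)
  have char: "f \<in> regular X U \<longleftrightarrow> (f \<circ> k) holomorphic_on (h ` U)" if U: "openin (top_of X) U" for f U
  proof -
    have "f \<in> regular X U \<longleftrightarrow> (f \<circ> k) \<circ> h \<in> regular X U"
      by (rule value_determinedD[OF vd U]) (use sub[OF U] kh in auto)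
    then show ?thesis using reg[OF open_h[OF U], of "f \<circ> k"] by (simp add: pre[OF U])
  qed
  have sheaf: "function_sheaf X"
    unfolding function_sheaf_def
  proof (intro conjI allI impI)
    show "g \<in> regular X U" if "openin (top_of X) U \<and> f \<in> regular X U \<and> (\<forall>x\<in>U. g x = f x)" for U f g
      using vd that unfolding value_determined_def by blast
    show "f \<in> regular X V" if "openin (top_of X) U \<and> openin (top_of X) V \<and> V \<subseteq> U \<and> f \<in> regular X U" for U V f
      using that char holomorphic_on_subset by (meson image_mono)
    show "f \<in> regular X U"
      if *: "openin (top_of X) U \<and> (\<forall>x\<in>U. \<exists>V. openin (top_of X) V \<and> x \<in> V \<and> V \<subseteq> U \<and> f \<in> regular X V)" for U f
    proof -
      have "(f \<circ> k) field_differentiable at w" if w: "w \<in> h ` U" for w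
      proof -
        obtain x where x: "x \<in> U" "w = h x" using w by blast
        then obtain V where V: "openin (top_of X) V" "x \<in> V" "f \<in> regular X V" using * by blast
        then have "(f \<circ> k) holomorphic_on (h ` V)" using char by blast
        then show ?thesis using open_h[OF V(1)] V(2) x(2) by (meson holomorphic_on_imp_differentiable_at imageI)
      qed
      then show ?thesis using char * by (simp add: holomorphic_on_def field_differentiable_at_within)
    qed
  qed
  have hs: "top_of X homeomorphic_space (euclidean :: complex topology)"
    using hom homeomorphic_map_imp_homeomorphic_space by blast
  have haus: "Hausdorff_space (top_of X)" using homeomorphic_Hausdorff_space[OF hs] by simp
  have sc: "second_countable (top_of X)"
    using homeomorphic_space_second_countability[OF hs] second_countable_euclidean by simp
  have conn: "connected_space (top_of X)"
    using homeomorphic_connected_space[OF hs] connected_UNIV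
    by (simp flip: connectedin_topspace add: connectedin_iff_connected)
  have iso: "fspace_iso (fs_restrict X (points X)) (fs_restrict affine_line UNIV) h"
    unfolding fspace_iso_def
  proof (intro conjI allI impI)
    show "homeomorphic_map (top_of (fs_restrict X (points X))) (top_of (fs_restrict affine_line UNIV)) h"
      using hom by (simp add: points_def affine_line_def)
    fix W f assume "openin (top_of (fs_restrict affine_line UNIV)) W"
    then have W: "open W" by (simp add: affine_line_def)
    let ?U = "{x \<in> points X. h x \<in> W}"
    have loc: "u \<in> regular (fs_restrict X (points X)) ?U \<longleftrightarrow> u \<in> regular X ?U" for u
    proof
      assume "u \<in> regular X ?U"
      then show "u \<in> regular (fs_restrict X (points X)) ?U"
        using cont[OF W] by (auto simp: fs_restrict_def intro!: exI[of _ ?U])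
    next
      assume u: "u \<in> regular (fs_restrict X (points X)) ?U"
      have "\<exists>V. openin (top_of X) V \<and> x \<in> V \<and> V \<subseteq> ?U \<and> u \<in> regular X V" if "x \<in> ?U" for x
      proof -
        obtain V g where V: "openin (top_of X) V" "x \<in> V" "g \<in> regular X V" "\<forall>y\<in>V \<inter> ?U. u y = g y"
          using u \<open>x \<in> ?U\<close> unfolding fs_restrict_def by auto
        have o: "openin (top_of X) (V \<inter> ?U)" using V(1) cont[OF W] by blast
        then have "g \<in> regular X (V \<inter> ?U)"
          using sheaf V unfolding function_sheaf_def by (metis (no_types, lifting) Int_lower1)
        then have "u \<in> regular X (V \<inter> ?U)" using value_determinedD[OF vd o, of u g] V(4) by blast
        then show ?thesis using o V(2) that by blast
      qed
      with cont[OF W] show "u \<in> regular X ?U"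
        by (intro sheaf[unfolded function_sheaf_def, THEN conjunct2, THEN conjunct2, rule_format] conjI ballI)
    qed
    have "{x \<in> points (fs_restrict X (points X)). h x \<in> W} = ?U" by (auto simp: points_def)
    then show "f \<in> regular (fs_restrict affine_line UNIV) W \<longleftrightarrow>
        f \<circ> h \<in> regular (fs_restrict X (points X)) {x \<in> points (fs_restrict X (points X)). h x \<in> W}"
      using loc regular_restrict_affine_line[OF W] reg[OF W] by simp
  qed
  have ne: "points X \<noteq> {}" using surj by auto
  have chart: "\<exists>V W h. openin (top_of X) V \<and> x \<in> V \<and> open W \<and>
      fspace_iso (fs_restrict X V) (fs_restrict affine_line W) h" if "x \<in> points X" for x
    using that iso by (intro exI[of _ "points X"] exI[of _ UNIV]) (auto simp: points_def)
  show ?thesis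
    unfolding riemann_surface_def using sheaf haus sc conn ne chart by blast
qed

lemma fspace_iso_affine_line_id: "fspace_iso affine_line affine_line id"
  by (simp add: fspace_iso_def points_def affine_line_def)

lemma value_determined_affine_line: "value_determined affine_line"
  unfolding value_determined_def affine_line_def by simp (metis holomorphic_transform)

section \<open>Orbits of the Fricke modular group\<close>

lemma moebius_int_matrix:
  "mat_moebius (map_matrix of_int A) z = int_moebius (A $ 1 $ 1) (A $ 1 $ 2) (A $ 2 $ 1) (A $ 2 $ 2) z"
  by (simp add: mat_moebius_def moebius_def int_moebius_def map_matrix_def)

abbreviation fricke_matrix :: "real ^ 2 ^ 2" where
  "fricke_matrix \<equiv> vector [vector [0, - 1 / sqrt 2], vector [sqrt 2, 0]]"

lemma moebius_Fricke_mult: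
  fixes A :: "real ^ 2 ^ 2"
  assumes "of_real (A $ 2 $ 1) * z + of_real (A $ 2 $ 2) \<noteq> 0"
  shows "mat_moebius (fricke_matrix ** A) z = - 1 / (2 * mat_moebius A z)"
proof -
  define a b c d where "a = A $ 1 $ 1" and "b = A $ 1 $ 2" and "c = A $ 2 $ 1" and "d = A $ 2 $ 2"
  define s :: complex where "s = of_real (sqrt 2)"
  have s: "s \<noteq> 0" "s * s = 2" by (simp_all add: s_def flip: of_real_mult)
  have "mat_moebius (fricke_matrix ** A) z =
      (- of_real c / s * z - of_real d / s) / (s * of_real a * z + s * of_real b)"
    by (simp add: mat_moebius_def moebius_def matrix_matrix_mult_def sum_2 vector_2 a_def b_def c_def d_def s_def)
  also have "\<dots> = (s * (- of_real c / s * z - of_real d / s)) / (s * (s * of_real a * z + s * of_real b))"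
    using s by simp
  also have "s * (- of_real c / s * z - of_real d / s) = - (of_real c * z + of_real d)"
    using s by (simp add: field_simps)
  also have "s * (s * of_real a * z + s * of_real b) = (s * s) * (of_real a * z + of_real b)"
    by (simp add: algebra_simps)
  finally have "mat_moebius (fricke_matrix ** A) z =
      - (of_real c * z + of_real d) / (2 * (of_real a * z + of_real b))"
    by (simp only: s)
  moreover have "mat_moebius A z = (of_real a * z + of_real b) / (of_real c * z + of_real d)"
    by (simp add: mat_moebius_def moebius_def a_def b_def c_def d_def)
  ultimately show ?thesis using assms by (simp add: c_def d_def)
qed

lemma Fricke_mult_psl:
  "Fricke \<otimes>\<^bsub>PSL2R\<^esub> psl A = psl (fricke_matrix ** A)"
proof -
  have neg: "(- X) ** Y = - (X ** Y)" "X ** (- Y) = - (X ** Y)" for X Y :: "real ^ 2 ^ 2"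
    by (simp_all add: vec_eq_iff matrix_matrix_mult_def sum_negf)
  show ?thesis
    by (auto simp: Fricke_def psl_eq PSL2R_def FactGroup_def SL2R_def set_mult_def neg)
qed

text \<open>
  A matrix of determinant \<open>2\<close> is the integral form of the product of the Fricke matrix with the
  element of \<open>H2\<close> whose rows are \<open>(c / 2, d / 2)\<close> and \<open>(- a, - b)\<close>.
\<close>

lemma H2_plus_orbit:
  assumes z: "Im z > 0"
  shows "(\<lambda>g. psl_act g z) ` H2_plus = {w. fricke_rel z w}"
proof (intro equalityI subsetI)
  fix w assume "w \<in> (\<lambda>g. psl_act g z) ` H2_plus"
  then obtain g where g: "g \<in> H2_plus" "w = psl_act g z" by blast
  from g(1) obtain A :: "int ^ 2 ^ 2" where A: "det A = 1" "[A $ 2 $ 1 = 0] (mod 2)"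
    and gA: "g = psl (map_matrix of_int A) \<or> g = Fricke \<otimes>\<^bsub>PSL2R\<^esub> psl (map_matrix of_int A)"
    by (auto simp: H2_plus_def H2_def l_coset_def)
  let ?w = "int_moebius (A $ 1 $ 1) (A $ 1 $ 2) (A $ 2 $ 1) (A $ 2 $ 2) z"
  have M: "fricke_mat (A $ 1 $ 1) (A $ 1 $ 2) (A $ 2 $ 1) (A $ 2 $ 2)"
    using A by (simp add: fricke_mat_def det_2 cong_0_iff)
  then have rel: "fricke_rel z ?w" unfolding fricke_rel_def by blast
  have "mat_moebius (fricke_matrix ** map_matrix of_int A) z = - 1 / (2 * ?w)"
    unfolding moebius_int_matrix[symmetric]
    by (rule moebius_Fricke_mult) (use fricke_mat_denom_nonzero[OF M z] in \<open>simp add: map_matrix_def\<close>)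
  then have "w = ?w \<or> w = - 1 / (2 * ?w)"
    using g(2) gA by (auto simp: Fricke_mult_psl psl_act_psl moebius_int_matrix)
  then show "w \<in> {w. fricke_rel z w}" using rel fricke_rel_Fricke[OF rel z] by auto
next
  have in_H2: "psl (map_matrix of_int (vector [vector [a, b], vector [c, d]] :: int ^ 2 ^ 2)) \<in> H2"
    and act_H2: "mat_moebius (map_matrix of_int (vector [vector [a, b], vector [c, d]] :: int ^ 2 ^ 2)) z = int_moebius a b c d z"
    if "a * d - b * c = 1" "even c" for a b c d
    using that unfolding H2_def
    by (auto simp: det_2 cong_0_iff moebius_int_matrix intro!: exI[of _ "vector [vector [a, b], vector [c, d]]"])
  fix w assume "w \<in> {w. fricke_rel z w}"
  then obtain a b c d where M: "fricke_mat a b c d" and w: "w = int_moebius a b c d z"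
    by (auto simp: fricke_rel_def)
  obtain c' where c': "c = 2 * c'" using M by (auto simp: fricke_mat_def elim: evenE)
  consider (I) "a * d - b * c = 1" | (F) a' d' where "a = 2 * a'" "d = 2 * d'" "a * d - b * c = 2"
    using M by (auto simp: fricke_mat_def elim!: evenE)
  then show "w \<in> (\<lambda>g. psl_act g z) ` H2_plus"
  proof cases
    case I
    then show ?thesis
      using in_H2[of a d b c] act_H2[of a d b c] c' w
      by (auto simp: H2_plus_def psl_act_psl intro!: image_eqI[where x = "psl (map_matrix of_int (vector [vector [a, b], vector [c, d]]))"])
  next
    case F
    let ?A = "vector [vector [c', d'], vector [- a, - b]] :: int ^ 2 ^ 2"
    have det: "c' * (- b) - d' * (- a) = 1" using F c' by (simp add: algebra_simps)
    have ev: "even (- a)" using F by simp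
    have M': "fricke_mat c' d' (- a) (- b)" using det ev by (simp add: fricke_mat_def)
    have nz: "of_int (- a) * z + of_int (- b) \<noteq> 0" using fricke_mat_denom_nonzero[OF M' z] .
    have nz2: "of_int c' * z + of_int d' \<noteq> 0"
    proof -
      have "of_int c * z + of_int d = 2 * (of_int c' * z + of_int d')"
        by (simp add: F c' algebra_simps)
      then show ?thesis using fricke_mat_denom_nonzero[OF M z] by (metis mult_zero_right)
    qed
    have "psl_act (Fricke \<otimes>\<^bsub>PSL2R\<^esub> psl (map_matrix of_int ?A)) z = - 1 / (2 * int_moebius c' d' (- a) (- b) z)"
      unfolding Fricke_mult_psl psl_act_psl act_H2[OF det ev, symmetric]
      by (rule moebius_Fricke_mult) (use nz in \<open>simp add: map_matrix_def vector_2\<close>)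
    also have "\<dots> = w"
      using nz nz2 by (simp add: w int_moebius_def F c' field_simps)
    finally show ?thesis using in_H2[OF det ev]
      by (intro image_eqI[where x = "Fricke \<otimes>\<^bsub>PSL2R\<^esub> psl (map_matrix of_int ?A)"])
         (auto simp: H2_plus_def l_coset_def)
  qed
qed

lemma fricke_orbit_eq_iff:
  assumes "Im z > 0" "Im w > 0"
  shows "(\<lambda>g. psl_act g z) ` H2_plus = (\<lambda>g. psl_act g w) ` H2_plus \<longleftrightarrow> fricke_rel z w"
  unfolding H2_plus_orbit[OF assms(1)] H2_plus_orbit[OF assms(2)]
  using fricke_rel_trans[OF _ _ assms(1)] fricke_rel_trans[OF _ _ assms(2)]
    fricke_rel_sym[OF _ assms(1)] fricke_rel_refl by blast

section \<open>The Fricke curve is the affine line\<close>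

context fricke_hauptmodul
begin

text \<open>
  Away from critical points \<open>u\<close> is \<open>u \<circ> f\<close> composed with a local inverse of \<open>f\<close>. A punctured neighbourhood of a
  point of the upper half plane contains no critical points, so its image shows \<open>u\<close> to be holomorphic
  near the image point except possibly at it; there \<open>u\<close> is continuous because \<open>f\<close> is open.
\<close>

lemma descends_to_holomorphic:
  assumes U: "open U" and uf: "(u \<circ> f) holomorphic_on {z. Im z > 0 \<and> f z \<in> U}"
  shows "u holomorphic_on U"
proof -
  define A where "A = {z. Im z > 0 \<and> f z \<in> U}"
  have A: "open A" "A \<subseteq> uhp"
    using continuous_open_preimage[OF continuous open_uhp U] by (auto simp: A_def vimage_def Int_def)
  have fA: "f ` A = U" using surjective by (fastforce simp: A_def)
  have ufA: "(u \<circ> f) holomorphic_on A" using uf by (simp add: A_def)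
  have cont: "continuous_on U u"
    unfolding continuous_on_open_vimage[OF U]
  proof (intro allI impI)
    fix B :: "complex set" assume "open B"
    have "u -` B \<inter> U = f ` ((u \<circ> f) -` B \<inter> A)" using fA by auto
    moreover have "open ((u \<circ> f) -` B \<inter> A)"
      using holomorphic_on_imp_continuous_on[OF ufA] \<open>open B\<close> continuous_on_open_vimage[OF A(1)] by blast
    ultimately show "open (u -` B \<inter> U)" using open_map A(2) by (metis inf.coboundedI2)
  qed
  have noncritical: "u field_differentiable at (f z)" if z: "z \<in> A" "deriv f z \<noteq> 0" for z
  proof -
    have holA: "f holomorphic_on A" using hol A(2) by (rule holomorphic_on_subset)
    obtain r where r: "r > 0" "ball z r \<subseteq> A" "open (f ` ball z r)" "inj_on f (ball z r)"
      using has_complex_derivative_locally_invertible[OF holA z(1) A(1) z(2)] by metis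
    obtain g where g: "g holomorphic_on f ` ball z r" "\<And>w. w \<in> ball z r \<Longrightarrow> g (f w) = w"
      using holomorphic_has_inverse[OF holomorphic_on_subset[OF holA r(2)] open_ball r(4)] by metis
    have "(u \<circ> f) \<circ> g holomorphic_on f ` ball z r"
      by (rule holomorphic_on_compose_gen[OF g(1) ufA]) (use g(2) r(2) in auto)
    then have "u holomorphic_on f ` ball z r"
      by (rule holomorphic_transform) (use g(2) in auto)
    then show ?thesis using r(1,3) by (intro holomorphic_on_imp_differentiable_at[of u "f ` ball z r"]) auto
  qed
  have "u field_differentiable at w" if w: "w \<in> U" for w
  proof -
    obtain z where z: "z \<in> A" "w = f z" using fA w by blast
    obtain r where r: "r > 0" "ball z r \<subseteq> A" "\<And>x. x \<in> ball z r - {z} \<Longrightarrow> deriv f x \<noteq> 0"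
    proof -
      obtain r1 where r1: "r1 > 0" "\<And>x. x \<in> ball z r1 - {z} \<Longrightarrow> deriv f x \<noteq> 0"
      proof (cases "deriv f z = 0")
        case True
        obtain b where b: "Im b > 0" "deriv f b \<noteq> 0" by (rule deriv_nonzero_somewhere)
        have zi: "z \<in> uhp" using z A by blast
        have bi: "b \<in> uhp" using b(1) by simp
        show ?thesis
          by (rule isolated_zeros[OF deriv_holomorphic open_uhp connected_uhp zi True bi b(2)]) (rule that)
      next
        case False
        have zi: "z \<in> uhp" using z A by blast
        have "continuous_on uhp (deriv f)"
          by (rule holomorphic_on_imp_continuous_on[OF deriv_holomorphic])
        then have "isCont (deriv f) z" using continuous_on_eq_continuous_at[OF open_uhp] zi by blast
        then obtain e where "e > 0" "\<And>y. dist z y < e \<Longrightarrow> deriv f y \<noteq> 0"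
          using continuous_at_avoid[of z "deriv f" 0] False by blast
        then show ?thesis using that by auto
      qed
      obtain r2 where "r2 > 0" "ball z r2 \<subseteq> A" using A(1) z(1) openE by blast
      then show ?thesis using r1 by (intro that[of "min r1 r2"]) auto
    qed
    have N: "open (f ` ball z r)" using open_map r(2) A(2) by (metis dual_order.trans open_ball)
    have NU: "f ` ball z r \<subseteq> U" using r(2) fA by blast
    have "u holomorphic_on f ` ball z r"
    proof (rule no_isolated_singularity[where K = "{w}"])
      show "continuous_on (f ` ball z r) u" using cont NU by (rule continuous_on_subset)
      show "u holomorphic_on f ` ball z r - {w}"
      proof -
        have "u field_differentiable at y" if "y \<in> f ` ball z r - {w}" for y
          using that noncritical r(2,3) z(2) by blast
        then show ?thesis by (simp add: holomorphic_on_def field_differentiable_at_within)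
      qed
    qed (use N in auto)
    then show ?thesis using N r(1) z(2) by (intro holomorphic_on_imp_differentiable_at[of u "f ` ball z r"]) auto
  qed
  then show ?thesis by (simp add: holomorphic_on_def field_differentiable_at_within)
qed

lemma fricke_curve_iso_affine_line: "\<exists>h. fspace_iso fricke_curve_2 affine_line h"
  unfolding fricke_curve_2_def orbit_space_def
proof (rule fs_quotient_iso[OF value_determined_upper_half_plane])
  show "quotient_map (top_of upper_half_plane) (top_of affine_line) f"
  proof (rule continuous_open_imp_quotient_map)
    show "continuous_map (top_of upper_half_plane) (top_of affine_line) f"
      using continuous by (simp add: top_of_upper_half_plane affine_line_def)
    show "open_map (top_of upper_half_plane) (top_of affine_line) f"
      using open_map by (simp add: open_map_def openin_upper_half_plane affine_line_def)
    show "f ` topspace (top_of upper_half_plane) = topspace (top_of affine_line)"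
      using surjective by (simp add: top_of_upper_half_plane affine_line_def)
  qed
  show "f x = f y \<longleftrightarrow> (\<lambda>g. psl_act g x) ` H2_plus = (\<lambda>g. psl_act g y) ` H2_plus"
    if "x \<in> points upper_half_plane" "y \<in> points upper_half_plane" for x y
    using that injective_modulo_fricke_rel fricke_orbit_eq_iff by (simp add: points_upper_half_plane)
  fix U u assume "openin (top_of affine_line) U"
  then have U: "open U" by (simp add: affine_line_def)
  let ?A = "{z. Im z > 0 \<and> f z \<in> U}"
  have A: "open ?A"
    using continuous_open_preimage[OF continuous open_uhp U] by (simp add: vimage_def Int_def)
  have "u holomorphic_on U \<longleftrightarrow> (u \<circ> f) holomorphic_on ?A"
    using descends_to_holomorphic[OF U] holomorphic_on_compose_gen[OF holomorphic_on_subset[OF hol], of ?A u U]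
    by auto
  then show "u \<in> regular affine_line U \<longleftrightarrow> u \<circ> f \<in> regular upper_half_plane {x \<in> points upper_half_plane. f x \<in> U}"
    using regular_upper_half_plane[OF A] by (simp add: points_upper_half_plane affine_line_def)
qed

end

lemma fricke_curve_affine_line:
  obtains h where "fspace_iso fricke_curve_2 affine_line h"
  using hauptmodul_exists fricke_hauptmodul.fricke_curve_iso_affine_line by blast

section \<open>Lines in the eigenspace of the isometry\<close>

lemma vector4 [simp]:
  "(vector [a, b, c, d] :: 'a::zero ^ 4) $ 1 = a"
  "(vector [a, b, c, d] :: 'a::zero ^ 4) $ 2 = b"
  "(vector [a, b, c, d] :: 'a::zero ^ 4) $ 3 = c"
  "(vector [a, b, c, d] :: 'a::zero ^ 4) $ 4 = d"
  by (simp_all add: vector_def)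

definition eigvec :: "complex \<Rightarrow> complex \<Rightarrow> complex ^ 4" where
  "eigvec a b = vector [a, - \<i> * a, b, - \<i> * b]"

text \<open>
  The eigenvector with coordinate \<open>t\<close>, scaled so that \<open>b - a = 1 + \<i>\<close>.
\<close>

definition period_vec :: "complex \<Rightarrow> complex ^ 4" where
  "period_vec t = eigvec ((1 - \<i>) * t - \<i>) ((1 - \<i>) * t + 1)"

text \<open>
  A Cayley transform \<open>(a + \<i> b) / ((1 - \<i>) (b - a))\<close> of the disc coordinate \<open>a / b\<close>, chosen so that the isometries
  act by \<open>fricke_rel\<close>. The formula makes sense on an open part of the whole projective
  space.
\<close>

definition period_coord :: "complex ^ 4 \<Rightarrow> complex" where
  "period_coord z = (z $ 1 + \<i> * z $ 3) / ((1 - \<i>) * (z $ 3 - z $ 1))"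

lemma one_minus_i_mult: "(1 - \<i>) * (1 + \<i>) = 2" "(1 + \<i>) * (1 - \<i>) = 2"
  by (simp_all add: complex_eq_iff)

lemma one_i_nonzero [simp]: "1 - \<i> \<noteq> 0" "1 + \<i> \<noteq> 0"
  by (simp_all add: complex_eq_iff)

lemma eigvec_scale: "c *s eigvec a b = eigvec (c * a) (c * b)"
  by (simp add: eigvec_def vec_eq_iff forall_4)

lemma eigvec_nth [simp]: "eigvec a b $ 1 = a" "eigvec a b $ 3 = b" "eigvec a b $ 2 = - \<i> * a" "eigvec a b $ 4 = - \<i> * b"
  by (simp_all add: eigvec_def)

lemma period_vec_diff: "period_vec t $ 3 - period_vec t $ 1 = 1 + \<i>"
  by (simp add: period_vec_def)

lemma period_vec_nonzero: "period_vec t \<noteq> 0" "period_vec t $ 3 \<noteq> period_vec t $ 1"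
  using period_vec_diff[of t] one_i_nonzero(2) by (metis eq_iff_diff_eq_0 zero_index)+

lemma period_coord_period_vec [simp]: "period_coord (period_vec t) = t"
proof -
  have "period_vec t $ 1 + \<i> * period_vec t $ 3 = 2 * t"
    by (simp add: period_vec_def complex_eq_iff algebra_simps)
  then show ?thesis
    unfolding period_coord_def period_vec_diff one_minus_i_mult by simp
qed

lemma eigvec_eq_period_vec:
  assumes "b \<noteq> a"
  shows "eigvec a b = ((b - a) / (1 + \<i>)) *s period_vec ((a + \<i> * b) / ((1 - \<i>) * (b - a)))"
proof -
  define c where "c = (b - a) / (1 + \<i>)"
  have "(1 - \<i>) * ((a + \<i> * b) / ((1 - \<i>) * (b - a))) = (a + \<i> * b) / (b - a)" by simp
  then have P: "period_vec ((a + \<i> * b) / ((1 - \<i>) * (b - a))) =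
      eigvec ((a + \<i> * b) / (b - a) - \<i>) ((a + \<i> * b) / (b - a) + 1)"
    by (simp only: period_vec_def)
  have "(a + \<i> * b) / (b - a) - \<i> = (1 + \<i>) * a / (b - a)"
    and "(a + \<i> * b) / (b - a) + 1 = (1 + \<i>) * b / (b - a)"
    using assms by (simp_all add: field_simps)
  then show ?thesis unfolding P eigvec_scale using assms by simp
qed

lemma Re_T_form_eigvec: "Re (T_form (eigvec a b) (cnj_vec (eigvec a b))) = 4 * ((cmod b)\<^sup>2 - (cmod a)\<^sup>2)"
  unfolding cmod_power2 by (simp add: T_form_def cnj_vec_def power2_eq_square algebra_simps)

lemma Re_T_form_period_vec: "Re (T_form (period_vec t) (cnj_vec (period_vec t))) = 16 * Im t"
  unfolding period_vec_def Re_T_form_eigvec cmod_power2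
  by (simp add: power2_eq_square algebra_simps)

lemma complexify_mult_vec: "(complexify A *v z) $ i = (\<Sum>j\<in>UNIV. of_int (A $ i $ j) * z $ j)"
  by (simp add: complexify_def matrix_vector_mult_def map_matrix_def)

lemma rho_nth:
  "rho $ 1 $ 1 = 0" "rho $ 1 $ 2 = -1" "rho $ 1 $ 3 = 0" "rho $ 1 $ 4 = 0"
  "rho $ 2 $ 1 = 1" "rho $ 2 $ 2 = 0" "rho $ 2 $ 3 = 0" "rho $ 2 $ 4 = 0"
  "rho $ 3 $ 1 = 0" "rho $ 3 $ 2 = 0" "rho $ 3 $ 3 = 0" "rho $ 3 $ 4 = -1"
  "rho $ 4 $ 1 = 0" "rho $ 4 $ 2 = 0" "rho $ 4 $ 3 = 1" "rho $ 4 $ 4 = 0"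
  by (simp_all add: rho_def)

lemma rho_eigenspace: "complexify rho *v z = \<i> *s z \<longleftrightarrow> z = eigvec (z $ 1) (z $ 3)"
proof -
  have "complexify rho *v z = \<i> *s z \<longleftrightarrow> - z $ 2 = \<i> * z $ 1 \<and> z $ 1 = \<i> * z $ 2 \<and> - z $ 4 = \<i> * z $ 3 \<and> z $ 3 = \<i> * z $ 4"
    by (simp add: vec_eq_iff forall_4 complexify_mult_vec sum_4 rho_nth)
  also have "\<dots> \<longleftrightarrow> z $ 2 = - \<i> * z $ 1 \<and> z $ 4 = - \<i> * z $ 3"
    by (auto simp: algebra_simps complex_eq_iff)
  also have "\<dots> \<longleftrightarrow> z = eigvec (z $ 1) (z $ 3)"
    by (simp add: vec_eq_iff[of z] forall_4)
  finally show ?thesis .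
qed

lemma proj_point_eq: "proj_point z = range (\<lambda>c. c *s z)"
  by (simp add: proj_point_def vec.span_singleton)

lemma proj_point_scale: "c \<noteq> 0 \<Longrightarrow> proj_point (c *s z) = proj_point z"
proof -
  assume c: "c \<noteq> 0"
  have "k *s (c *s z) = (k * c) *s z" "k *s z = (k / c) *s (c *s z)" for k
    using c by (simp_all add: vector_smult_assoc)
  then show ?thesis unfolding proj_point_eq by (metis (mono_tags, lifting) image_cong rangeI subsetI subset_antisym image_iff)
qed

lemma mem_proj_point_self: "z \<in> proj_point z"
  unfolding proj_point_eq by (rule image_eqI[of _ _ 1]) auto

lemma mem_proj_point: "w \<in> proj_point z \<Longrightarrow> w \<noteq> 0 \<Longrightarrow> \<exists>c. c \<noteq> 0 \<and> w = c *s z"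
  unfolding proj_point_eq by auto

lemma period_coord_scale: "c \<noteq> 0 \<Longrightarrow> period_coord (c *s z) = period_coord z"
proof -
  assume c: "c \<noteq> 0"
  have 1: "(c *s z) $ 1 + \<i> * (c *s z) $ 3 = c * (z $ 1 + \<i> * z $ 3)"
    and 2: "(1 - \<i>) * ((c *s z) $ 3 - (c *s z) $ 1) = c * ((1 - \<i>) * (z $ 3 - z $ 1))"
    by (simp_all add: algebra_simps)
  show ?thesis unfolding period_coord_def 1 2 by (rule mult_divide_mult_cancel_left[OF c])
qed

definition period_map :: "complex \<Rightarrow> (complex ^ 4) set" where
  "period_map t = proj_point (period_vec t)"

definition line_coord :: "(complex ^ 4) set \<Rightarrow> complex" where
  "line_coord L = period_coord (SOME z. z \<in> L \<and> z \<noteq> 0)"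

lemma line_coord_proj_point:
  assumes "z \<noteq> 0" shows "line_coord (proj_point z) = period_coord z"
proof -
  have "(SOME w. w \<in> proj_point z \<and> w \<noteq> 0) \<in> proj_point z \<and> (SOME w. w \<in> proj_point z \<and> w \<noteq> 0) \<noteq> 0"
    using someI[of "\<lambda>w. w \<in> proj_point z \<and> w \<noteq> 0" z] mem_proj_point_self assms by blast
  then obtain c where "c \<noteq> 0" "(SOME w. w \<in> proj_point z \<and> w \<noteq> 0) = c *s z"
    using mem_proj_point by blast
  then show ?thesis unfolding line_coord_def by (simp add: period_coord_scale)
qed

lemma line_coord_period_map [simp]: "line_coord (period_map t) = t"
  unfolding period_map_def by (simp add: line_coord_proj_point period_vec_nonzero)

lemma proj_point_eigvec:
  assumes "b \<noteq> a"
  shows "proj_point (eigvec a b) = period_map ((a + \<i> * b) / ((1 - \<i>) * (b - a)))"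
  unfolding eigvec_eq_period_vec[OF assms] period_map_def
  by (rule proj_point_scale) (use assms in simp)

lemma T_form_scale: "Re (T_form (c *s z) (cnj_vec (c *s z))) = (cmod c)\<^sup>2 * Re (T_form z (cnj_vec z))"
proof -
  have "T_form (c *s z) (cnj_vec (c *s z)) = (c * cnj c) * T_form z (cnj_vec z)"
    by (simp add: T_form_def cnj_vec_def algebra_simps)
  then show ?thesis by (simp add: complex_norm_square[symmetric] del: of_real_power)
qed

text \<open>
  For the eigenvector with coordinate \<open>t\<close> the hermitian norm is \<open>16 Im t\<close>, and every other
  eigenvector with \<open>a \<noteq> b\<close> is a multiple of such a vector.
\<close>

lemma period_domain_points_eq: "period_domain_points = period_map ` uhp"
proof (intro equalityI subsetI)
  fix L assume "L \<in> period_domain_points"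
  then obtain z where z: "L = proj_point z" "complexify rho *v z = \<i> *s z" "Re (T_form z (cnj_vec z)) > 0"
    by (auto simp: period_domain_points_def)
  define a b where "a = z $ 1" and "b = z $ 3"
  have ze: "z = eigvec a b" using z(2) unfolding rho_eigenspace a_def b_def .
  have "(cmod b)\<^sup>2 > (cmod a)\<^sup>2" using z(3) by (simp add: ze Re_T_form_eigvec)
  then have ab: "b \<noteq> a" by auto
  define t where "t = (a + \<i> * b) / ((1 - \<i>) * (b - a))"
  have "Re (T_form z (cnj_vec z)) = (cmod ((b - a) / (1 + \<i>)))\<^sup>2 * (16 * Im t)"
    unfolding ze eigvec_eq_period_vec[OF ab] T_form_scale Re_T_form_period_vec t_def ..
  then have "Im t > 0" using z(3) by (simp add: zero_less_mult_iff)
  moreover have "L = period_map t" unfolding z(1) ze t_def by (rule proj_point_eigvec[OF ab])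
  ultimately show "L \<in> period_map ` uhp" by blast
next
  fix L assume "L \<in> period_map ` uhp"
  then obtain t where t: "Im t > 0" "L = proj_point (period_vec t)" by (auto simp: period_map_def)
  have "complexify rho *v period_vec t = \<i> *s period_vec t"
    unfolding rho_eigenspace by (simp add: period_vec_def)
  then show "L \<in> period_domain_points"
    unfolding period_domain_points_def using t by (auto simp: Re_T_form_period_vec)
qed

section \<open>The action of the isometry group on the period domain\<close>

lemma complexify_mult: "complexify (A ** B) = complexify A ** complexify B"
  by (simp add: complexify_def vec_eq_iff matrix_matrix_mult_def map_matrix_def)

lemma image_proj_point: "(*v) A ` proj_point z = proj_point (A *v z)"
proof -
  have "A *v (c *s z) = c *s (A *v z)" for c by (simp add: vec_eq_iff matrix_vector_mult_def sum_distrib_left algebra_simps)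
  then show ?thesis unfolding proj_point_eq by (auto simp: image_image)
qed

lemma Gamma_rho_commute: "\<gamma> \<in> Gamma_rho \<Longrightarrow> (\<gamma> ** rho) $ i $ j = (rho ** \<gamma>) $ i $ j"
  by (simp add: Gamma_rho_def)

lemma Gamma_rho_blocks:
  fixes \<gamma> :: "int ^ 4 ^ 4"
  assumes "\<gamma> \<in> Gamma_rho"
  shows "\<gamma> $ 1 $ 2 = - (\<gamma> $ 2 $ 1)" "\<gamma> $ 2 $ 2 = \<gamma> $ 1 $ 1" "\<gamma> $ 1 $ 4 = - (\<gamma> $ 2 $ 3)" "\<gamma> $ 2 $ 4 = \<gamma> $ 1 $ 3"
    "\<gamma> $ 3 $ 2 = - (\<gamma> $ 4 $ 1)" "\<gamma> $ 4 $ 2 = \<gamma> $ 3 $ 1" "\<gamma> $ 3 $ 4 = - (\<gamma> $ 4 $ 3)" "\<gamma> $ 4 $ 4 = \<gamma> $ 3 $ 3"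
  using Gamma_rho_commute[OF assms, of 1 1] Gamma_rho_commute[OF assms, of 1 2]
    Gamma_rho_commute[OF assms, of 1 3] Gamma_rho_commute[OF assms, of 1 4]
    Gamma_rho_commute[OF assms, of 3 1] Gamma_rho_commute[OF assms, of 3 2]
    Gamma_rho_commute[OF assms, of 3 3] Gamma_rho_commute[OF assms, of 3 4]
  by (simp_all add: matrix_matrix_mult_def sum_4 rho_nth)

lemma Gamma_rho_norm_equations:
  fixes \<gamma> :: "int ^ 4 ^ 4"
  assumes g: "\<gamma> \<in> Gamma_rho"
  defines "p1 \<equiv> \<gamma> $ 1 $ 1" and "p2 \<equiv> \<gamma> $ 2 $ 1" and "q1 \<equiv> \<gamma> $ 1 $ 3" and "q2 \<equiv> \<gamma> $ 2 $ 3"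
    and "r1 \<equiv> \<gamma> $ 3 $ 1" and "r2 \<equiv> \<gamma> $ 4 $ 1" and "s1 \<equiv> \<gamma> $ 3 $ 3" and "s2 \<equiv> \<gamma> $ 4 $ 3"
  shows "p1\<^sup>2 + p2\<^sup>2 - r1\<^sup>2 - r2\<^sup>2 = 1" "s1\<^sup>2 + s2\<^sup>2 - q1\<^sup>2 - q2\<^sup>2 = 1"
    "p1 * q1 + p2 * q2 = r1 * s1 + r2 * s2" "p1 * q2 - p2 * q1 = r1 * s2 - r2 * s1"
proof -
  have T: "T_form (\<gamma> *v x) (\<gamma> *v y) = T_form x y" for x y
    using g by (simp add: Gamma_rho_def O_T_def)
  let ?e1 = "vector [1, 0, 0, 0] :: int ^ 4" and ?e3 = "vector [0, 0, 1, 0] :: int ^ 4" and ?e4 = "vector [0, 0, 0, 1] :: int ^ 4"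
  note defs = T_form_def matrix_vector_mult_def sum_4 Gamma_rho_blocks[OF g] power2_eq_square
    p1_def p2_def q1_def q2_def r1_def r2_def s1_def s2_def
  show "p1\<^sup>2 + p2\<^sup>2 - r1\<^sup>2 - r2\<^sup>2 = 1" using T[of ?e1 ?e1] by (simp add: defs)
  show "s1\<^sup>2 + s2\<^sup>2 - q1\<^sup>2 - q2\<^sup>2 = 1" using T[of ?e3 ?e3] by (simp add: defs)
  show "p1 * q1 + p2 * q2 = r1 * s1 + r2 * s2" using T[of ?e1 ?e3] by (simp add: defs)
  show "p1 * q2 - p2 * q1 = r1 * s2 - r2 * s1" using T[of ?e1 ?e4] by (simp add: defs)
qed

lemma int_sum_two_squares_eq_1:
  fixes a b :: int
  assumes "a\<^sup>2 + b\<^sup>2 = 1"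
  shows "(a = 1 \<and> b = 0) \<or> (a = -1 \<and> b = 0) \<or> (a = 0 \<and> b = 1) \<or> (a = 0 \<and> b = -1)"
proof -
  have "a\<^sup>2 \<le> 1" "b\<^sup>2 \<le> 1" using assms zero_le_power2[of a] zero_le_power2[of b] by linarith+
  then have "\<bar>a\<bar> \<le> 1" "\<bar>b\<bar> \<le> 1" using abs_square_le_1 by blast+
  then have "a \<in> {-1, 0, 1}" "b \<in> {-1, 0, 1}" by auto
  then show ?thesis using assms by auto
qed

text \<open>
  The unit \<open>\<delta> = d1 + \<i> d2\<close> is the determinant \<open>p s - q r\<close>. Unitarity computes the inverse
  matrix, which gives \<open>s = \<delta> cnj p\<close> and \<open>r = \<delta> cnj q\<close>; comparing the norms of the rows and the columns
  then yields \<open>|\<delta>| = 1\<close>.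
\<close>

lemma gaussian_unitary:
  fixes p1 p2 q1 q2 r1 r2 s1 s2 :: int
  assumes 1: "p1\<^sup>2 + p2\<^sup>2 - r1\<^sup>2 - r2\<^sup>2 = 1" and 2: "s1\<^sup>2 + s2\<^sup>2 - q1\<^sup>2 - q2\<^sup>2 = 1"
    and 3: "p1 * q1 + p2 * q2 = r1 * s1 + r2 * s2" and 4: "p1 * q2 - p2 * q1 = r1 * s2 - r2 * s1"
  obtains d1 d2 :: int where "(d1 = 1 \<and> d2 = 0) \<or> (d1 = -1 \<and> d2 = 0) \<or> (d1 = 0 \<and> d2 = 1) \<or> (d1 = 0 \<and> d2 = -1)"
    "s1 = d1 * p1 + d2 * p2" "s2 = d2 * p1 - d1 * p2" "r1 = d1 * q1 + d2 * q2" "r2 = d2 * q1 - d1 * q2"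
    "p1\<^sup>2 + p2\<^sup>2 - q1\<^sup>2 - q2\<^sup>2 = 1"
proof -
  define d1 d2 where "d1 = p1 * s1 - p2 * s2 - (q1 * r1 - q2 * r2)" and "d2 = p1 * s2 + p2 * s1 - (q1 * r2 + q2 * r1)"
  have s: "s1 = d1 * p1 + d2 * p2" "s2 = d2 * p1 - d1 * p2"
    unfolding d1_def d2_def using 1 3 4 by algebra+
  have r: "r1 = d1 * q1 + d2 * q2" "r2 = d2 * q1 - d1 * q2"
    unfolding d1_def d2_def using 2 3 4 by algebra+
  define D P Q where "D = d1\<^sup>2 + d2\<^sup>2" and "P = p1\<^sup>2 + p2\<^sup>2" and "Q = q1\<^sup>2 + q2\<^sup>2"
  have "P - D * Q = 1" using 1 unfolding r D_def P_def Q_def by algebra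
  moreover have "D * P - Q = 1" using 2 unfolding s D_def P_def Q_def by algebra
  ultimately have "(D - 1) * (P + Q) = 0" by algebra
  moreover have "P + Q > 0"
  proof -
    have "Q \<ge> 0" "D \<ge> 0" unfolding Q_def D_def by auto
    then have "D * Q \<ge> 0" by simp
    then show ?thesis using \<open>P - D * Q = 1\<close> \<open>Q \<ge> 0\<close> by linarith
  qed
  ultimately have D: "D = 1" by auto
  then have "P - Q = 1" using \<open>P - D * Q = 1\<close> by simp
  then have "p1\<^sup>2 + p2\<^sup>2 - q1\<^sup>2 - q2\<^sup>2 = 1" by (simp add: P_def Q_def)
  then show ?thesis using that[of d1 d2] s r int_sum_two_squares_eq_1[of d1 d2] D by (auto simp: D_def)
qed

text \<open>
  Numerator and denominator of \<open>period_coord\<close> at the image of \<open>period_vec t\<close> under the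
  matrix with rows \<open>(p, q)\<close> and \<open>(r, s)\<close>.
\<close>

definition moebius_num :: "complex \<Rightarrow> complex \<Rightarrow> complex \<Rightarrow> complex \<Rightarrow> complex \<Rightarrow> complex" where
  "moebius_num p q r s t = (p * ((1 - \<i>) * t - \<i>) + q * ((1 - \<i>) * t + 1)) + \<i> * (r * ((1 - \<i>) * t - \<i>) + s * ((1 - \<i>) * t + 1))"

definition moebius_den :: "complex \<Rightarrow> complex \<Rightarrow> complex \<Rightarrow> complex \<Rightarrow> complex \<Rightarrow> complex" where
  "moebius_den p q r s t = (1 - \<i>) * ((r * ((1 - \<i>) * t - \<i>) + s * ((1 - \<i>) * t + 1)) - (p * ((1 - \<i>) * t - \<i>) + q * ((1 - \<i>) * t + 1)))"

lemma image_period_map: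
  fixes \<gamma> :: "int ^ 4 ^ 4"
  assumes g: "\<gamma> \<in> Gamma_rho"
  defines "p \<equiv> of_int (\<gamma> $ 1 $ 1) + \<i> * of_int (\<gamma> $ 2 $ 1)" and "q \<equiv> of_int (\<gamma> $ 1 $ 3) + \<i> * of_int (\<gamma> $ 2 $ 3)"
    and "r \<equiv> of_int (\<gamma> $ 3 $ 1) + \<i> * of_int (\<gamma> $ 4 $ 1)" and "s \<equiv> of_int (\<gamma> $ 3 $ 3) + \<i> * of_int (\<gamma> $ 4 $ 3)"
  assumes nz: "moebius_den p q r s t \<noteq> 0"
  shows "(*v) (complexify \<gamma>) ` period_map t = period_map (moebius_num p q r s t / moebius_den p q r s t)"
proof -
  let ?a = "p * ((1 - \<i>) * t - \<i>) + q * ((1 - \<i>) * t + 1)" and ?b = "r * ((1 - \<i>) * t - \<i>) + s * ((1 - \<i>) * t + 1)"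
  have "complexify \<gamma> *v eigvec a b = eigvec (p * a + q * b) (r * a + s * b)" for a b
    unfolding vec_eq_iff[of "complexify \<gamma> *v eigvec a b"] forall_4 complexify_mult_vec sum_4
      p_def q_def r_def s_def Gamma_rho_blocks[OF g]
    by (simp add: complex_eq_iff algebra_simps)
  then have "(*v) (complexify \<gamma>) ` period_map t = proj_point (eigvec ?a ?b)"
    unfolding period_map_def image_proj_point period_vec_def by simp
  moreover have "?b \<noteq> ?a" using nz by (auto simp: moebius_den_def)
  then have "proj_point (eigvec ?a ?b) = period_map (moebius_num p q r s t / moebius_den p q r s t)"
    unfolding moebius_num_def moebius_den_def by (rule proj_point_eigvec)
  ultimately show ?thesis by (rule trans)
qed

lemma moebius_scale:
  "moebius_num (c * p) (c * q) (c * r) (c * s) t = c * moebius_num p q r s t"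
  "moebius_den (c * p) (c * q) (c * r) (c * s) t = c * moebius_den p q r s t"
  by (simp_all add: moebius_num_def moebius_den_def algebra_simps)

text \<open>
  Conjugating a special unitary matrix by the Cayley transform gives, up to the factor \<open>2\<close>, the integral
  matrix written out in the proof; its determinant is \<open>|p|\<^sup>2 - |q|\<^sup>2 = 1\<close>.
\<close>

lemma moebius_SU:
  fixes p1 p2 q1 q2 :: int
  assumes "p1\<^sup>2 + p2\<^sup>2 - q1\<^sup>2 - q2\<^sup>2 = 1"
  defines "p \<equiv> of_int p1 + \<i> * of_int p2" and "q \<equiv> of_int q1 + \<i> * of_int q2"
  shows "\<exists>a b c d. fricke_mat a b c d \<and> moebius_num p q (cnj q) (cnj p) t = 2 * (of_int a * t + of_int b) \<and>
     moebius_den p q (cnj q) (cnj p) t = 2 * (of_int c * t + of_int d)"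
proof (intro exI conjI)
  show "fricke_mat (p1 + q1 + p2 + q2) (q1 + p2) (- 2 * (p2 + q2)) (p1 - q1 - p2 - q2)"
    using assms(1) by (auto simp: fricke_mat_def power2_eq_square algebra_simps)
  show "moebius_num p q (cnj q) (cnj p) t = 2 * (of_int (p1 + q1 + p2 + q2) * t + of_int (q1 + p2))"
    and "moebius_den p q (cnj q) (cnj p) t = 2 * (of_int (- 2 * (p2 + q2)) * t + of_int (p1 - q1 - p2 - q2))"
    by (simp_all add: moebius_num_def moebius_den_def p_def q_def complex_eq_iff algebra_simps)
qed

text \<open>
  For determinant \<open>\<i>\<close> the same product of matrices has determinant \<open>4 \<i>\<close> and the common factor \<open>1 + \<i>\<close>, whose
  square is \<open>2 \<i>\<close>, so the integral matrix has determinant \<open>2\<close> and lies in the Fricke coset.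
\<close>

lemma moebius_det_i:
  fixes p1 p2 q1 q2 :: int
  assumes "p1\<^sup>2 + p2\<^sup>2 - q1\<^sup>2 - q2\<^sup>2 = 1"
  defines "p \<equiv> of_int p1 + \<i> * of_int p2" and "q \<equiv> of_int q1 + \<i> * of_int q2"
  shows "\<exists>a b c d. fricke_mat a b c d \<and> moebius_num p q (\<i> * cnj q) (\<i> * cnj p) t = (1 + \<i>) * (of_int a * t + of_int b) \<and>
     moebius_den p q (\<i> * cnj q) (\<i> * cnj p) t = (1 + \<i>) * (of_int c * t + of_int d)"
proof (intro exI conjI)
  show "fricke_mat (2 * (p2 + q2)) (p2 + q2 + q1 - p1) (2 * (p1 + q1 - p2 - q2)) (2 * (p1 - q2))"
    using assms(1) by (auto simp: fricke_mat_def power2_eq_square algebra_simps)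
  show "moebius_num p q (\<i> * cnj q) (\<i> * cnj p) t = (1 + \<i>) * (of_int (2 * (p2 + q2)) * t + of_int (p2 + q2 + q1 - p1))"
    and "moebius_den p q (\<i> * cnj q) (\<i> * cnj p) t = (1 + \<i>) * (of_int (2 * (p1 + q1 - p2 - q2)) * t + of_int (2 * (p1 - q2)))"
    by (simp_all add: moebius_num_def moebius_den_def p_def q_def complex_eq_iff algebra_simps)
qed

text \<open>
  Multiplying a matrix by \<open>\<i>\<close> changes the sign of its determinant but not its action on lines, which
  reduces the four possible determinants to \<open>1\<close> and \<open>\<i>\<close>.
\<close>

lemma Gamma_rho_acts_by_fricke_rel:
  fixes \<gamma> :: "int ^ 4 ^ 4"
  assumes g: "\<gamma> \<in> Gamma_rho" and t: "Im t > 0"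
  shows "\<exists>w. fricke_rel t w \<and> (*v) (complexify \<gamma>) ` period_map t = period_map w"
proof -
  define p1 p2 q1 q2 r1 r2 s1 s2 where d: "p1 = \<gamma> $ 1 $ 1" "p2 = \<gamma> $ 2 $ 1" "q1 = \<gamma> $ 1 $ 3" "q2 = \<gamma> $ 2 $ 3"
    "r1 = \<gamma> $ 3 $ 1" "r2 = \<gamma> $ 4 $ 1" "s1 = \<gamma> $ 3 $ 3" "s2 = \<gamma> $ 4 $ 3"
  define p q r s :: complex where c: "p = of_int p1 + \<i> * of_int p2" "q = of_int q1 + \<i> * of_int q2"
    "r = of_int r1 + \<i> * of_int r2" "s = of_int s1 + \<i> * of_int s2"
  obtain d1 d2 where \<delta>: "(d1 = 1 \<and> d2 = 0) \<or> (d1 = -1 \<and> d2 = 0) \<or> (d1 = 0 \<and> d2 = 1) \<or> (d1 = 0 \<and> d2 = -1)"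
    and sr: "s1 = d1 * p1 + d2 * p2" "s2 = d2 * p1 - d1 * p2" "r1 = d1 * q1 + d2 * q2" "r2 = d2 * q1 - d1 * q2"
    and n: "p1\<^sup>2 + p2\<^sup>2 - q1\<^sup>2 - q2\<^sup>2 = 1"
    by (rule gaussian_unitary[OF Gamma_rho_norm_equations[OF g, folded d]])
  have n': "(- p2)\<^sup>2 + p1\<^sup>2 - (- q2)\<^sup>2 - q1\<^sup>2 = 1" using n by simp
  define ip iq :: complex where i: "ip = of_int (- p2) + \<i> * of_int p1" "iq = of_int (- q2) + \<i> * of_int q1"
  have ipq: "p = (- \<i>) * ip" "q = (- \<i>) * iq" by (simp_all add: c i complex_eq_iff)
  have "\<exists>a b c d k. k \<noteq> 0 \<and> fricke_mat a b c d \<and> moebius_num p q r s t = k * (of_int a * t + of_int b) \<and>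
     moebius_den p q r s t = k * (of_int c * t + of_int d)"
    using \<delta>
  proof (elim disjE)
    assume "d1 = 1 \<and> d2 = 0"
    then have rs: "r = cnj q" "s = cnj p" by (simp_all add: c sr complex_eq_iff)
    have "(2 :: complex) \<noteq> 0" by simp
    then show ?thesis unfolding rs using moebius_SU[OF n, of t, folded c] by blast
  next
    assume "d1 = 0 \<and> d2 = 1"
    then have rs: "r = \<i> * cnj q" "s = \<i> * cnj p" by (simp_all add: c sr complex_eq_iff)
    show ?thesis unfolding rs using moebius_det_i[OF n, of t, folded c] one_i_nonzero(2) by blast
  next
    assume "d1 = -1 \<and> d2 = 0"
    then have rs: "r = (- \<i>) * cnj iq" "s = (- \<i>) * cnj ip" by (simp_all add: c i sr complex_eq_iff)
    have nz: "(- \<i>) * 2 \<noteq> (0::complex)" by simp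
    obtain a b e f where h: "fricke_mat a b e f"
      "moebius_num ip iq (cnj iq) (cnj ip) t = 2 * (of_int a * t + of_int b)"
      "moebius_den ip iq (cnj iq) (cnj ip) t = 2 * (of_int e * t + of_int f)"
      using moebius_SU[OF n', of t, folded i] by blast
    show ?thesis unfolding rs ipq moebius_scale h(2,3)
      by (intro exI[of _ a] exI[of _ b] exI[of _ e] exI[of _ f] exI[of _ "(- \<i>) * 2"] conjI nz h(1))
         (simp_all only: mult.assoc)
  next
    assume "d1 = 0 \<and> d2 = -1"
    then have rs: "r = (- \<i>) * (\<i> * cnj iq)" "s = (- \<i>) * (\<i> * cnj ip)" by (simp_all add: c i sr complex_eq_iff)
    have nz: "(- \<i>) * (1 + \<i>) \<noteq> (0::complex)" by simp
    obtain a b e f where h: "fricke_mat a b e f"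
      "moebius_num ip iq (\<i> * cnj iq) (\<i> * cnj ip) t = (1 + \<i>) * (of_int a * t + of_int b)"
      "moebius_den ip iq (\<i> * cnj iq) (\<i> * cnj ip) t = (1 + \<i>) * (of_int e * t + of_int f)"
      using moebius_det_i[OF n', of t, folded i] by blast
    show ?thesis unfolding rs ipq moebius_scale h(2,3)
      by (intro exI[of _ a] exI[of _ b] exI[of _ e] exI[of _ f] exI[of _ "(- \<i>) * (1 + \<i>)"] conjI nz h(1))
         (simp_all only: mult.assoc)
  qed
  then obtain a b e f k where k: "k \<noteq> 0" and M: "fricke_mat a b e f"
    and num: "moebius_num p q r s t = k * (of_int a * t + of_int b)"
    and den: "moebius_den p q r s t = k * (of_int e * t + of_int f)" by blast
  have "moebius_den p q r s t \<noteq> 0" using den k fricke_mat_denom_nonzero[OF M t] by simp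
  then have "(*v) (complexify \<gamma>) ` period_map t = period_map (moebius_num p q r s t / moebius_den p q r s t)"
    unfolding c d by (rule image_period_map[OF g])
  also have "moebius_num p q r s t / moebius_den p q r s t = int_moebius a b e f t"
    unfolding num den int_moebius_def by (rule mult_divide_mult_cancel_left[OF k])
  finally show ?thesis using M unfolding fricke_rel_def by blast
qed

text \<open>
  The integral \<open>4 \<times> 4\<close> matrix of the Gaussian matrix with rows \<open>(p, q)\<close> and \<open>(r, s)\<close>. Inverting
  the formulas in \<open>moebius_SU\<close> and \<open>moebius_det_i\<close> for the matrices of \<open>T\<close>, its inverse and \<open>W\<close> gives the
  entries used below.
\<close>

definition gauss_mat :: "int \<Rightarrow> int \<Rightarrow> int \<Rightarrow> int \<Rightarrow> int \<Rightarrow> int \<Rightarrow> int \<Rightarrow> int \<Rightarrow> int ^ 4 ^ 4" where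
  "gauss_mat p1 p2 q1 q2 r1 r2 s1 s2 =
     vector [vector [p1, - p2, q1, - q2], vector [p2, p1, q2, q1], vector [r1, - r2, s1, - s2], vector [r2, r1, s2, s1]]"

lemma Gamma_rho_T: "gauss_mat 1 1 0 (-1) 0 1 1 (-1) \<in> Gamma_rho" (is "?A \<in> _")
  and Gamma_rho_T_inverse: "gauss_mat 1 (-1) 0 1 0 (-1) 1 1 \<in> Gamma_rho" (is "?B \<in> _")
proof -
  have inv: "?A ** ?B = mat 1" "?B ** ?A = mat 1"
    by (simp_all add: gauss_mat_def vec_eq_iff forall_4 matrix_matrix_mult_def sum_4 mat_def)
  then have "invertible ?A" "invertible ?B" unfolding invertible_def by blast+
  then show "?A \<in> Gamma_rho" "?B \<in> Gamma_rho"
    by (simp_all add: Gamma_rho_def O_T_def gauss_mat_def T_form_def vec_eq_iff forall_4 matrix_matrix_mult_def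
        matrix_vector_mult_def sum_4 rho_nth algebra_simps)
qed

lemma Gamma_rho_W: "gauss_mat 1 (-1) 0 1 1 0 (-1) 1 \<in> Gamma_rho" (is "?A \<in> _")
proof -
  let ?B = "gauss_mat 1 1 (-1) 0 0 1 (-1) (-1)"
  have inv: "?A ** ?B = mat 1" "?B ** ?A = mat 1"
    by (simp_all add: gauss_mat_def vec_eq_iff forall_4 matrix_matrix_mult_def sum_4 mat_def)
  then have "invertible ?A" unfolding invertible_def by blast
  then show "?A \<in> Gamma_rho"
    by (simp add: Gamma_rho_def O_T_def gauss_mat_def T_form_def vec_eq_iff forall_4 matrix_matrix_mult_def
        matrix_vector_mult_def sum_4 rho_nth algebra_simps)
qed

lemma Gamma_rho_mult:
  assumes "A \<in> Gamma_rho" "B \<in> Gamma_rho" shows "A ** B \<in> Gamma_rho"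
proof -
  have A: "A ** rho = rho ** A" and B: "B ** rho = rho ** B" using assms by (simp_all add: Gamma_rho_def)
  have "A ** B ** rho = A ** (B ** rho)" by (rule matrix_mul_assoc[symmetric])
  also have "\<dots> = A ** rho ** B" unfolding B by (rule matrix_mul_assoc)
  also have "\<dots> = rho ** (A ** B)" unfolding A by (rule matrix_mul_assoc[symmetric])
  finally have "A ** B ** rho = rho ** (A ** B)" .
  then show ?thesis
    using assms by (simp add: Gamma_rho_def O_T_def invertible_mult matrix_vector_mul_assoc[symmetric])
qed

lemma Gamma_rho_one: "mat 1 \<in> Gamma_rho"
  by (simp add: Gamma_rho_def O_T_def invertible_def)

lemma Gamma_rho_generators_act:
  assumes "Im t > 0"
  shows "\<exists>\<gamma>\<in>Gamma_rho. (*v) (complexify \<gamma>) ` period_map t = period_map (t + 1)"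
    and "\<exists>\<gamma>\<in>Gamma_rho. (*v) (complexify \<gamma>) ` period_map t = period_map (t - 1)"
    and "\<exists>\<gamma>\<in>Gamma_rho. (*v) (complexify \<gamma>) ` period_map t = period_map (- 1 / (2 * t))"
proof -
  have t0: "t \<noteq> 0" using assms by auto
  have T: "moebius_num (1 + \<i>) (- \<i>) \<i> (1 - \<i>) t = 2 * (t + 1)" "moebius_den (1 + \<i>) (- \<i>) \<i> (1 - \<i>) t = 2"
    and T': "moebius_num (1 - \<i>) \<i> (- \<i>) (1 + \<i>) t = 2 * (t - 1)" "moebius_den (1 - \<i>) \<i> (- \<i>) (1 + \<i>) t = 2"
    and W: "moebius_num (1 - \<i>) \<i> 1 (\<i> - 1) t = - (1 + \<i>)" "moebius_den (1 - \<i>) \<i> 1 (\<i> - 1) t = (1 + \<i>) * (2 * t)"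
    by (simp_all add: moebius_num_def moebius_den_def complex_eq_iff algebra_simps)
  have W2: "(- 1 - \<i>) / ((1 + \<i>) * (2 * t)) = - (1 / (2 * t))"
    using mult_divide_mult_cancel_left[OF one_i_nonzero(2), of "- 1" "2 * t"] by simp
  show "\<exists>\<gamma>\<in>Gamma_rho. (*v) (complexify \<gamma>) ` period_map t = period_map (t + 1)"
    by (rule bexI[OF _ Gamma_rho_T], subst image_period_map[OF Gamma_rho_T]) (simp_all add: gauss_mat_def T add_divide_distrib)
  show "\<exists>\<gamma>\<in>Gamma_rho. (*v) (complexify \<gamma>) ` period_map t = period_map (t - 1)"
    by (rule bexI[OF _ Gamma_rho_T_inverse], subst image_period_map[OF Gamma_rho_T_inverse]) (simp_all add: gauss_mat_def T' diff_divide_distrib)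
  show "\<exists>\<gamma>\<in>Gamma_rho. (*v) (complexify \<gamma>) ` period_map t = period_map (- 1 / (2 * t))"
    by (rule bexI[OF _ Gamma_rho_W], subst image_period_map[OF Gamma_rho_W]) (simp_all add: gauss_mat_def W W2 t0)
qed

lemma Gamma_rho_image_comp:
  "(*v) (complexify A) ` (*v) (complexify B) ` L = (*v) (complexify (A ** B)) ` L"
  by (simp add: image_image complexify_mult matrix_vector_mul_assoc)

text \<open>
  The isometries act through the relation \<open>fricke_rel\<close>. Conversely, the generators \<open>T\<close> and \<open>W\<close> lift
  to isometries, and the descent extends this to the whole relation.
\<close>

lemma Gamma_rho_orbit:
  assumes t: "Im t > 0"
  shows "(\<lambda>\<gamma>. (*v) (complexify \<gamma>) ` period_map t) ` Gamma_rho = period_map ` {w. fricke_rel t w}"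
proof (intro equalityI subsetI)
  fix L assume "L \<in> (\<lambda>\<gamma>. (*v) (complexify \<gamma>) ` period_map t) ` Gamma_rho"
  then show "L \<in> period_map ` {w. fricke_rel t w}" using Gamma_rho_acts_by_fricke_rel[OF _ t] by blast
next
  fix L assume "L \<in> period_map ` {w. fricke_rel t w}"
  then obtain w where w: "fricke_rel t w" "L = period_map w" by blast
  let ?P = "\<lambda>w. \<exists>\<gamma>\<in>Gamma_rho. (*v) (complexify \<gamma>) ` period_map t = period_map w"
  have step: "?P v" if "?P u" "\<exists>\<gamma>\<in>Gamma_rho. (*v) (complexify \<gamma>) ` period_map u = period_map v" for u v
    using that Gamma_rho_mult Gamma_rho_image_comp by metis
  have "?P w"
  proof (rule fricke_rel_induct[OF w(1) t])
    have "complexify (mat 1) = mat 1" by (simp add: complexify_def vec_eq_iff map_matrix_def mat_def)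
    then have "(*v) (complexify (mat 1)) ` period_map t = period_map t" by simp
    then show "?P t" using Gamma_rho_one by blast
  next
    fix u assume u: "Im u > 0" "?P u"
    show "?P (u + 1)" by (rule step[OF u(2) Gamma_rho_generators_act(1)[OF u(1)]])
    show "?P (u - 1)" by (rule step[OF u(2) Gamma_rho_generators_act(2)[OF u(1)]])
    show "?P (- 1 / (2 * u))" by (rule step[OF u(2) Gamma_rho_generators_act(3)[OF u(1)]])
  qed
  then show "L \<in> (\<lambda>\<gamma>. (*v) (complexify \<gamma>) ` period_map t) ` Gamma_rho" using w(2) by auto
qed

section \<open>The moduli space is the Fricke curve\<close>

text \<open>
  Open sets of the projective space to which functions of the coordinate on the period domain extend.
\<close>

definition coord_chart :: "complex set \<Rightarrow> (complex ^ 4) set set" where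
  "coord_chart W = proj_point ` {z :: complex ^ 4. z $ 3 \<noteq> z $ 1 \<and> period_coord z \<in> W}"

lemma proj_point_in_coord_chart:
  assumes "z \<noteq> 0"
  shows "proj_point z \<in> coord_chart W \<longleftrightarrow> z $ 3 \<noteq> z $ 1 \<and> period_coord z \<in> W"
proof
  assume "proj_point z \<in> coord_chart W"
  then obtain w :: "complex ^ 4" where w: "proj_point z = proj_point w" "w $ 3 \<noteq> w $ 1" "period_coord w \<in> W"
    by (auto simp: coord_chart_def)
  have "z \<in> proj_point w" using mem_proj_point_self[of z] unfolding w(1) .
  then obtain c where "c \<noteq> 0" "z = c *s w" using mem_proj_point assms by blast
  then show "z $ 3 \<noteq> z $ 1 \<and> period_coord z \<in> W" using w by (simp add: period_coord_scale)
qed (auto simp: coord_chart_def)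

lemma period_coord_has_derivative:
  fixes z :: "complex ^ 4"
  assumes "z $ 3 \<noteq> z $ 1"
  obtains D where "(period_coord has_derivative D) (at z)" "\<And>c v. D (c *s v) = c * D v"
proof -
  let ?N = "\<lambda>z :: complex ^ 4. z $ 1 + \<i> * z $ 3" and ?M = "\<lambda>z :: complex ^ 4. (1 - \<i>) * (z $ 3 - z $ 1)"
  have N: "(?N has_derivative ?N) (at z)" and M: "(?M has_derivative ?M) (at z)"
    by (intro has_derivative_add has_derivative_mult_right has_derivative_diff
        bounded_linear_imp_has_derivative bounded_linear_vec_nth)+
  have "?M z \<noteq> 0" using assms by simp
  from has_derivative_divide'[OF N M this]
  have "(period_coord has_derivative (\<lambda>v. (?N v * ?M z - ?N z * ?M v) / (?M z * ?M z))) (at z)"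
    by (simp only: period_coord_def[abs_def])
  then show ?thesis by (rule that) (simp add: algebra_simps add_divide_distrib diff_divide_distrib)
qed

lemma open_period_coord_preimage:
  assumes "open W"
  shows "open {z :: complex ^ 4. z $ 3 \<noteq> z $ 1 \<and> period_coord z \<in> W}"
proof -
  let ?S = "{z :: complex ^ 4. z $ 3 \<noteq> z $ 1}"
  have S: "open ?S" by (intro open_Collect_neq continuous_intros)
  have "continuous_on ?S period_coord"
    by (intro continuous_at_imp_continuous_on ballI)
       (auto elim: period_coord_has_derivative intro: has_derivative_continuous)
  from continuous_open_preimage[OF this S assms] show ?thesis by (simp add: vimage_def Int_def)
qed

lemma top_of_affine_space [simp]: "top_of affine_space = euclidean"
  by (simp add: affine_space_def)

lemma top_of_punctured_space: "top_of (fs_restrict affine_space (- {0})) = top_of_set (- {0})"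
  by simp

lemma points_projective_space: "points projective_space = proj_point ` (- {0})"
  by (simp add: projective_space_def points_def top_of_punctured_space)

lemma openin_projective_space:
  "openin (top_of projective_space) V \<longleftrightarrow> V \<subseteq> proj_point ` (- {0}) \<and> open {z. z \<noteq> 0 \<and> proj_point z \<in> V}"
proof -
  have "{z \<in> topspace (top_of_set (- {0})). proj_point z \<in> V} = {z. z \<noteq> 0 \<and> proj_point z \<in> V}" by auto
  moreover have "openin (top_of_set (- {0})) {z. z \<noteq> 0 \<and> proj_point z \<in> V} \<longleftrightarrow> open {z. z \<noteq> 0 \<and> proj_point z \<in> V}"
    by (subst openin_open_eq) auto
  ultimately show ?thesis
    unfolding projective_space_def top_of_quotient top_of_punctured_space openin_quotient_topology by simp
qed

lemma regular_projective_space: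
  "g \<in> regular projective_space V \<longleftrightarrow>
     (\<forall>z\<in>{z. z \<noteq> 0 \<and> proj_point z \<in> V}. \<exists>W k. open W \<and> z \<in> W \<and> k \<in> regular affine_space W \<and>
        (\<forall>w\<in>W \<inter> {z. z \<noteq> 0 \<and> proj_point z \<in> V}. g (proj_point w) = k w))"
proof -
  have S: "{z \<in> points (fs_restrict affine_space (- {0})). proj_point z \<in> V} = {z. z \<noteq> 0 \<and> proj_point z \<in> V}"
    by (auto simp: points_def top_of_punctured_space)
  show ?thesis
    unfolding projective_space_def regular_quotient S by (simp only: fs_restrict_def fspace.simps mem_Collect_eq
        top_of_affine_space open_openin[symmetric] o_apply)
qed

lemma openin_coord_chart:
  assumes "open W" shows "openin (top_of projective_space) (coord_chart W)"
  unfolding openin_projective_space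
proof
  show "coord_chart W \<subseteq> proj_point ` (- {0})"
    by (auto simp: coord_chart_def intro!: imageI)
  have "{z. z \<noteq> 0 \<and> proj_point z \<in> coord_chart W} = {z :: complex ^ 4. z $ 3 \<noteq> z $ 1 \<and> period_coord z \<in> W}"
  proof (rule Collect_cong)
    fix z :: "complex ^ 4"
    show "(z \<noteq> 0 \<and> proj_point z \<in> coord_chart W) = (z $ 3 \<noteq> z $ 1 \<and> period_coord z \<in> W)"
      by (cases "z = 0") (simp_all add: proj_point_in_coord_chart)
  qed
  then show "open {z. z \<noteq> 0 \<and> proj_point z \<in> coord_chart W}" using open_period_coord_preimage[OF assms] by simp
qed

lemma regular_coord_chart:
  assumes W: "open W" and f: "f holomorphic_on W"
  shows "f \<circ> line_coord \<in> regular projective_space (coord_chart W)"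
  unfolding regular_projective_space
proof
  fix z :: "complex ^ 4"
  assume "z \<in> {z. z \<noteq> 0 \<and> proj_point z \<in> coord_chart W}"
  then have z: "z \<noteq> 0 \<and> proj_point z \<in> coord_chart W" by simp
  let ?V = "{z :: complex ^ 4. z $ 3 \<noteq> z $ 1 \<and> period_coord z \<in> W}"
  have "f \<circ> period_coord \<in> regular affine_space ?V"
  proof -
    have "\<exists>f'. (f \<circ> period_coord has_derivative f') (at z) \<and> (\<forall>c v. f' (c *s v) = c * f' v)" if "z \<in> ?V" for z
    proof -
      have "z $ 3 \<noteq> z $ 1" using that by simp
      then obtain D where D: "(period_coord has_derivative D) (at z)" "\<And>c v. D (c *s v) = c * D v"
        using period_coord_has_derivative by metis
      have "(f has_field_derivative deriv f (period_coord z)) (at (period_coord z))"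
        using holomorphic_derivI[OF f W] that by blast
      then have "(f has_derivative (*) (deriv f (period_coord z))) (at (period_coord z))"
        by (rule has_field_derivative_imp_has_derivative)
      from diff_chain_at[OF D(1) this]
      have "(f \<circ> period_coord has_derivative (\<lambda>v. deriv f (period_coord z) * D v)) (at z)"
        by (simp add: o_def)
      then show ?thesis by (intro exI conjI) (assumption, simp add: D(2))
    qed
    then show ?thesis by (simp add: affine_space_def)
  qed
  moreover have "z \<in> ?V" using z proj_point_in_coord_chart by blast
  moreover have "(f \<circ> line_coord) (proj_point w) = (f \<circ> period_coord) w" if "w \<in> ?V" for w
  proof -
    have "w \<noteq> 0" using that by auto
    then show ?thesis by (simp add: line_coord_proj_point)
  qed
  ultimately show "\<exists>V k. open V \<and> z \<in> V \<and> k \<in> regular affine_space V \<and>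
      (\<forall>w\<in>V \<inter> {z. z \<noteq> 0 \<and> proj_point z \<in> coord_chart W}. (f \<circ> line_coord) (proj_point w) = k w)"
    using open_period_coord_preimage[OF W] by (intro exI[of _ ?V] exI[of _ "f \<circ> period_coord"]) blast
qed

lemma period_vec_has_derivative:
  "(period_vec has_derivative (\<lambda>h. h *s eigvec (1 - \<i>) (1 - \<i>))) (at t)"
proof -
  have "linear (\<lambda>h::complex. h *s eigvec (1 - \<i>) (1 - \<i>))"
    by (rule linearI) (simp_all add: vec_eq_iff algebra_simps)
  then have "bounded_linear (\<lambda>h::complex. h *s eigvec (1 - \<i>) (1 - \<i>))"
    by (simp add: linear_conv_bounded_linear)
  then have "((\<lambda>t. t *s eigvec (1 - \<i>) (1 - \<i>) + period_vec 0) has_derivative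
      (\<lambda>h. h *s eigvec (1 - \<i>) (1 - \<i>) + 0)) (at t)"
    by (intro has_derivative_add has_derivative_const bounded_linear_imp_has_derivative)
  moreover have "t *s eigvec (1 - \<i>) (1 - \<i>) + period_vec 0 = period_vec t" for t
    by (simp add: vec_eq_iff forall_4 period_vec_def algebra_simps)
  ultimately show ?thesis by simp
qed

lemma continuous_period_vec: "continuous_on A period_vec"
  using has_derivative_continuous[OF period_vec_has_derivative]
  by (intro continuous_at_imp_continuous_on) blast

lemma continuous_map_period_map: "continuous_map euclidean (top_of projective_space) period_map"
proof -
  have "continuous_map euclidean (top_of_set (- {0})) period_vec"
    using continuous_period_vec[of UNIV] by (auto simp: continuous_map_in_subtopology period_vec_nonzero)
  moreover have "continuous_map (top_of_set (- {0})) (top_of projective_space) proj_point"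
    using quotient_imp_continuous_map[OF quotient_map_quotient_topology]
    by (simp only: projective_space_def top_of_quotient top_of_punctured_space)
  ultimately have "continuous_map euclidean (top_of projective_space) (proj_point \<circ> period_vec)"
    by (rule continuous_map_compose)
  then show ?thesis by (simp add: period_map_def[abs_def] o_def)
qed

lemma points_period_domain: "points period_domain = period_map ` uhp"
proof -
  have "period_map t \<in> points projective_space" for t
    unfolding points_projective_space period_map_def by (rule imageI) (simp add: period_vec_nonzero)
  then show ?thesis
    by (auto simp: period_domain_def points_def period_domain_points_eq)
qed

text \<open>
  A regular function on projective space is locally a function of the homogeneous coordinates with
  complex linear derivative, and \<open>period_vec\<close> is an affine lift of \<open>period_map\<close>.
\<close>

lemma regular_along_period_map:
  assumes g: "g \<in> regular projective_space V" and V: "openin (top_of projective_space) V"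
    and t: "period_map t \<in> V"
  shows "(\<lambda>t. g (period_map t)) field_differentiable at t"
proof -
  obtain W k where W: "open W" "period_vec t \<in> W" "k \<in> regular affine_space W"
    and gk: "\<And>w. w \<in> W \<Longrightarrow> w \<noteq> 0 \<Longrightarrow> proj_point w \<in> V \<Longrightarrow> g (proj_point w) = k w"
  proof -
    have "period_vec t \<in> {z. z \<noteq> 0 \<and> proj_point z \<in> V}"
      using t period_vec_nonzero(1)[of t] by (simp add: period_map_def)
    from bspec[OF g[unfolded regular_projective_space] this] show ?thesis using that by blast
  qed
  obtain k' where k': "(k has_derivative k') (at (period_vec t))" "\<And>c v. k' (c *s v) = c * k' v"
    using W(2,3) by (auto simp: affine_space_def)
  from diff_chain_at[OF period_vec_has_derivative k'(1)]
  have "(k \<circ> period_vec has_derivative (\<lambda>h. k' (eigvec (1 - \<i>) (1 - \<i>)) * h)) (at t)"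
    by (simp add: o_def k'(2) mult.commute)
  then have D: "(k \<circ> period_vec has_field_derivative k' (eigvec (1 - \<i>) (1 - \<i>))) (at t)"
    by (simp add: has_field_derivative_def)
  have "open {s. period_vec s \<in> W}"
    using continuous_open_vimage[OF W(1), of period_vec] continuous_period_vec[of UNIV]
    by (simp add: vimage_def continuous_on_eq_continuous_at)
  moreover have "open {s. period_map s \<in> V}"
    using continuous_map_period_map V by (simp add: continuous_map_def)
  ultimately have o: "open ({s. period_vec s \<in> W} \<inter> {s. period_map s \<in> V})" by (rule open_Int)
  have "((\<lambda>t. g (period_map t)) has_field_derivative k' (eigvec (1 - \<i>) (1 - \<i>))) (at t)"
    by (rule has_field_derivative_transform_within_open[OF D o])
       (use W(2) t gk period_vec_nonzero in \<open>simp_all add: period_map_def\<close>)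
  then show ?thesis by (auto simp: field_differentiable_def)
qed

text \<open>
  A holomorphic function of the coordinate extends to a chart of projective space, and conversely
  regular functions stay holomorphic along \<open>period_map\<close>.
\<close>

lemma period_domain_iso: "fspace_iso period_domain upper_half_plane line_coord"
  unfolding fspace_iso_def
proof (intro conjI allI impI)
  let ?H = "uhp"
  have top: "top_of period_domain = subtopology (top_of projective_space) period_domain_points"
    by (simp add: period_domain_def)
  have chart: "{L \<in> points period_domain. line_coord L \<in> U} = coord_chart U \<inter> period_domain_points" for U
  proof -
    have mem_chart: "period_map t \<in> coord_chart U \<longleftrightarrow> t \<in> U" for t
      unfolding period_map_def proj_point_in_coord_chart[OF period_vec_nonzero(1)]
      by (simp add: period_vec_nonzero)
    show ?thesis
    proof (intro equalityI subsetI)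
      fix L assume "L \<in> {L \<in> points period_domain. line_coord L \<in> U}"
      then obtain t where "Im t > 0" "L = period_map t" "t \<in> U" by (auto simp: points_period_domain)
      then show "L \<in> coord_chart U \<inter> period_domain_points"
        using mem_chart period_domain_points_eq by blast
    next
      fix L assume "L \<in> coord_chart U \<inter> period_domain_points"
      then obtain t where "Im t > 0" "L = period_map t" "L \<in> coord_chart U"
        using period_domain_points_eq by blast
      then show "L \<in> {L \<in> points period_domain. line_coord L \<in> U}"
        using mem_chart by (simp add: points_period_domain)
    qed
  qed
  have "homeomorphic_maps (top_of period_domain) (top_of upper_half_plane) line_coord period_map"
    unfolding homeomorphic_maps_def
  proof (intro conjI ballI)
    show "continuous_map (top_of period_domain) (top_of upper_half_plane) line_coord"
      unfolding continuous_map_def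
    proof (intro conjI allI impI)
      show "line_coord \<in> topspace (top_of period_domain) \<rightarrow> topspace (top_of upper_half_plane)"
        using points_period_domain by (auto simp: points_def top_of_upper_half_plane)
      fix U assume "openin (top_of upper_half_plane) U"
      then have "open U" by (simp add: openin_upper_half_plane)
      then show "openin (top_of period_domain) {L \<in> topspace (top_of period_domain). line_coord L \<in> U}"
        unfolding chart[unfolded points_def] unfolding top
        by (intro openin_subtopology_Int openin_coord_chart)
    qed
    show "continuous_map (top_of upper_half_plane) (top_of period_domain) period_map"
      unfolding top top_of_upper_half_plane
      using continuous_map_period_map
      by (auto simp: continuous_map_in_subtopology period_domain_points_eq intro: continuous_map_from_subtopology)
    show "period_map (line_coord L) = L" if "L \<in> topspace (top_of period_domain)" for L
      using that points_period_domain by (auto simp: points_def)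
    show "line_coord (period_map t) = t" for t by simp
  qed
  then show "homeomorphic_map (top_of period_domain) (top_of upper_half_plane) line_coord"
    by (rule homeomorphic_maps_imp_map)
  fix U f assume "openin (top_of upper_half_plane) U"
  then have U: "open U" "U \<subseteq> ?H" by (simp_all add: openin_upper_half_plane)
  let ?D = "{L \<in> points period_domain. line_coord L \<in> U}"
  have reg: "f \<circ> line_coord \<in> regular period_domain ?D \<longleftrightarrow>
     (\<forall>L\<in>?D. \<exists>V g. openin (top_of projective_space) V \<and> L \<in> V \<and> g \<in> regular projective_space V \<and>
        (\<forall>L'\<in>V \<inter> ?D. (f \<circ> line_coord) L' = g L'))"
    by (simp add: period_domain_def fs_restrict_def)
  have "f holomorphic_on U \<longleftrightarrow> f \<circ> line_coord \<in> regular period_domain ?D"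
  proof
    assume f: "f holomorphic_on U"
    show "f \<circ> line_coord \<in> regular period_domain ?D"
      unfolding reg
    proof
      fix L assume "L \<in> ?D"
      then have "L \<in> coord_chart U" unfolding chart by blast
      then show "\<exists>V g. openin (top_of projective_space) V \<and> L \<in> V \<and> g \<in> regular projective_space V \<and>
        (\<forall>L'\<in>V \<inter> ?D. (f \<circ> line_coord) L' = g L')"
        using openin_coord_chart[OF U(1)] regular_coord_chart[OF U(1) f] by blast
    qed
  next
    assume f: "f \<circ> line_coord \<in> regular period_domain ?D"
    have "f field_differentiable at t" if t: "t \<in> U" for t
    proof -
      have D: "period_map s \<in> ?D" if "s \<in> U" for s using that U(2) by (auto simp: points_period_domain)
      obtain V g where Vg: "openin (top_of projective_space) V \<and> period_map t \<in> V \<and> g \<in> regular projective_space V \<and>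
          (\<forall>L'\<in>V \<inter> ?D. (f \<circ> line_coord) L' = g L')"
        using bspec[OF iffD1[OF reg f] D[OF t]] by (elim exE)
      then have V: "openin (top_of projective_space) V" "period_map t \<in> V" "g \<in> regular projective_space V"
        and fg: "\<forall>L'\<in>V \<inter> ?D. (f \<circ> line_coord) L' = g L'"
        by simp_all
      obtain d where d: "((\<lambda>t. g (period_map t)) has_field_derivative d) (at t)"
        using regular_along_period_map[OF V(3,1,2)] by (auto simp: field_differentiable_def)
      have "open {s. period_map s \<in> V}"
        using continuous_map_period_map V(1) by (simp add: continuous_map_def)
      then have o: "open (U \<inter> {s. period_map s \<in> V})" using U(1) by blast
      have "(f has_field_derivative d) (at t)"
      proof (rule has_field_derivative_transform_within_open[OF d o])
        fix s assume "s \<in> U \<inter> {s. period_map s \<in> V}"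
        then have "period_map s \<in> V \<inter> ?D" using D[of s] by blast
        from bspec[OF fg this] show "g (period_map s) = f s" by simp
      qed (use t V(2) in simp)
      then show ?thesis by (auto simp: field_differentiable_def)
    qed
    then show "f holomorphic_on U" by (simp add: holomorphic_on_def field_differentiable_at_within)
  qed
  then show "f \<in> regular upper_half_plane U \<longleftrightarrow> f \<circ> line_coord \<in> regular period_domain ?D"
    by (simp only: regular_upper_half_plane[OF U(1)])
qed

lemma moduli_iso_fricke_curve: "\<exists>h. fspace_iso moduli_M fricke_curve_2 h"
  unfolding moduli_M_def orbit_space_def
proof (rule fs_quotient_iso)
  let ?orb = "\<lambda>z. (\<lambda>g. psl_act g z) ` H2_plus"
  show "value_determined period_domain"
    unfolding period_domain_def by (rule value_determined_restrict)
  have h: "homeomorphic_map (top_of period_domain) (top_of upper_half_plane) line_coord"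
    and reg_h: "\<And>U f. openin (top_of upper_half_plane) U \<Longrightarrow>
      f \<in> regular upper_half_plane U \<longleftrightarrow> f \<circ> line_coord \<in> regular period_domain {L \<in> points period_domain. line_coord L \<in> U}"
    using period_domain_iso unfolding fspace_iso_def by blast+
  have q: "quotient_map (top_of upper_half_plane) (top_of fricke_curve_2) ?orb"
    by (simp add: fricke_curve_2_def orbit_space_def quotient_map_quotient_topology)
  show "quotient_map (top_of period_domain) (top_of fricke_curve_2) (?orb \<circ> line_coord)"
    using h unfolding homeomorphic_map_def by (intro quotient_map_compose[OF _ q]) blast
  show "(?orb \<circ> line_coord) L = (?orb \<circ> line_coord) L' \<longleftrightarrow>
      (\<lambda>\<gamma>. (*v) (complexify \<gamma>) ` L) ` Gamma_rho = (\<lambda>\<gamma>. (*v) (complexify \<gamma>) ` L') ` Gamma_rho"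
    if L: "L \<in> points period_domain" "L' \<in> points period_domain" for L L'
  proof -
    obtain t t' where t: "Im t > 0" "L = period_map t" and t': "Im t' > 0" "L' = period_map t'"
      using L by (auto simp: points_period_domain)
    have inj: "inj period_map" by (rule inj_on_inverseI[of _ line_coord]) simp
    show ?thesis
      unfolding t t' Gamma_rho_orbit[OF t(1)] Gamma_rho_orbit[OF t'(1)] inj_image_eq_iff[OF inj]
      by (simp add: H2_plus_orbit[OF t(1)] H2_plus_orbit[OF t'(1)])
  qed
  fix U u assume U: "openin (top_of fricke_curve_2) U"
  let ?V = "{z \<in> points upper_half_plane. ?orb z \<in> U}"
  have V: "openin (top_of upper_half_plane) ?V"
    using quotient_imp_continuous_map[OF q] U by (simp add: continuous_map_def points_def)
  have img: "line_coord L \<in> points upper_half_plane" if "L \<in> points period_domain" for L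
    using that by (auto simp: points_period_domain points_upper_half_plane)
  have "u \<in> regular fricke_curve_2 U \<longleftrightarrow> u \<circ> ?orb \<in> regular upper_half_plane ?V"
    by (simp add: fricke_curve_2_def orbit_space_def regular_quotient)
  also have "\<dots> \<longleftrightarrow> u \<circ> ?orb \<circ> line_coord \<in> regular period_domain {L \<in> points period_domain. line_coord L \<in> ?V}"
    by (rule reg_h[OF V])
  also have "{L \<in> points period_domain. line_coord L \<in> ?V} = {L \<in> points period_domain. (?orb \<circ> line_coord) L \<in> U}"
    using img by auto
  finally show "u \<in> regular fricke_curve_2 U \<longleftrightarrow>
      u \<circ> (?orb \<circ> line_coord) \<in> regular period_domain {L \<in> points period_domain. (?orb \<circ> line_coord) L \<in> U}"
    unfolding o_assoc .
qed

theorem corollary2p4: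
  shows "rs_isomorphic moduli_M fricke_curve_2 \<and> rs_isomorphic fricke_curve_2 affine_line"
proof -
  obtain f where f: "fspace_iso fricke_curve_2 affine_line f" by (rule fricke_curve_affine_line)
  obtain h where h: "fspace_iso moduli_M fricke_curve_2 h" using moduli_iso_fricke_curve by blast
  have vd: "value_determined fricke_curve_2" "value_determined moduli_M"
    unfolding fricke_curve_2_def moduli_M_def orbit_space_def period_domain_def
    by (intro value_determined_quotient value_determined_upper_half_plane value_determined_restrict)+
  have "riemann_surface affine_line"
    by (rule riemann_surface_if_iso_affine_line[OF value_determined_affine_line fspace_iso_affine_line_id])
  moreover have "riemann_surface fricke_curve_2"
    by (rule riemann_surface_if_iso_affine_line[OF vd(1) f])
  moreover have "riemann_surface moduli_M"
    by (rule riemann_surface_if_iso_affine_line[OF vd(2) fspace_iso_compose[OF h f]])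
  ultimately show ?thesis using f h unfolding rs_isomorphic_def by blast
qed

end
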